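(* Consider the discrete (finite-alphabet) compound secret-key generation model described in the context, with capacity region $\mathcal{R}_{\rm G}$ for the generated-secret (GS) model and $\mathcal{R}_{\rm C}$ for the chosen-secret (CS) model. Then $$\mathcal{R}_{\rm G}\subseteq\bigcap_{k\in\mathcal K}\bigcap_{l\in\mathcal L}\ \bigcup_{P_{V|U},P_{U|\tilde{\mathbf X}}}\Big\{(R_S,R_J,R_L)\in\mathbb R_+^3:\ R_S\le I(\mathbf Y_k;U|V)-I(\mathbf Z_l;U|V),\ R_J\ge I(\tilde{\mathbf X};U|\mathbf Y_k),\ R_L\ge I(X;U|\mathbf Y_k)+I(\mathbf Y_k;V)-I(\mathbf Z_l;V)\Big\},$$ $$\mathcal{R}_{\rm C}\subseteq\bigcap_{k\in\mathcal K}\bigcap_{l\in\mathcal L}\ \bigcup_{P_{V|U},P_{U|\tilde{\mathbf X}}}\Big\{(R_S,R_J,R_L)\in\mathbb R_+^3:\ R_S\le I(\mathbf Y_k;U|V)-I(\mathbf Z_l;U|V),\ R_J\ge I(\tilde{\mathbf X};U|\mathbf Y_k)+I(\mathbf Y_k;U|V)-I(\mathbf Z_l;U|V),\ R_L\ge I(X;U|\mathbf Y_k)+I(\mathbf Y_k;V)-I(\mathbf Z_l;V)\Big\},$$ where the auxiliary random variables $V$ and $U$ satisfy the Markov chain $V-U-\tilde{\mathbf X}-X-(\mathbf Y_k,\mathbf Z_l)$ and their alphabets satisfy $|\mathcal V|\le|\tilde{\boldsymbol{\mathcal X}}|+2(|\mathcal K|+|\mathcal L|)+1$ and $|\mathcal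 U|\le(|\tilde{\boldsymbol{\mathcal X}}|+2(|\mathcal K|+|\mathcal L|)+1)(|\tilde{\boldsymbol{\mathcal X}}|+|\mathcal K|+|\mathcal L|+1)$.
   Context: **Source and channels.** $\mathcal K,\mathcal L$ are finite nonempty sets of channel states. $X^n=(X_1,\dots,X_n)$ (source identifier) is i.i.d. according to $P_X$ on a finite alphabet. The encoder observes $\tilde{\mathbf X}^n$ (vector-valued symbols in a finite alphabet $\tilde{\boldsymbol{\mathcal X}}$), and in state $(k,l)\in\mathcal K\times\mathcal L$ the decoder observes $\mathbf Y_k^n$ and the eavesdropper observes $\mathbf Z_l^n$ (vector-valued symbols in finite alphabets $\boldsymbol{\mathcal Y}_k$, $\boldsymbol{\mathcal Z}_l$). The joint law is $P_{\tilde{\mathbf X}^nX^n\mathbf Y_k^n\mathbf Z_l^n}=\prod_{t=1}^nP_{\tilde{\mathbf X}_t|X_t}P_{X_t}P_{\mathbf Y_{k,t}\mathbf Z_{l,t}|X_t}$, the single-letter laws $P_{\tilde{\mathbf X}|X}$, $P_{\mathbf Y_k\mathbf Z_l|X}$ being given. Logarithms are base 2. The notation $A-B-C$ denotes a Markov chain. **Strategies.** $\mathcal S=[1:2^{nR_S}]$, $\mathcal J=[1:2^{nR_J}]$, where $[a:b]=[\lfloor a\rfloor,\lceil b\rceil]\cap\mathbb N$. GS model: an encoder $e:\tilde{\boldsymbol{\mathcal X}}^n\to\mathcal J\times\mathcal S$ produces helper data and secret key $(J,S)=e(\tilde{\mathbf X}^n)$; a decoder $d:\boldsymbol{\mathcal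 Y}_k^n\times\mathcal J\to\mathcal S$ (encoder and decoder do not know the state $(k,l)$) produces $\hat S_k=d(\mathbf Y_k^n,J)$. CS model: $S$ is uniform on $\mathcal S$ and independent of $(\tilde{\mathbf X}^n,X^n,\mathbf Y_k^n,\mathbf Z_l^n)$; an encoder $e:\tilde{\boldsymbol{\mathcal X}}^n\times\mathcal S\to\mathcal J$ produces $J=e(\tilde{\mathbf X}^n,S)$; a decoder $d:\boldsymbol{\mathcal Y}_k^n\times\mathcal J\to\mathcal S$ (encoder and decoder do not know the state $(k,l)$) produces $\hat S_k=d(\mathbf Y_k^n,J)$. **Achievability.** $(R_S,R_J,R_L)\in\mathbb R_+^3$ is achievable for the GS model if for all sufficiently small $\delta>0$ and all large enough $n$ there exist an encoder and a decoder such that (1) $\max_{k}\mathbb P\{\hat S_k\ne S\}\le\delta$; (2) $H(S)+n\delta\ge\log|\mathcal S|\ge n(R_S-\delta)$; (3) $\log|\mathcal J|\le n(R_J+\delta)$; (4) $\max_{l}I(S;J,\mathbf Z_l^n)\le n\delta$; (5) $\max_{l}I(X^n;J|\mathbf Z_l^n)\le n(R_L+\delta)$. It is achievable for the CS model if the same holds (with CS strategies) with (2) replaced by $\log|\mathcal S|\ge n(R_S-\delta)$. The capacity regions $\mathcal R_{\rm G}$ and $\mathcal R_{\rm C}$ are the closures of the sets of achievable tuples for the GS and CS models. *)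

theory Defs
  imports "HOL-Probability.Probability"
begin

section \<open>Information measures, base 2\<close>

text \<open>The library functionals, for discrete random variables \<open>X\<close>, \<open>Y\<close>, \<open>Z\<close> on a probability mass
  function \<open>p\<close>. They only see the support of \<open>p\<close>, which is finite in every use below, so the
  values are the usual finite sums even where a symbol type (\<open>nat\<close>, lists) is infinite.\<close>

definition shannon_entropy :: "'w pmf \<Rightarrow> ('w \<Rightarrow> 'a::countable) \<Rightarrow> real" where
  "shannon_entropy p X = prob_space.entropy (measure_pmf p) 2 (count_space UNIV) X"

definition mutual_info ::
  "'w pmf \<Rightarrow> ('w \<Rightarrow> 'a::countable) \<Rightarrow> ('w \<Rightarrow> 'b::countable) \<Rightarrow> real" where
  "mutual_info p X Y =
     prob_space.mutual_information (measure_pmf p) 2 (count_space UNIV) (count_space UNIV) X Y"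

definition cond_mutual_info ::
  "'w pmf \<Rightarrow> ('w \<Rightarrow> 'a::countable) \<Rightarrow> ('w \<Rightarrow> 'b::countable) \<Rightarrow> ('w \<Rightarrow> 'c::countable) \<Rightarrow> real" where
  "cond_mutual_info p X Y Z =
     prob_space.conditional_mutual_information (measure_pmf p) 2
       (count_space UNIV) (count_space UNIV) (count_space UNIV) X Y Z"


section \<open>Source and compound channel\<close>

text \<open>
  Type variables: \<open>'x\<close> is the alphabet of the source \<open>X\<close>, \<open>'a\<close> that of the encoder observation,
  \<open>'k\<close> and \<open>'l\<close> are the state sets. \<open>'y\<close> and \<open>'z\<close> are common alphabets containing the
  alphabets of all \<open>Y\<^sub>k\<close>, respectively all \<open>Z\<^sub>l\<close>; symbols outside the alphabet of a given
  state have probability 0 there.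

  Parameters: \<open>PX\<close> is the law of \<open>X\<close>, \<open>PA\<close> the law of the encoder observation given \<open>X\<close>, and
  \<open>W k l\<close> the law of \<open>(Y\<^sub>k, Z\<^sub>l)\<close> given \<open>X\<close>. The outcomes of the single-letter law are
  \<open>(xt, x, y, z)\<close>, where \<open>xt\<close> is the encoder observation.
\<close>

definition single_law ::
  "'x pmf \<Rightarrow> ('x \<Rightarrow> 'a pmf) \<Rightarrow> ('x \<Rightarrow> ('y \<times> 'z) pmf) \<Rightarrow> ('a \<times> 'x \<times> 'y \<times> 'z) pmf" where
  "single_law PX PA Wkl =
     do { x \<leftarrow> PX; xt \<leftarrow> PA x; (y, z) \<leftarrow> Wkl x; return_pmf (xt, x, y, z) }"

definition block_law ::
  "nat \<Rightarrow> 'x pmf \<Rightarrow> ('x \<Rightarrow> 'a pmf) \<Rightarrow> ('x \<Rightarrow> ('y \<times> 'z) pmf) \<Rightarrow> ('a \<times> 'x \<times> 'y \<times> 'z) list pmf" where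
  "block_law n PX PA Wkl = replicate_pmf n (single_law PX PA Wkl)"

definition seqXt :: "('a \<times> 'x \<times> 'y \<times> 'z) list \<Rightarrow> 'a list" where
  "seqXt = map (\<lambda>(xt, x, y, z). xt)"

definition seqX :: "('a \<times> 'x \<times> 'y \<times> 'z) list \<Rightarrow> 'x list" where
  "seqX = map (\<lambda>(xt, x, y, z). x)"

definition seqY :: "('a \<times> 'x \<times> 'y \<times> 'z) list \<Rightarrow> 'y list" where
  "seqY = map (\<lambda>(xt, x, y, z). y)"

definition seqZ :: "('a \<times> 'x \<times> 'y \<times> 'z) list \<Rightarrow> 'z list" where
  "seqZ = map (\<lambda>(xt, x, y, z). z)"


section \<open>Strategies\<close>

definition int_range :: "real \<Rightarrow> real \<Rightarrow> nat set" where
  "int_range a b = {m. \<lfloor>a\<rfloor> \<le> int m \<and> int m \<le> \<lceil>b\<rceil>}"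

definition rate_set :: "nat \<Rightarrow> real \<Rightarrow> nat set" where
  "rate_set n R = int_range 1 (2 powr (real n * R))"

definition gs_encoders :: "nat \<Rightarrow> nat set \<Rightarrow> nat set \<Rightarrow> ('a list \<Rightarrow> nat \<times> nat) set" where
  "gs_encoders n J S = {xs. length xs = n} \<rightarrow> J \<times> S"

definition cs_encoders :: "nat \<Rightarrow> nat set \<Rightarrow> nat set \<Rightarrow> ('a list \<times> nat \<Rightarrow> nat) set" where
  "cs_encoders n J S = {xs. length xs = n} \<times> S \<rightarrow> J"

definition decoders :: "nat \<Rightarrow> nat set \<Rightarrow> nat set \<Rightarrow> ('y list \<times> nat \<Rightarrow> nat) set" where
  "decoders n J S = {ys. length ys = n} \<times> J \<rightarrow> S"


section \<open>Achievability and capacity regions\<close>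

text \<open>
  The maxima over the states are written as one universal quantification over \<open>(k, l)\<close>. Each
  quantity depends on the state only through the marginal it involves, so this is the maximum
  over \<open>k\<close> alone, respectively over \<open>l\<close> alone, whenever the law of \<open>Y\<^sub>k\<close> given \<open>X\<close> does
  not depend on \<open>l\<close> and that of \<open>Z\<^sub>l\<close> given \<open>X\<close> does not depend on \<open>k\<close>.
\<close>

definition gs_achievable ::
  "'x::finite pmf \<Rightarrow> ('x \<Rightarrow> 'a::finite pmf)
   \<Rightarrow> ('k::finite \<Rightarrow> 'l::finite \<Rightarrow> 'x \<Rightarrow> ('y::finite \<times> 'z::finite) pmf)
   \<Rightarrow> real \<times> real \<times> real \<Rightarrow> bool" where
  "gs_achievable PX PA W = (\<lambda>(RS :: real, RJ :: real, RL :: real).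
     0 \<le> RS \<and> 0 \<le> RJ \<and> 0 \<le> RL \<and>
     (\<forall>\<^sub>F \<delta> :: real in at_right 0. \<forall>\<^sub>F n in sequentially.
       \<exists>e \<in> gs_encoders n (rate_set n RJ) (rate_set n RS).
       \<exists>d \<in> decoders n (rate_set n RJ) (rate_set n RS).
         \<forall>k l. let p = block_law n PX PA (W k l);
                   J = (\<lambda>w. fst (e (seqXt w)));
                   S = (\<lambda>w. snd (e (seqXt w)));
                   S' = (\<lambda>w. d (seqY w, J w))
               in measure_pmf.prob p {w. S' w \<noteq> S w} \<le> \<delta>
                \<and> shannon_entropy p S + real n * \<delta> \<ge> log 2 (real (card (rate_set n RS)))
                \<and> log 2 (real (card (rate_set n RS))) \<ge> real n * (RS - \<delta>)
                \<and> log 2 (real (card (rate_set n RJ))) \<le> real n * (RJ + \<delta>)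
                \<and> mutual_info p S (\<lambda>w. (J w, seqZ w)) \<le> real n * \<delta>
                \<and> cond_mutual_info p seqX J seqZ \<le> real n * (RL + \<delta>)))"

definition cs_achievable ::
  "'x::finite pmf \<Rightarrow> ('x \<Rightarrow> 'a::finite pmf)
   \<Rightarrow> ('k::finite \<Rightarrow> 'l::finite \<Rightarrow> 'x \<Rightarrow> ('y::finite \<times> 'z::finite) pmf)
   \<Rightarrow> real \<times> real \<times> real \<Rightarrow> bool" where
  "cs_achievable PX PA W = (\<lambda>(RS :: real, RJ :: real, RL :: real).
     0 \<le> RS \<and> 0 \<le> RJ \<and> 0 \<le> RL \<and>
     (\<forall>\<^sub>F \<delta> :: real in at_right 0. \<forall>\<^sub>F n in sequentially.
       \<exists>e \<in> cs_encoders n (rate_set n RJ) (rate_set n RS).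
       \<exists>d \<in> decoders n (rate_set n RJ) (rate_set n RS).
         \<forall>k l. let p = pair_pmf (pmf_of_set (rate_set n RS)) (block_law n PX PA (W k l));
                   S = fst;
                   J = (\<lambda>(s, w). e (seqXt w, s));
                   S' = (\<lambda>(s, w). d (seqY w, J (s, w)))
               in measure_pmf.prob p {w. S' w \<noteq> S w} \<le> \<delta>
                \<and> log 2 (real (card (rate_set n RS))) \<ge> real n * (RS - \<delta>)
                \<and> log 2 (real (card (rate_set n RJ))) \<le> real n * (RJ + \<delta>)
                \<and> mutual_info p S (\<lambda>w. (J w, seqZ (snd w))) \<le> real n * \<delta>
                \<and> cond_mutual_info p (\<lambda>w. seqX (snd w)) J (\<lambda>w. seqZ (snd w)) \<le> real n * (RL + \<delta>)))"

definition gs_capacity_region ::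
  "'x::finite pmf \<Rightarrow> ('x \<Rightarrow> 'a::finite pmf)
   \<Rightarrow> ('k::finite \<Rightarrow> 'l::finite \<Rightarrow> 'x \<Rightarrow> ('y::finite \<times> 'z::finite) pmf)
   \<Rightarrow> (real \<times> real \<times> real) set" where
  "gs_capacity_region PX PA W = closure {R. gs_achievable PX PA W R}"

definition cs_capacity_region ::
  "'x::finite pmf \<Rightarrow> ('x \<Rightarrow> 'a::finite pmf)
   \<Rightarrow> ('k::finite \<Rightarrow> 'l::finite \<Rightarrow> 'x \<Rightarrow> ('y::finite \<times> 'z::finite) pmf)
   \<Rightarrow> (real \<times> real \<times> real) set" where
  "cs_capacity_region PX PA W = closure {R. cs_achievable PX PA W R}"


section \<open>Auxiliary random variables\<close>

text \<open>Pairs of kernels \<open>(P\<^bsub>V|U\<^esub>, P\<^bsub>U|Xt\<^esub>)\<close> with alphabets of size at most \<open>mV\<close> and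
  \<open>mU\<close>. The alphabets are finite sets of natural numbers, which is no restriction up to
  renaming of symbols.\<close>

definition aux_kernels :: "nat \<Rightarrow> nat \<Rightarrow> ((nat \<Rightarrow> nat pmf) \<times> ('a \<Rightarrow> nat pmf)) set" where
  "aux_kernels mV mU = {(PV, PU). \<exists>AV AU.
     finite AV \<and> card AV \<le> mV \<and> finite AU \<and> card AU \<le> mU \<and>
     (\<forall>xt. set_pmf (PU xt) \<subseteq> AU) \<and> (\<forall>u\<in>AU. set_pmf (PV u) \<subseteq> AV)}"

text \<open>The joint law of \<open>(V, U, Xt, X, Y, Z)\<close> with the given kernels for which
  \<open>V - U - Xt - X - (Y, Z)\<close> is a Markov chain.\<close>

definition aux_law ::
  "'x pmf \<Rightarrow> ('x \<Rightarrow> 'a pmf) \<Rightarrow> ('x \<Rightarrow> ('y \<times> 'z) pmf) \<Rightarrow> (nat \<Rightarrow> nat pmf) \<Rightarrow> ('a \<Rightarrow> nat pmf)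
   \<Rightarrow> (nat \<times> nat \<times> 'a \<times> 'x \<times> 'y \<times> 'z) pmf" where
  "aux_law PX PA Wkl PV PU =
     do { (xt, x, y, z) \<leftarrow> single_law PX PA Wkl; u \<leftarrow> PU xt; v \<leftarrow> PV u;
          return_pmf (v, u, xt, x, y, z) }"

definition rvV :: "nat \<times> nat \<times> 'a \<times> 'x \<times> 'y \<times> 'z \<Rightarrow> nat" where
  "rvV = (\<lambda>(v, u, xt, x, y, z). v)"

definition rvU :: "nat \<times> nat \<times> 'a \<times> 'x \<times> 'y \<times> 'z \<Rightarrow> nat" where
  "rvU = (\<lambda>(v, u, xt, x, y, z). u)"

definition rvXt :: "nat \<times> nat \<times> 'a \<times> 'x \<times> 'y \<times> 'z \<Rightarrow> 'a" where
  "rvXt = (\<lambda>(v, u, xt, x, y, z). xt)"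

definition rvX :: "nat \<times> nat \<times> 'a \<times> 'x \<times> 'y \<times> 'z \<Rightarrow> 'x" where
  "rvX = (\<lambda>(v, u, xt, x, y, z). x)"

definition rvY :: "nat \<times> nat \<times> 'a \<times> 'x \<times> 'y \<times> 'z \<Rightarrow> 'y" where
  "rvY = (\<lambda>(v, u, xt, x, y, z). y)"

definition rvZ :: "nat \<times> nat \<times> 'a \<times> 'x \<times> 'y \<times> 'z \<Rightarrow> 'z" where
  "rvZ = (\<lambda>(v, u, xt, x, y, z). z)"

end

theory Submission
  imports Defs
begin

text \<open>
  Single-letterization takes \<open>V\<^sub>i = (J, Y\<^sub>1\<dots>Y\<^sub>i\<^sub>-\<^sub>1, Z\<^sub>i\<^sub>+\<^sub>1\<dots>Z\<^sub>n)\<close> and \<open>U\<^sub>i = (S, V\<^sub>i)\<close>. The differences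
  \<open>H(Y\<^sub>i|V\<^sub>i) - H(Z\<^sub>i|V\<^sub>i)\<close> then telescope (Csiszar's sum identity), Fano's inequality allows \<open>S\<close> to be
  added to \<open>J\<close> in the equivocations, and the rate conditions of a code of length \<open>n\<close> become the
  single-letter inequalities up to a vanishing slack.

  All information quantities of an auxiliary pair \<open>(V, U)\<close> with \<open>V\<close> a function of \<open>U\<close> are determined by
  the law of \<open>Xt\<close> and the averages of finitely many continuous functions of the posteriors of \<open>Xt\<close>
  given \<open>U\<close> and given \<open>V\<close>. The attainable values form the convex hull of a compact set. Convexity
  replaces the time-sharing variable, compactness allows the slack to tend to zero with fixed
  alphabets, and Caratheodory's theorem, applied once for \<open>V\<close> and once for each conditional law of
  \<open>U\<close>, bounds the alphabets.
\<close>

section \<open>Entropy of finitely supported distributions\<close>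

text \<open>Because the union over kernels stands inside the intersection over the states, the
  auxiliary pair may be chosen afresh for every \<open>(k, l)\<close>, so the whole argument runs
  for one fixed state. Beside the law of \<open>Xt\<close> only four averaged quantities must then
  be preserved: \<open>CARD('a) + 5\<close> symbols suffice for \<open>V\<close>. For each value of
  \<open>V\<close> three quantities remain and the simplex constraint saves a dimension, so
  \<open>CARD('a) + 3\<close> values of \<open>U\<close> suffice. The sizes in the statement
  dominate these numbers because there is at least one state of each kind.

  Both models are instances of one randomized code, a kernel from source words to pairs of helper
  data and key. They differ in the uncertainty of this pair given the encoder's and the decoder's
  observations. For a generated key nonnegativity is enough. A chosen key remains completely
  uncertain there, and its entropy pays for the additional term in the storage rate.\<close>

definition ent :: "'w pmf \<Rightarrow> ('w \<Rightarrow> 'b) \<Rightarrow> real" where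
  "ent p X = (\<Sum>w\<in>set_pmf p. pmf p w * - log 2 (pmf (map_pmf X p) (X w)))"

lemma sum_map_pmf:
  fixes F :: "'b \<Rightarrow> real"
  assumes "finite (set_pmf p)"
  shows "(\<Sum>b\<in>set_pmf (map_pmf g p). pmf (map_pmf g p) b * F b) = (\<Sum>w\<in>set_pmf p. pmf p w * F (g w))"
proof -
  have "(\<Sum>b\<in>set_pmf (map_pmf g p). pmf (map_pmf g p) b * F b) = measure_pmf.expectation (map_pmf g p) F"
    using assms by (subst integral_measure_pmf[of "set_pmf (map_pmf g p)"]) auto
  also have "\<dots> = measure_pmf.expectation p (\<lambda>w. F (g w))" by simp
  also have "\<dots> = (\<Sum>w\<in>set_pmf p. pmf p w * F (g w))"
    using assms by (subst integral_measure_pmf[of "set_pmf p"]) auto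
  finally show ?thesis .
qed

lemma pmf_map_sum:
  assumes "finite (set_pmf p)"
  shows "pmf (map_pmf g p) b = (\<Sum>w\<in>set_pmf p. pmf p w * of_bool (g w = b))"
proof -
  have "pmf (map_pmf g p) b = measure_pmf.expectation p (indicator (g -` {b}))"
    by (simp add: pmf_map)
  also have "\<dots> = (\<Sum>w\<in>set_pmf p. pmf p w * indicator (g -` {b}) w)"
    using assms by (subst integral_measure_pmf[of "set_pmf p"]) auto
  finally show ?thesis by (simp add: indicator_def of_bool_def)
qed

lemma ent_map: "finite (set_pmf p) \<Longrightarrow> ent (map_pmf g p) X = ent p (\<lambda>w. X (g w))"
  unfolding ent_def by (subst sum_map_pmf) (auto simp: pmf.map_comp o_def)

lemma pmf_map_pos: "w \<in> set_pmf p \<Longrightarrow> 0 < pmf (map_pmf X p) (X w)"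
  by (simp add: pmf_positive)

lemma pmf_map_mono:
  assumes fin: "finite (set_pmf p)"
    and "\<And>v. v \<in> set_pmf p \<Longrightarrow> X v = X w \<Longrightarrow> Y v = Y w"
  shows "pmf (map_pmf X p) (X w) \<le> pmf (map_pmf Y p) (Y w)"
  unfolding pmf_map_sum[OF fin] using assms(2) by (intro sum_mono) auto

lemma ent_mono:
  assumes fin: "finite (set_pmf p)"
    and "\<And>v w. v \<in> set_pmf p \<Longrightarrow> w \<in> set_pmf p \<Longrightarrow> X v = X w \<Longrightarrow> Y v = Y w"
  shows "ent p Y \<le> ent p X"
  unfolding ent_def
proof (rule sum_mono)
  fix w assume w: "w \<in> set_pmf p"
  have "pmf (map_pmf X p) (X w) \<le> pmf (map_pmf Y p) (Y w)"
    by (rule pmf_map_mono[OF fin]) (use assms(2) w in blast)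
  then have "log 2 (pmf (map_pmf X p) (X w)) \<le> log 2 (pmf (map_pmf Y p) (Y w))"
    using pmf_map_pos[OF w, of X] pmf_map_pos[OF w, of Y] by simp
  then show "pmf p w * - log 2 (pmf (map_pmf Y p) (Y w)) \<le> pmf p w * - log 2 (pmf (map_pmf X p) (X w))"
    by (simp add: mult_left_mono)
qed

text \<open>Entropy sees only which outcomes of the support a variable identifies. This lets tuples
  be reordered and lists, functions and options be exchanged. The value type is unrestricted because
  blocks of letters are functions on \<open>nat\<close>, which do not form a countable type.\<close>

lemma ent_cong:
  assumes fin: "finite (set_pmf p)"
    and "\<And>v w. v \<in> set_pmf p \<Longrightarrow> w \<in> set_pmf p \<Longrightarrow> X v = X w \<longleftrightarrow> Y v = Y w"
  shows "ent p X = ent p Y"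
  using assms(2) by (intro antisym ent_mono[OF fin]) blast+

text \<open>Submodularity (\<open>q\<close> a conditional law), the cardinality bound (\<open>q\<close> uniform) and Fano's inequality (\<open>q\<close> a
  mixture of the decoder output and the uniform law) are instances.\<close>

lemma gibbs_conditional:
  assumes fin: "finite (set_pmf p)"
    and pos: "\<And>w. w \<in> set_pmf p \<Longrightarrow> 0 < q (X w) (T w)"
    and nn: "\<And>x t. 0 \<le> q x t"
    and le1: "\<And>w. w \<in> set_pmf p \<Longrightarrow> (\<Sum>x\<in>X ` set_pmf p. q x (T w)) \<le> 1"
  shows "ent p (\<lambda>w. (X w, T w)) - ent p T \<le> (\<Sum>w\<in>set_pmf p. pmf p w * - log 2 (q (X w) (T w)))"
proof -
  define A where "A w = pmf (map_pmf (\<lambda>w. (X w, T w)) p) (X w, T w)" for w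
  define B where "B w = pmf (map_pmf T p) (T w)" for w
  have A: "0 < A w" and B: "0 < B w" if "w \<in> set_pmf p" for w
    using pmf_map_pos[OF that, of "\<lambda>w. (X w, T w)"] pmf_map_pos[OF that, of T] by (auto simp: A_def B_def)
  have "ent p (\<lambda>w. (X w, T w)) - ent p T - (\<Sum>w\<in>set_pmf p. pmf p w * - log 2 (q (X w) (T w)))
      = (\<Sum>w\<in>set_pmf p. pmf p w * log 2 (q (X w) (T w) * B w / A w))"
    unfolding ent_def sum_subtractf[symmetric] A_def[symmetric] B_def[symmetric]
  proof (intro sum.cong refl)
    fix w assume w: "w \<in> set_pmf p"
    show "pmf p w * - log 2 (A w) - pmf p w * - log 2 (B w) - pmf p w * - log 2 (q (X w) (T w)) =
         pmf p w * log 2 (q (X w) (T w) * B w / A w)"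
      using A[OF w] B[OF w] pos[OF w] by (simp add: log_divide log_mult algebra_simps)
  qed
  also have "\<dots> \<le> (\<Sum>w\<in>set_pmf p. pmf p w * ((q (X w) (T w) * B w / A w - 1) / ln 2))"
  proof (intro sum_mono mult_left_mono)
    fix w assume w: "w \<in> set_pmf p"
    have "ln (q (X w) (T w) * B w / A w) \<le> q (X w) (T w) * B w / A w - 1"
      using A[OF w] B[OF w] pos[OF w] by (intro ln_le_minus_one) auto
    then show "log 2 (q (X w) (T w) * B w / A w) \<le> (q (X w) (T w) * B w / A w - 1) / ln 2"
      unfolding log_def by (rule divide_right_mono) simp
  qed simp
  also have "\<dots> = ((\<Sum>w\<in>set_pmf p. pmf p w * (q (X w) (T w) * B w / A w)) - (\<Sum>w\<in>set_pmf p. pmf p w)) / ln 2"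
    by (simp add: sum_subtractf[symmetric] sum_divide_distrib algebra_simps diff_divide_distrib)
  also have "(\<Sum>w\<in>set_pmf p. pmf p w) = 1" using fin by (rule sum_pmf_eq_1) auto
  also have "(\<Sum>w\<in>set_pmf p. pmf p w * (q (X w) (T w) * B w / A w)) \<le> 1"
  proof -
    let ?r = "map_pmf (\<lambda>w. (X w, T w)) p"
    let ?F = "\<lambda>z. q (fst z) (snd z) * pmf (map_pmf T p) (snd z) / pmf ?r z"
    have "(\<Sum>w\<in>set_pmf p. pmf p w * (q (X w) (T w) * B w / A w)) = (\<Sum>z\<in>set_pmf ?r. pmf ?r z * ?F z)"
      by (subst sum_map_pmf[OF fin]) (simp add: A_def B_def)
    also have "\<dots> = (\<Sum>z\<in>set_pmf ?r. q (fst z) (snd z) * pmf (map_pmf T p) (snd z))"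
      by (intro sum.cong refl) (auto simp: set_pmf_iff simp del: set_map_pmf)
    also have "\<dots> \<le> (\<Sum>z\<in>(X ` set_pmf p) \<times> (T ` set_pmf p). q (fst z) (snd z) * pmf (map_pmf T p) (snd z))"
      using fin by (intro sum_mono2) (auto simp: nn)
    also have "\<dots> = (\<Sum>t\<in>T ` set_pmf p. \<Sum>x\<in>X ` set_pmf p. q x t * pmf (map_pmf T p) t)"
      by (simp add: sum.cartesian_product' sum.swap[of _ "X ` set_pmf p"])
    also have "\<dots> \<le> (\<Sum>t\<in>T ` set_pmf p. pmf (map_pmf T p) t)"
      unfolding sum_distrib_right[symmetric] using le1 by (intro sum_mono mult_left_le_one_le) (auto intro!: sum_nonneg nn)
    also have "\<dots> = 1" using fin by (intro sum_pmf_eq_1) auto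
    finally show ?thesis .
  qed
  finally show ?thesis by (simp add: divide_right_mono)
qed

lemma ent_submodular:
  assumes fin: "finite (set_pmf p)"
  shows "ent p (\<lambda>w. (X w, Y w, Z w)) + ent p Z \<le> ent p (\<lambda>w. (X w, Z w)) + ent p (\<lambda>w. (Y w, Z w))"
proof -
  define q where "q = (\<lambda>x (yz::'c\<times>'d). pmf (map_pmf (\<lambda>w. (X w, Z w)) p) (x, snd yz) / pmf (map_pmf Z p) (snd yz))"
  have "ent p (\<lambda>w. (X w, (\<lambda>w. (Y w, Z w)) w)) - ent p (\<lambda>w. (Y w, Z w))
     \<le> (\<Sum>w\<in>set_pmf p. pmf p w * - log 2 (q (X w) (Y w, Z w)))"
  proof (rule gibbs_conditional[OF fin])
    fix w assume w: "w \<in> set_pmf p"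
    show "0 < q (X w) (Y w, Z w)" using pmf_map_pos[OF w, of "\<lambda>w. (X w, Z w)"] pmf_map_pos[OF w, of Z]
      by (simp add: q_def)
    have "(\<Sum>x\<in>X ` set_pmf p. pmf (map_pmf (\<lambda>w. (X w, Z w)) p) (x, Z w))
        = (\<Sum>x\<in>X ` set_pmf p. \<Sum>v\<in>set_pmf p. pmf p v * of_bool (Z v = Z w) * of_bool (x = X v))"
      unfolding pmf_map_sum[OF fin] by (intro sum.cong) auto
    also have "\<dots> = (\<Sum>v\<in>set_pmf p. \<Sum>x\<in>X ` set_pmf p. pmf p v * of_bool (Z v = Z w) * of_bool (x = X v))"
      by (rule sum.swap)
    also have "\<dots> = (\<Sum>v\<in>set_pmf p. pmf p v * of_bool (Z v = Z w))"
      using fin by (intro sum.cong refl) (simp add: sum_distrib_left[symmetric])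
    also have "\<dots> = pmf (map_pmf Z p) (Z w)" unfolding pmf_map_sum[OF fin] ..
    finally show "(\<Sum>x\<in>X ` set_pmf p. q x (Y w, Z w)) \<le> 1"
      by (simp add: q_def sum_divide_distrib[symmetric])
  qed (simp add: q_def)
  also have "\<dots> = ent p (\<lambda>w. (X w, Z w)) - ent p Z"
    unfolding ent_def sum_subtractf[symmetric]
  proof (intro sum.cong refl)
    fix w assume w: "w \<in> set_pmf p"
    show "pmf p w * - log 2 (q (X w) (Y w, Z w)) =
         pmf p w * - log 2 (pmf (map_pmf (\<lambda>w. (X w, Z w)) p) (X w, Z w)) -
         pmf p w * - log 2 (pmf (map_pmf Z p) (Z w))"
      using pmf_map_pos[OF w, of "\<lambda>w. (X w, Z w)"] pmf_map_pos[OF w, of Z]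
      by (simp add: q_def log_divide algebra_simps)
  qed
  finally show ?thesis by simp
qed

lemma ent_const [simp]: "finite (set_pmf p) \<Longrightarrow> ent p (\<lambda>w. c) = 0"
  by (simp add: ent_def)

lemma ent_le_log_card:
  assumes fin: "finite (set_pmf p)" and A: "finite A" "\<And>w. w \<in> set_pmf p \<Longrightarrow> X w \<in> A"
  shows "ent p X \<le> log 2 (card A)"
proof -
  have ne: "A \<noteq> {}" using A(2) set_pmf_not_empty[of p] by blast
  then have c: "0 < card A" using A(1) by (simp add: card_gt_0_iff)
  have "ent p (\<lambda>w. (X w, (\<lambda>w. ()) w)) - ent p (\<lambda>w. ()) \<le> (\<Sum>w\<in>set_pmf p. pmf p w * - log 2 ((\<lambda>_ _. 1 / card A) (X w) ()))"
  proof (rule gibbs_conditional[OF fin])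
    have "card (X ` set_pmf p) \<le> card A" using A by (intro card_mono) auto
    then show "(\<Sum>x\<in>X ` set_pmf p. 1 / card A) \<le> 1" using c by (simp add: field_simps)
  qed (use c in auto)
  also have "\<dots> = (\<Sum>w\<in>set_pmf p. pmf p w) * log 2 (card A)"
    using c by (simp add: sum_distrib_right log_divide)
  also have "(\<Sum>w\<in>set_pmf p. pmf p w) = 1" using fin by (rule sum_pmf_eq_1) auto
  also have "ent p (\<lambda>w. (X w, (\<lambda>w. ()) w)) = ent p X" by (rule ent_cong[OF fin]) auto
  finally show ?thesis using fin by simp
qed

lemma fano:
  assumes fin: "finite (set_pmf p)" and A: "finite A" "\<And>w. w \<in> set_pmf p \<Longrightarrow> S w \<in> A"
    and err: "measure_pmf.prob p {w. d (T w) \<noteq> S w} \<le> \<delta>"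
  shows "ent p (\<lambda>w. (S w, T w)) - ent p T \<le> 1 + \<delta> * log 2 (card A)"
proof -
  have ne: "A \<noteq> {}" using A(2) set_pmf_not_empty[of p] by blast
  then have c: "0 < card A" using A(1) by (simp add: card_gt_0_iff)
  \<comment> \<open>Half of the mass sits on the decoder's guess: a correct guess costs one bit, a
    wrong one \<open>1 + log 2 (card A)\<close> bits. The guess may lie outside the range of
    \<open>S\<close>, so the total mass is only bounded by 1.\<close>
  define q where "q = (\<lambda>s t. if s = d t then 1/2 else 1 / (2 * real (card A)))"
  have s1: "(\<Sum>w\<in>set_pmf p. pmf p w) = 1" using fin by (rule sum_pmf_eq_1) auto
  have "ent p (\<lambda>w. (S w, T w)) - ent p T \<le> (\<Sum>w\<in>set_pmf p. pmf p w * - log 2 (q (S w) (T w)))"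
  proof (rule gibbs_conditional[OF fin])
    fix w assume "w \<in> set_pmf p"
    have "(\<Sum>x\<in>S ` set_pmf p. q x (T w)) \<le> (\<Sum>x\<in>S ` set_pmf p. 1/2 * of_bool (x = d (T w)) + 1 / (2 * real (card A)))"
      by (intro sum_mono) (auto simp: q_def)
    also have "\<dots> = (\<Sum>x\<in>S ` set_pmf p. 1/2 * of_bool (x = d (T w))) + card (S ` set_pmf p) / (2 * real (card A))"
      by (simp add: sum.distrib)
    also have "(\<Sum>x\<in>S ` set_pmf p. (1/2::real) * of_bool (x = d (T w))) = 1/2 * (\<Sum>x\<in>S ` set_pmf p. of_bool (x = d (T w)))"
      by (simp only: sum_distrib_left)
    also have "(\<Sum>x\<in>S ` set_pmf p. of_bool (x = d (T w)) :: real) \<le> 1"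
      using fin by (simp add: sum.If_cases of_bool_def)
    also have "card (S ` set_pmf p) / (2 * real (card A)) \<le> 1/2"
    proof -
      have "card (S ` set_pmf p) \<le> card A" using A by (intro card_mono) auto
      then show ?thesis using c by (simp add: field_simps)
    qed
    finally show "(\<Sum>x\<in>S ` set_pmf p. q x (T w)) \<le> 1" by simp
  qed (use c in \<open>auto simp: q_def\<close>)
  also have "\<dots> = (\<Sum>w\<in>set_pmf p. pmf p w + log 2 (card A) * (pmf p w * of_bool (d (T w) \<noteq> S w)))"
    using c by (intro sum.cong refl) (auto simp: q_def log_divide log_mult algebra_simps)
  also have "\<dots> = 1 + log 2 (card A) * (\<Sum>w\<in>set_pmf p. pmf p w * of_bool (d (T w) \<noteq> S w))"
    by (simp add: sum.distrib sum_distrib_left s1)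
  also have "(\<Sum>w\<in>set_pmf p. pmf p w * of_bool (d (T w) \<noteq> S w)) = measure_pmf.prob p {w. d (T w) \<noteq> S w}"
    using pmf_map_sum[OF fin, of "\<lambda>w. d (T w) \<noteq> S w" True] by (simp add: pmf_map vimage_def)
  also have "log 2 (card A) * measure_pmf.prob p {w. d (T w) \<noteq> S w} \<le> log 2 (card A) * \<delta>"
    using c err by (intro mult_left_mono) auto
  finally show ?thesis by (simp add: mult.commute)
qed

section \<open>Kernels, Markov chains and product laws\<close>

definition kernel_law :: "'s pmf \<Rightarrow> ('s \<Rightarrow> 'a) \<Rightarrow> ('a \<Rightarrow> 'u pmf) \<Rightarrow> ('u \<times> 's) pmf" where
  "kernel_law s t L = do { w \<leftarrow> s; u \<leftarrow> L (t w); return_pmf (u, w) }"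

lemma kernel_law_altdef: "kernel_law s t L = bind_pmf s (\<lambda>w. map_pmf (\<lambda>u. (u, w)) (L (t w)))"
  by (simp add: kernel_law_def map_pmf_def)

lemma finite_set_kernel_law:
  "finite (set_pmf s) \<Longrightarrow> (\<And>w. w \<in> set_pmf s \<Longrightarrow> finite (set_pmf (L (t w)))) \<Longrightarrow> finite (set_pmf (kernel_law s t L))"
  by (auto simp: kernel_law_altdef)

lemma pmf_kernel_law: "pmf (kernel_law s t L) (u, w) = pmf s w * pmf (L (t w)) u"
proof -
  have e: "pmf (map_pmf (\<lambda>u. (u, v)) (L (t v))) (u, w) = indicator {w} v * pmf (L (t w)) u" for v
  proof (cases "v = w")
    case True
    then show ?thesis using pmf_map_inj'[of "\<lambda>u. (u, w)"] by (simp add: inj_on_def)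
  next
    case False
    then show ?thesis by (auto simp: pmf_eq_0_set_pmf)
  qed
  show ?thesis
    unfolding kernel_law_altdef pmf_bind e by (simp add: pmf.rep_eq)
qed

lemma map_snd_kernel_law: "map_pmf snd (kernel_law s t L) = s"
  by (simp add: kernel_law_altdef map_bind_pmf pmf.map_comp o_def bind_return_pmf')

lemma map_kernel_law_state:
  "map_pmf (\<lambda>z. (fst z, h (snd z))) (kernel_law s (\<lambda>w. k (h w)) L) = kernel_law (map_pmf h s) k L"
  by (simp add: kernel_law_altdef map_bind_pmf pmf.map_comp o_def bind_map_pmf)

lemma map_kernel_law_input:
  "map_pmf (\<lambda>z. (\<phi> (fst z), snd z)) (kernel_law s t L) = kernel_law s t (\<lambda>a. map_pmf \<phi> (L a))"
  by (simp add: kernel_law_altdef map_bind_pmf pmf.map_comp o_def)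

text \<open>The Markov chain \<open>fst z - t (snd z) - snd z\<close> in entropic form. The mass
  function factorizes, so the identity holds outcome by outcome after taking logarithms. It serves
  for the message of a code as well as for the observation \<open>Xt\<close> of a single source
  letter.\<close>

lemma ent_kernel_law:
  assumes fin: "finite (set_pmf (kernel_law s t L))"
  defines "r \<equiv> kernel_law s t L"
  shows "ent r (\<lambda>z. z) + ent r (\<lambda>z. t (snd z)) = ent r (\<lambda>z. (fst z, t (snd z))) + ent r snd"
proof -
  have pr: "pmf r (m, w) = pmf s w * pmf (L (t w)) m" for m w
    by (simp add: r_def pmf_kernel_law)
  have prt: "pmf (map_pmf (\<lambda>z. (fst z, t (snd z))) r) (m, c) = pmf (map_pmf t s) c * pmf (L c) m" for m c
    unfolding r_def using map_kernel_law_state[of t s "\<lambda>c. c" L] by (simp add: pmf_kernel_law)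
  have snd: "map_pmf snd r = s" by (simp add: r_def map_snd_kernel_law)
  have m1: "map_pmf (\<lambda>z. t (snd z)) r = map_pmf t s"
    by (simp add: snd[symmetric] pmf.map_comp o_def)
  show ?thesis
    unfolding ent_def sum.distrib[symmetric]
  proof (intro sum.cong refl)
    fix z assume z: "z \<in> set_pmf r"
    obtain m w where zz: "z = (m, w)" by (cases z)
    have "0 < pmf r (m, w)" using z by (simp add: zz pmf_positive)
    then have p: "0 < pmf s w" "0 < pmf (L (t w)) m" unfolding pr by (auto simp: zero_less_mult_iff)
    moreover have "0 < pmf (map_pmf t s) (t w)" using p(1) by (intro pmf_map_pos) (simp add: set_pmf_iff)
    ultimately show "pmf r z * - log 2 (pmf (map_pmf (\<lambda>z. z) r) z) + pmf r z * - log 2 (pmf (map_pmf (\<lambda>z. t (snd z)) r) (t (snd z))) =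
         pmf r z * - log 2 (pmf (map_pmf (\<lambda>z. (fst z, t (snd z))) r) (fst z, t (snd z))) +
         pmf r z * - log 2 (pmf (map_pmf snd r) (snd z))"
      by (simp add: zz snd m1 prt) (simp add: pr log_mult algebra_simps)
  qed
qed

lemma ent_pair:
  assumes "finite (set_pmf p)" "finite (set_pmf q)"
  shows "ent (pair_pmf p q) (\<lambda>(x, y). (X x, Y y)) = ent p X + ent q Y"
proof -
  have f: "finite (set_pmf (pair_pmf p q))" using assms by simp
  have ep: "ent p X = ent (pair_pmf p q) (\<lambda>z. X (fst z))" 
    using ent_map[OF f, of fst X] by (simp add: map_fst_pair_pmf)
  have eq: "ent q Y = ent (pair_pmf p q) (\<lambda>z. Y (snd z))" 
    using ent_map[OF f, of snd Y] by (simp add: map_snd_pair_pmf)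
  have m: "map_pmf (\<lambda>(x, y). (X x, Y y)) (pair_pmf p q) = pair_pmf (map_pmf X p) (map_pmf Y q)"
    by (simp add: map_pair)
  have mp: "map_pmf (\<lambda>z. X (fst z)) (pair_pmf p q) = map_pmf X p"
    using pmf.map_comp[of X fst "pair_pmf p q"] by (simp add: map_fst_pair_pmf o_def)
  have mq: "map_pmf (\<lambda>z. Y (snd z)) (pair_pmf p q) = map_pmf Y q"
    using pmf.map_comp[of Y snd "pair_pmf p q"] by (simp add: map_snd_pair_pmf o_def)
  show ?thesis unfolding ep eq unfolding ent_def m mp mq sum.distrib[symmetric]
  proof (intro sum.cong refl)
    fix z assume z: "z \<in> set_pmf (pair_pmf p q)"
    obtain x y where zz: "z = (x, y)" by (cases z)
    have "0 < pmf (map_pmf X p) (X x)" "0 < pmf (map_pmf Y q) (Y y)"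
      using z by (auto simp: zz intro!: pmf_map_pos)
    then show "pmf (pair_pmf p q) z * - log 2 (pmf (pair_pmf (map_pmf X p) (map_pmf Y q)) (case z of (x, y) \<Rightarrow> (X x, Y y))) =
         pmf (pair_pmf p q) z * - log 2 (pmf (map_pmf X p) (X (fst z))) +
         pmf (pair_pmf p q) z * - log 2 (pmf (map_pmf Y q) (Y (snd z)))"
      by (simp add: zz pmf_pair log_mult algebra_simps)
  qed
qed

lemma restrict_eq_iff: "restrict f I = restrict g I \<longleftrightarrow> (\<forall>j\<in>I. f j = g j)"
  by (metis restrict_apply' restrict_ext)

text \<open>The map \<open>g j\<close> may vary with the coordinate, so that a block can be revealed
  on some coordinates and hidden on others by making \<open>g j\<close> constant there.
  \<open>restrict\<close> fixes the values outside \<open>I\<close>, so equality of blocks means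
  equality on \<open>I\<close>.\<close>

lemma ent_Pi:
  assumes "finite I" and fin: "\<And>j. j \<in> I \<Longrightarrow> finite (set_pmf (p j))"
  shows "ent (Pi_pmf I d p) (\<lambda>f. restrict (\<lambda>j. g j (f j)) I) = (\<Sum>j\<in>I. ent (p j) (g j))"
  using assms
proof (induction I rule: finite_induct)
  case empty
  then show ?case by simp
next
  case (insert i I)
  have fI: "finite (set_pmf (Pi_pmf I d p))"
    using insert by (subst set_Pi_pmf) auto
  have fi: "finite (set_pmf (pair_pmf (p i) (Pi_pmf I d p)))" using insert fI by simp
  have "ent (Pi_pmf (insert i I) d p) (\<lambda>f. restrict (\<lambda>j. g j (f j)) (insert i I))
     = ent (pair_pmf (p i) (Pi_pmf I d p)) (\<lambda>z. restrict (\<lambda>j. g j (((\<lambda>(y, f). f(i := y)) z) j)) (insert i I))"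
    using insert by (subst Pi_pmf_insert) (auto simp: ent_map[OF fi])
  also have "\<dots> = ent (pair_pmf (p i) (Pi_pmf I d p)) (\<lambda>(x, f). (g i x, restrict (\<lambda>j. g j (f j)) I))"
    by (rule ent_cong[OF fi]) (use insert.hyps in \<open>auto simp: restrict_eq_iff split: if_splits\<close>)
  also have "\<dots> = ent (p i) (g i) + (\<Sum>j\<in>I. ent (p j) (g j))"
    unfolding ent_pair[OF insert.prems[OF insertI1] fI]
    by (simp only: insert.IH[OF insert.prems[OF insertI2]])
  finally show ?case by (simp only: sum.insert[OF insert.hyps])
qed

section \<open>The library's information measures as finite entropies\<close>

lemma mutual_info_eq_ent:
  assumes fin: "finite (set_pmf p)"
  shows "mutual_info p X Y = ent p X + ent p Y - ent p (\<lambda>w. (X w, Y w))"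
proof -
  interpret information_space "measure_pmf p" 2 
    by unfold_locales simp
  have D: "distributed (measure_pmf p) (count_space UNIV) Q (\<lambda>x. ennreal (pmf (map_pmf Q p) x))" for Q :: "_ \<Rightarrow> 'd"
    by (simp add: distributed_def map_pmf_rep_eq[symmetric] measure_pmf_eq_density[symmetric])
  have pc: "count_space UNIV \<Otimes>\<^sub>M count_space UNIV = (count_space UNIV :: ('b \<times> 'c) measure)"
    by (subst pair_measure_countable) auto
  let ?r = "map_pmf (\<lambda>w. (X w, Y w)) p"
  let ?F = "\<lambda>z. log 2 (pmf ?r z / (pmf (map_pmf X p) (fst z) * pmf (map_pmf Y p) (snd z)))"
  have "mutual_info p X Y = (\<integral>z. pmf ?r z * ?F z \<partial>(count_space UNIV \<Otimes>\<^sub>M count_space UNIV))"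
    unfolding mutual_info_def
    by (rule mutual_information_distr[where Px = "pmf (map_pmf X p)" and Py = "pmf (map_pmf Y p)" and Pxy = "pmf ?r"])
       (auto intro: sigma_finite_measure_count_space D simp: pc)
  also have "\<dots> = (\<integral>z. ?F z \<partial>measure_pmf ?r)"
    unfolding pc by (subst measure_pmf_eq_density, subst integral_density) auto
  also have "\<dots> = (\<Sum>z\<in>set_pmf ?r. pmf ?r z * ?F z)"
    using fin by (subst integral_measure_pmf[of "set_pmf ?r"]) auto
  also have "\<dots> = (\<Sum>w\<in>set_pmf p. pmf p w * ?F (X w, Y w))"
    by (rule sum_map_pmf[OF fin])
  also have "\<dots> = ent p X + ent p Y - ent p (\<lambda>w. (X w, Y w))"
    unfolding ent_def sum.distrib[symmetric] sum_subtractf[symmetric]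
  proof (intro sum.cong refl)
    fix w assume w: "w \<in> set_pmf p"
    show "pmf p w * ?F (X w, Y w) = pmf p w * - log 2 (pmf (map_pmf X p) (X w)) + pmf p w * - log 2 (pmf (map_pmf Y p) (Y w)) -
         pmf p w * - log 2 (pmf ?r (X w, Y w))"
      using pmf_map_pos[OF w, of X] pmf_map_pos[OF w, of Y] pmf_map_pos[OF w, of "\<lambda>w. (X w, Y w)"]
      by (simp add: log_divide log_mult algebra_simps)
  qed
  finally show ?thesis .
qed

lemma cond_mutual_info_eq_ent:
  assumes fin: "finite (set_pmf p)"
  shows "cond_mutual_info p X Y Z = ent p (\<lambda>w. (X w, Z w)) + ent p (\<lambda>w. (Y w, Z w)) - ent p Z - ent p (\<lambda>w. (X w, Y w, Z w))"
proof -
  interpret information_space "measure_pmf p" 2 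
    by unfold_locales simp
  have pc: "count_space UNIV \<Otimes>\<^sub>M count_space UNIV = (count_space UNIV :: ('c \<times> 'd) measure)"
    by (subst pair_measure_countable) auto
  \<comment> \<open>The library defines conditional mutual information through the chain rule, as
    \<open>I(X; Y, Z) - I(X; Z)\<close>.\<close>
  have "cond_mutual_info p X Y Z = mutual_info p X (\<lambda>w. (Y w, Z w)) - mutual_info p X Z"
    by (simp add: cond_mutual_info_def mutual_info_def prob_space.conditional_mutual_information_def[OF prob_space_measure_pmf] pc)
  then show ?thesis by (simp add: mutual_info_eq_ent[OF fin])
qed

lemma shannon_entropy_eq_ent:
  assumes fin: "finite (set_pmf p)"
  shows "shannon_entropy p X = ent p X"
proof -
  interpret information_space "measure_pmf p" 2 
    by unfold_locales simp
  let ?r = "map_pmf X p"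
  have D: "distributed (measure_pmf p) (count_space UNIV) X (\<lambda>x. ennreal (pmf ?r x))"
    by (simp add: distributed_def map_pmf_rep_eq[symmetric] measure_pmf_eq_density[symmetric])
  have "shannon_entropy p X = - (\<integral>x. pmf ?r x * log 2 (pmf ?r x) \<partial>count_space UNIV)"
    unfolding shannon_entropy_def by (rule entropy_distr[OF D]) auto
  also have "(\<integral>x. pmf ?r x * log 2 (pmf ?r x) \<partial>count_space UNIV) = (\<integral>x. log 2 (pmf ?r x) \<partial>measure_pmf ?r)"
    by (subst measure_pmf_eq_density, subst integral_density) auto
  also have "\<dots> = (\<Sum>z\<in>set_pmf ?r. pmf ?r z * log 2 (pmf ?r z))"
    using fin by (subst integral_measure_pmf[of "set_pmf ?r"]) auto
  also have "\<dots> = (\<Sum>w\<in>set_pmf p. pmf p w * log 2 (pmf ?r (X w)))"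
    by (rule sum_map_pmf[OF fin])
  finally show ?thesis by (simp add: ent_def sum_negf)
qed

section \<open>Conditional entropy as a function of the posterior\<close>

definition eta :: "real \<Rightarrow> real" where "eta x = x * - log 2 x"

text \<open>Continuity is needed up to the endpoint 0, where \<open>eta 0 = 0\<close>, since
  posteriors on the boundary of the simplex belong to the compact set of attainable ones.\<close>

lemma continuous_on_eta: "continuous_on {0..} eta"
  unfolding continuous_on_def
proof
  fix x :: real assume x: "x \<in> {0..}"
  show "(eta \<longlongrightarrow> eta x) (at x within {0..})"
  proof (cases "x = 0")
    case True
    have "((\<lambda>x::real. x * - (ln x / ln 2)) \<longlongrightarrow> 0) (at_right 0)" by real_asymp
    then have "(eta \<longlongrightarrow> eta 0) (at_right 0)" by (simp add: eta_def[abs_def] log_def)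
    then show ?thesis using True by (simp add: at_within_Ici_at_right)
  next
    case False
    then have "isCont eta x" using x unfolding eta_def[abs_def] by (auto intro!: continuous_intros)
    then show ?thesis unfolding isCont_def by (rule tendsto_within_subset) simp
  qed
qed

lemma pmf_marginal:
  fixes A :: "'w \<Rightarrow> 'a::finite"
  assumes fin: "finite (set_pmf p)"
  shows "pmf (map_pmf Y p) y = (\<Sum>a\<in>UNIV. pmf (map_pmf (\<lambda>w. (A w, Y w)) p) (a, y))"
proof -
  have "(\<Sum>a\<in>UNIV. pmf (map_pmf (\<lambda>w. (A w, Y w)) p) (a, y))
      = (\<Sum>a\<in>UNIV. \<Sum>v\<in>set_pmf p. pmf p v * of_bool (Y v = y) * of_bool (a = A v))"
    unfolding pmf_map_sum[OF fin] by (intro sum.cong) auto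
  also have "\<dots> = (\<Sum>v\<in>set_pmf p. \<Sum>a\<in>UNIV. pmf p v * of_bool (Y v = y) * of_bool (a = A v))"
    by (rule sum.swap)
  also have "\<dots> = (\<Sum>v\<in>set_pmf p. pmf p v * of_bool (Y v = y))"
    by (intro sum.cong refl) (simp add: sum_distrib_left[symmetric])
  finally show ?thesis by (simp add: pmf_map_sum[OF fin])
qed

lemma pmf_marginal':
  fixes A :: "'w \<Rightarrow> 'a::finite"
  assumes fin: "finite (set_pmf p)"
  shows "pmf (map_pmf Y p) y = (\<Sum>a\<in>UNIV. pmf (map_pmf (\<lambda>w. (Y w, A w)) p) (y, a))"
proof -
  have "pmf (map_pmf (\<lambda>w. (A w, Y w)) p) (a, y) = pmf (map_pmf (\<lambda>w. (Y w, A w)) p) (y, a)" for a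
    unfolding pmf_map_sum[OF fin] by (simp add: conj_commute)
  then show ?thesis by (simp add: pmf_marginal[OF fin, of Y y A])
qed

lemma pmf_map_fiber:
  assumes fin: "finite (set_pmf p)"
  shows "(\<Sum>u\<in>{u\<in>U ` set_pmf p. \<phi> u = v}. pmf (map_pmf (\<lambda>w. (U w, A w)) p) (u, a)) = pmf (map_pmf (\<lambda>w. (\<phi> (U w), A w)) p) (v, a)"
proof -
  have "(\<Sum>u\<in>{u\<in>U ` set_pmf p. \<phi> u = v}. pmf (map_pmf (\<lambda>w. (U w, A w)) p) (u, a))
     = (\<Sum>w\<in>set_pmf p. \<Sum>u\<in>{u\<in>U ` set_pmf p. \<phi> u = v}. if u = U w then pmf p w * of_bool (A w = a) else 0)"
    unfolding pmf_map_sum[OF fin] by (subst sum.swap) (intro sum.cong refl, auto)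
  also have "\<dots> = (\<Sum>w\<in>set_pmf p. pmf p w * of_bool ((\<phi> (U w), A w) = (v, a)))"
    using fin by (intro sum.cong refl) (subst sum.delta, auto)
  finally show ?thesis by (simp add: pmf_map_sum[OF fin])
qed

text \<open>Entropy of \<open>g\<close> when \<open>t\<close> has law \<open>\<pi>\<close> and \<open>g\<close> has its conditional law given \<open>t\<close>. A letter of probability 0
  under \<open>s\<close> is dropped (\<open>x / 0 = 0\<close>), which is harmless because posteriors vanish there.\<close>

definition hcond :: "'s pmf \<Rightarrow> ('s \<Rightarrow> 'a::finite) \<Rightarrow> ('s \<Rightarrow> 'b::finite) \<Rightarrow> real ^ 'a \<Rightarrow> real" where
  "hcond s t g \<pi> = (\<Sum>b\<in>UNIV. eta (\<Sum>a\<in>UNIV. \<pi> $ a * (pmf (map_pmf (\<lambda>w. (t w, g w)) s) (a, b) / pmf (map_pmf t s) a)))"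

definition posterior :: "('u \<times> 's) pmf \<Rightarrow> ('s \<Rightarrow> 'a::finite) \<Rightarrow> 'u \<Rightarrow> real ^ 'a" where
  "posterior q t u = (\<chi> a. pmf (map_pmf (\<lambda>z. (fst z, t (snd z))) q) (u, a) / pmf (map_pmf fst q) u)"

text \<open>Given \<open>u\<close>, the law of \<open>g\<close> is the mixture of its conditional
  laws given \<open>t\<close>, weighted by the posterior of \<open>t\<close>, because
  \<open>u\<close> depends on the state through \<open>t\<close> only. A conditional entropy given
  \<open>U\<close> is therefore the average of one fixed function of the posterior, whatever the
  alphabet of \<open>U\<close>.\<close>

lemma ent_cond_kernel:
  fixes t :: "'s \<Rightarrow> 'a::finite" and g :: "'s \<Rightarrow> 'b::finite"
  assumes fin: "finite (set_pmf (kernel_law s t L))"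
  defines "q \<equiv> kernel_law s t L"
  shows "ent q (\<lambda>z. (g (snd z), fst z)) - ent q fst
    = (\<Sum>u\<in>set_pmf (map_pmf fst q). pmf (map_pmf fst q) u * hcond s t g (posterior q t u))"
proof -
  let ?r = "map_pmf (\<lambda>z. (g (snd z), fst z)) q"
  let ?P = "pmf (map_pmf fst q)"
  define \<kappa> where "\<kappa> u b = (\<Sum>a\<in>UNIV. posterior q t u $ a * (pmf (map_pmf (\<lambda>w. (t w, g w)) s) (a, b) / pmf (map_pmf t s) a))" for u b
  have finq: "finite (set_pmf q)" using fin by (simp add: q_def)
  have pt: "pmf (map_pmf (\<lambda>z. (fst z, t (snd z))) q) (u, a) = pmf (map_pmf t s) a * pmf (L a) u" for u a
    unfolding q_def using map_kernel_law_state[of t s "\<lambda>c. c" L] by (simp add: pmf_kernel_law)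
  have ptg: "pmf (map_pmf (\<lambda>z. (t (snd z), g (snd z), fst z)) q) (a, b, u) = pmf (map_pmf (\<lambda>w. (t w, g w)) s) (a, b) * pmf (L a) u" for u a b
  proof -
    have "map_pmf (\<lambda>z. (t (snd z), g (snd z), fst z)) q = map_pmf (\<lambda>(u, a, b). (a, b, u)) (map_pmf (\<lambda>z. (fst z, (\<lambda>w. (t w, g w)) (snd z))) q)"
      by (simp add: pmf.map_comp o_def)
    also have "pmf \<dots> (a, b, u) = pmf (map_pmf (\<lambda>z. (fst z, (\<lambda>w. (t w, g w)) (snd z))) q) (u, a, b)"
      using pmf_map_inj'[of "\<lambda>(u, a, b). (a, b, u)" _ "(u, a, b)"] by (simp add: inj_on_def)
    also have "\<dots> = pmf (map_pmf (\<lambda>w. (t w, g w)) s) (a, b) * pmf (L a) u"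
      unfolding q_def using map_kernel_law_state[of "\<lambda>w. (t w, g w)" s fst L] by (simp add: pmf_kernel_law)
    finally show ?thesis .
  qed
  have le: "pmf (map_pmf t s) a = 0 \<Longrightarrow> pmf (map_pmf (\<lambda>w. (t w, g w)) s) (a, b) = 0" for a b
    by (auto simp: pmf_eq_0_set_pmf)
  have rb: "pmf ?r (b, u) = ?P u * \<kappa> u b" for b u
  proof (cases "?P u = 0")
    case True
    then have "u \<notin> fst ` set_pmf q" by (simp add: pmf_eq_0_set_pmf)
    then have "(b, u) \<notin> set_pmf ?r" by force
    then show ?thesis using True by (simp add: pmf_eq_0_set_pmf[symmetric] del: set_map_pmf)
  next
    case False
    have "pmf ?r (b, u) = (\<Sum>a\<in>UNIV. pmf (map_pmf (\<lambda>z. (t (snd z), g (snd z), fst z)) q) (a, b, u))"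
      by (rule pmf_marginal[OF finq])
    also have "\<dots> = ?P u * \<kappa> u b"
      unfolding \<kappa>_def sum_distrib_left ptg
      by (intro sum.cong refl) (use False le in \<open>auto simp: posterior_def pt\<close>)
    finally show ?thesis .
  qed
  have "ent q (\<lambda>z. (g (snd z), fst z)) - ent q fst = (\<Sum>z\<in>set_pmf q. pmf q z * - log 2 (\<kappa> (fst z) (g (snd z))))"
    unfolding ent_def sum_subtractf[symmetric]
  proof (intro sum.cong refl)
    fix z assume z: "z \<in> set_pmf q"
    have "0 < ?P (fst z)" "0 < pmf ?r (g (snd z), fst z)" 
      using pmf_map_pos[OF z, of fst] pmf_map_pos[OF z, of "\<lambda>z. (g (snd z), fst z)"] by auto
    then have "0 < ?P (fst z)" "0 < \<kappa> (fst z) (g (snd z))" unfolding rb by (auto simp: zero_less_mult_iff)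
    then show "pmf q z * - log 2 (pmf ?r (g (snd z), fst z)) - pmf q z * - log 2 (?P (fst z)) = pmf q z * - log 2 (\<kappa> (fst z) (g (snd z)))"
      unfolding rb by (simp add: log_mult algebra_simps)
  qed
  also have "\<dots> = (\<Sum>z\<in>set_pmf ?r. pmf ?r z * - log 2 (\<kappa> (snd z) (fst z)))"
    by (subst sum_map_pmf[OF finq]) simp
  also have "\<dots> = (\<Sum>z\<in>UNIV \<times> set_pmf (map_pmf fst q). pmf ?r z * - log 2 (\<kappa> (snd z) (fst z)))"
  proof (rule sum.mono_neutral_left)
    show "set_pmf ?r \<subseteq> UNIV \<times> set_pmf (map_pmf fst q)" by auto
    show "\<forall>z\<in>UNIV \<times> set_pmf (map_pmf fst q) - set_pmf ?r. pmf ?r z * - log 2 (\<kappa> (snd z) (fst z)) = 0"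
      by (auto simp only: pmf_eq_0_set_pmf[symmetric])
  qed (use finq in simp)
  also have "\<dots> = (\<Sum>u\<in>set_pmf (map_pmf fst q). \<Sum>b\<in>UNIV. pmf ?r (b, u) * - log 2 (\<kappa> u b))"
    by (simp add: sum.cartesian_product' sum.swap[of _ UNIV])
  also have "\<dots> = (\<Sum>u\<in>set_pmf (map_pmf fst q). ?P u * hcond s t g (posterior q t u))"
    unfolding hcond_def \<kappa>_def[symmetric] sum_distrib_left rb eta_def by (simp add: mult.assoc)
  finally show ?thesis .
qed

lemma continuous_on_hcond:
  "continuous_on {\<pi>. \<forall>a. 0 \<le> \<pi> $ a} (hcond s t g)"
  unfolding hcond_def[abs_def]
  by (intro continuous_on_sum continuous_on_compose2[OF continuous_on_eta] continuous_intros)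
     (auto intro!: sum_nonneg)

section \<open>The convex hull of achievable information quantities\<close>

definition cX :: "'a \<times> 'x \<times> 'y \<times> 'z \<Rightarrow> 'x" where "cX w = fst (snd w)"
definition cY :: "'a \<times> 'x \<times> 'y \<times> 'z \<Rightarrow> 'y" where "cY w = fst (snd (snd w))"
definition cZ :: "'a \<times> 'x \<times> 'y \<times> 'z \<Rightarrow> 'z" where "cZ w = snd (snd (snd w))"

text \<open>The only function of the posterior that the bounds evaluate at the level of
  \<open>V\<close>; all others are evaluated at the level of \<open>U\<close>.\<close>

definition gain :: "('a::finite \<times> 'x::finite \<times> 'y::finite \<times> 'z::finite) pmf \<Rightarrow> real ^ 'a \<Rightarrow> real" where
  "gain s \<pi> = hcond s fst cY \<pi> - hcond s fst cZ \<pi>"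

definition features :: "('a::finite \<times> 'x::finite \<times> 'y::finite \<times> 'z::finite) pmf \<Rightarrow> real ^ 'a \<Rightarrow> real \<times> real \<times> real" where
  "features s \<pi> = (gain s \<pi>, hcond s fst (\<lambda>w. (fst w, cY w)) \<pi> - hcond s fst cY \<pi>,
     hcond s fst (\<lambda>w. (cX w, cY w)) \<pi> - hcond s fst cY \<pi>)"

definition prob_simplex :: "(real ^ 'a::finite) set" where
  "prob_simplex = {\<pi>. (\<forall>a. 0 \<le> \<pi> $ a) \<and> (\<Sum>a\<in>UNIV. \<pi> $ a) = 1}"

text \<open>The inner mixture, over \<open>U\<close> for a fixed value of \<open>V\<close>. The
  posterior is kept as a coordinate because its mean is the posterior given that value of
  \<open>V\<close>; there the outer mixture \<open>region_hull\<close> evaluates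
  \<open>gain\<close>. The same coordinate records the law of \<open>Xt\<close> after the outer
  mixture.\<close>

definition graph_hull :: "('a::finite \<times> 'x::finite \<times> 'y::finite \<times> 'z::finite) pmf \<Rightarrow> ((real ^ 'a) \<times> real \<times> real \<times> real) set" where
  "graph_hull s = convex hull ((\<lambda>\<pi>. (\<pi>, features s \<pi>)) ` prob_simplex)"

definition region_hull :: "('a::finite \<times> 'x::finite \<times> 'y::finite \<times> 'z::finite) pmf \<Rightarrow> ((real ^ 'a) \<times> real \<times> real \<times> real \<times> real) set" where
  "region_hull s = convex hull ((\<lambda>t. (fst t, gain s (fst t), snd t)) ` graph_hull s)"

lemma compact_prob_simplex: "compact (prob_simplex :: (real ^ 'a::finite) set)"
proof -
  have "prob_simplex \<subseteq> (cbox 0 1 :: (real ^ 'a) set)"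
  proof
    fix \<pi> :: "real ^ 'a" assume p: "\<pi> \<in> prob_simplex"
    have "\<pi> $ a \<le> 1" for a
      using p member_le_sum[of a UNIV "\<lambda>a. \<pi> $ a"] by (auto simp: prob_simplex_def)
    then show "\<pi> \<in> cbox 0 1" using p by (auto simp: mem_box_cart prob_simplex_def)
  qed
  moreover have "closed (prob_simplex :: (real ^ 'a) set)"
  proof -
    have "prob_simplex = (\<Inter>a. {\<pi> :: real ^ 'a. 0 \<le> \<pi> $ a}) \<inter> {\<pi>. (\<Sum>a\<in>UNIV. \<pi> $ a) = 1}"
      by (auto simp: prob_simplex_def)
    also have "closed \<dots>"
      by (intro closed_Int closed_INT ballI closed_Collect_le closed_Collect_eq continuous_intros)
    finally show ?thesis .
  qed
  ultimately show ?thesis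
    by (metis bounded_cbox bounded_subset compact_eq_bounded_closed)
qed

lemma convex_prob_simplex: "convex (prob_simplex :: (real ^ 'a::finite) set)"
  unfolding convex_def prob_simplex_def
  by (auto simp: sum.distrib sum_distrib_left[symmetric])

lemma continuous_on_hcond_simplex: "continuous_on prob_simplex (hcond s t g)"
  by (rule continuous_on_subset[OF continuous_on_hcond]) (auto simp: prob_simplex_def)

lemma fst_graph_hull: "t \<in> graph_hull s \<Longrightarrow> fst t \<in> prob_simplex"
proof -
  have "graph_hull s \<subseteq> prob_simplex \<times> UNIV"
    unfolding graph_hull_def by (intro hull_minimal convex_Times convex_prob_simplex) auto
  then show "t \<in> graph_hull s \<Longrightarrow> fst t \<in> prob_simplex" by auto
qed

lemma compact_graph_hull: "compact (graph_hull s)"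
  unfolding graph_hull_def
  by (intro compact_convex_hull compact_continuous_image compact_prob_simplex)
     (unfold features_def gain_def, intro continuous_intros continuous_on_hcond_simplex)

lemma compact_region_hull: "compact (region_hull s)"
proof -
  have "continuous_on (graph_hull s) (\<lambda>t. gain s (fst t))"
    unfolding gain_def
    by (intro continuous_intros continuous_on_compose2[OF continuous_on_hcond_simplex]) (auto intro: fst_graph_hull simp del: split_paired_All split_paired_Ex)
  then show ?thesis
    unfolding region_hull_def
    by (intro compact_convex_hull compact_continuous_image compact_graph_hull continuous_intros)
qed

lemma convex_region_hull: "convex (region_hull s)"
  by (simp add: region_hull_def)

definition joint_ent :: "('u \<times> 's) pmf \<Rightarrow> ('s \<Rightarrow> 'b) \<Rightarrow> ('u \<Rightarrow> 'v) \<Rightarrow> real" where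
  "joint_ent q g \<phi> = ent q (\<lambda>z. (g (snd z), \<phi> (fst z)))"

definition source_marginal :: "('a::finite \<times> 'b) pmf \<Rightarrow> real ^ 'a" where
  "source_marginal s = (\<chi> a. pmf (map_pmf fst s) a)"

text \<open>With \<open>V = \<phi> U\<close>, the components after the law of \<open>Xt\<close> are \<open>H(Y|V) - H(Z|V)\<close>, \<open>H(Y|U) - H(Z|U)\<close>,
  \<open>H(Xt|Y, U)\<close> and \<open>H(X|Y, U)\<close>; the entropies of \<open>V\<close> and \<open>U\<close> cancel.\<close>

definition region_point :: "('u \<times> ('a::finite \<times> 'x \<times> 'y \<times> 'z)) pmf \<Rightarrow> ('u \<Rightarrow> 'v) \<Rightarrow> (real ^ 'a) \<times> real \<times> real \<times> real \<times> real" where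
  "region_point q \<phi> = (source_marginal (map_pmf snd q), joint_ent q cY \<phi> - joint_ent q cZ \<phi>,
     joint_ent q cY (\<lambda>u. u) - joint_ent q cZ (\<lambda>u. u),
     joint_ent q (\<lambda>w. (fst w, cY w)) (\<lambda>u. u) - joint_ent q cY (\<lambda>u. u),
     joint_ent q (\<lambda>w. (cX w, cY w)) (\<lambda>u. u) - joint_ent q cY (\<lambda>u. u))"

lemma posterior_simplex:
  assumes fin: "finite (set_pmf q)" and u: "u \<in> fst ` set_pmf q"
  shows "posterior q t u \<in> prob_simplex"
proof -
  have "pmf (map_pmf fst q) u \<noteq> 0" using u by (simp add: pmf_eq_0_set_pmf)
  moreover have "pmf (map_pmf fst q) u = (\<Sum>a\<in>UNIV. pmf (map_pmf (\<lambda>z. (fst z, t (snd z))) q) (u, a))"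
    by (rule pmf_marginal'[OF fin])
  ultimately show ?thesis
    by (auto simp: prob_simplex_def posterior_def sum_divide_distrib[symmetric] intro!: divide_nonneg_nonneg sum_nonneg)
qed

lemma joint_ent_kernel:
  assumes "finite (set_pmf (kernel_law s t L))"
  defines "q \<equiv> kernel_law s t L"
  shows "joint_ent q g (\<lambda>u. u) - ent q fst
    = (\<Sum>u\<in>fst ` set_pmf q. pmf (map_pmf fst q) u * hcond s t g (posterior q t u))"
  unfolding joint_ent_def q_def using ent_cond_kernel[OF assms(1), of g] by simp

lemma joint_ent_relabel:
  assumes "finite (set_pmf q)"
  shows "joint_ent (map_pmf (\<lambda>z. (\<phi> (fst z), snd z)) q) g \<psi> = joint_ent q g (\<lambda>u. \<psi> (\<phi> u))"
  unfolding joint_ent_def by (subst ent_map[OF assms]) simp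

text \<open>The posterior given \<open>V = v\<close> is the barycentre of the posteriors given the
  values of \<open>U\<close> in the fibre over \<open>v\<close>. So every auxiliary pair, on finite
  but arbitrarily large alphabets, is a mixture over \<open>V\<close> of mixtures over
  \<open>U\<close>.\<close>

lemma region_point_in_hull:
  fixes s :: "('a::finite \<times> 'x::finite \<times> 'y::finite \<times> 'z::finite) pmf"
  assumes fin: "finite (set_pmf (kernel_law s fst L))"
  shows "region_point (kernel_law s fst L) \<phi> \<in> region_hull s"
proof -
  define q where "q = kernel_law s fst L"
  define q' where "q' = map_pmf (\<lambda>z. (\<phi> (fst z), snd z)) q"
  have q'_alt: "q' = kernel_law s fst (\<lambda>a. map_pmf \<phi> (L a))"
    by (simp add: q'_def q_def map_kernel_law_input)
  have finq: "finite (set_pmf q)" using fin by (simp add: q_def)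
  have finq': "finite (set_pmf q')" using finq by (simp add: q'_def)
  define P where "P = pmf (map_pmf fst q)"
  define P' where "P' = pmf (map_pmf fst q')"
  define \<pi> where "\<pi> = posterior q fst"
  define \<pi>' where "\<pi>' = posterior q' fst"
  let ?U = "fst ` set_pmf q"
  let ?V = "fst ` set_pmf q'"
  let ?U' = "\<lambda>v. {u \<in> ?U. \<phi> u = v}"
  have V: "?V = \<phi> ` ?U" by (auto simp: q'_def image_image)
  have P'v: "P' v = (\<Sum>u\<in>?U' v. P u)" for v
  proof -
    have "pmf (map_pmf (\<lambda>z. (\<phi> (fst z), ())) q) (v, ()) = P' v"
      using pmf_marginal'[OF finq, of "\<lambda>z. \<phi> (fst z)" v "\<lambda>_. ()"]
      by (simp add: P'_def q'_def pmf.map_comp o_def UNIV_unit)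
    moreover have "pmf (map_pmf (\<lambda>z. (fst z, ())) q) (u, ()) = P u" for u
      using pmf_marginal'[OF finq, of fst u "\<lambda>_. ()"] by (simp add: P_def UNIV_unit)
    ultimately show ?thesis using pmf_map_fiber[OF finq, where U = fst and \<phi> = \<phi> and v = v and A = "\<lambda>_. ()" and a = "()"] by simp
  qed
  have Ppos: "0 < P u" if "u \<in> ?U" for u using that by (simp add: P_def pmf_positive)
  have P'pos: "0 < P' v" if "v \<in> ?V" for v using that by (simp add: P'_def pmf_positive)
  have P\<pi>: "P u * \<pi> u $ a = pmf (map_pmf (\<lambda>z. (fst z, fst (snd z))) q) (u, a)" if "u \<in> ?U" for u a
    using Ppos[OF that] by (simp add: \<pi>_def posterior_def P_def[symmetric])
  \<comment> \<open>The weights \<open>P u / P' v\<close> are the conditional probabilities of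
    \<open>U = u\<close> given \<open>V = v\<close>.\<close>
  define t where "t v = (\<Sum>u\<in>?U' v. (P u / P' v) *\<^sub>R (\<pi> u, features s (\<pi> u)))" for v
  have t_in: "t v \<in> graph_hull s" if v: "v \<in> ?V" for v
    unfolding t_def
  proof (rule convex_sum)
    show "finite (?U' v)" using finq by simp
    show "convex (graph_hull s)" by (simp add: graph_hull_def)
    show "(\<Sum>u\<in>?U' v. P u / P' v) = 1"
      using P'pos[OF v] by (simp add: sum_divide_distrib[symmetric] P'v)
    show "0 \<le> P u / P' v" for u by (simp add: P_def P'_def)
    show "(\<pi> u, features s (\<pi> u)) \<in> graph_hull s" if "u \<in> ?U' v" for u
      unfolding graph_hull_def using that posterior_simplex[OF finq, of u fst]
      by (intro hull_inc) (auto simp: \<pi>_def)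
  qed
  have fst_t: "fst (t v) = \<pi>' v" if v: "v \<in> ?V" for v
  proof (rule vec_eq_iff[THEN iffD2], rule allI)
    fix a
    have "fst (t v) $ a = (\<Sum>u\<in>?U' v. P u / P' v * \<pi> u $ a)"
      by (simp add: t_def fst_sum)
    also have "\<dots> = (\<Sum>u\<in>?U' v. pmf (map_pmf (\<lambda>z. (fst z, fst (snd z))) q) (u, a)) / P' v"
      unfolding sum_divide_distrib by (intro sum.cong refl) (simp add: P\<pi>[symmetric])
    also have "\<dots> = \<pi>' v $ a"
      unfolding pmf_map_fiber[OF finq] by (simp add: \<pi>'_def posterior_def P'_def q'_def pmf.map_comp o_def)
    finally show "fst (t v) $ a = \<pi>' v $ a" .
  qed
  have sum1: "(\<Sum>v\<in>?V. P' v) = 1" unfolding P'_def using finq' by (intro sum_pmf_eq_1) auto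
  have "(\<Sum>v\<in>?V. P' v *\<^sub>R (fst (t v), gain s (fst (t v)), snd (t v))) \<in> region_hull s"
  proof (rule convex_sum)
    show "(fst (t v), gain s (fst (t v)), snd (t v)) \<in> region_hull s" if "v \<in> ?V" for v
      unfolding region_hull_def by (intro hull_inc image_eqI[where x = "t v"] refl t_in that)
  qed (use finq' sum1 in \<open>auto simp: P'_def convex_region_hull\<close>)
  moreover have "(\<Sum>v\<in>?V. P' v *\<^sub>R (fst (t v), gain s (fst (t v)), snd (t v))) = region_point q \<phi>"
  proof -
    \<comment> \<open>The tower property: averaging over \<open>V\<close> the conditional averages
      of \<open>U\<close> is averaging over \<open>U\<close>.\<close>
    have grp: "(\<Sum>v\<in>?V. P' v *\<^sub>R t v) = (\<Sum>u\<in>?U. P u *\<^sub>R (\<pi> u, features s (\<pi> u)))"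
    proof -
      have "(\<Sum>v\<in>?V. P' v *\<^sub>R t v) = (\<Sum>v\<in>\<phi> ` ?U. \<Sum>u\<in>?U' v. P u *\<^sub>R (\<pi> u, features s (\<pi> u)))"
        unfolding V
      proof (intro sum.cong refl)
        fix v assume "v \<in> \<phi> ` ?U"
        then have "P' v \<noteq> 0" using P'pos[of v] V by auto
        then show "P' v *\<^sub>R t v = (\<Sum>u\<in>?U' v. P u *\<^sub>R (\<pi> u, features s (\<pi> u)))"
          unfolding t_def scaleR_sum_right by (intro sum.cong refl) simp
      qed
      also have "\<dots> = (\<Sum>u\<in>?U. P u *\<^sub>R (\<pi> u, features s (\<pi> u)))"
        using finq by (intro sum.group) auto
      finally show ?thesis .
    qed
    have c1: "(\<Sum>v\<in>?V. P' v *\<^sub>R fst (t v)) = source_marginal s"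
    proof -
      have "(\<Sum>v\<in>?V. P' v *\<^sub>R fst (t v)) = (\<Sum>u\<in>?U. P u *\<^sub>R \<pi> u)"
        using arg_cong[OF grp, of fst] by (simp add: fst_sum)
      also have "\<dots> = source_marginal s"
      proof (rule vec_eq_iff[THEN iffD2], rule allI)
        fix a
        have "(\<Sum>u\<in>?U. P u *\<^sub>R \<pi> u) $ a = (\<Sum>u\<in>?U. pmf (map_pmf (\<lambda>z. (fst z, fst (snd z))) q) (u, a))"
          unfolding sum_component by (intro sum.cong refl) (simp add: P\<pi>)
        also have "\<dots> = pmf (map_pmf (\<lambda>z. ((), fst (snd z))) q) ((), a)"
          using pmf_map_fiber[OF finq, where U = fst and \<phi> = "\<lambda>_. ()" and v = "()" and A = "\<lambda>z. fst (snd z)" and a = a] by simp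
        also have "\<dots> = pmf (map_pmf (\<lambda>z. fst (snd z)) q) a"
          using pmf_marginal[OF finq, of "\<lambda>z. fst (snd z)" a "\<lambda>_. ()"] by (simp add: UNIV_unit)
        also have "map_pmf (\<lambda>z. fst (snd z)) q = map_pmf fst s"
          using pmf.map_comp[of fst snd q] by (simp add: q_def map_snd_kernel_law o_def)
        finally show "(\<Sum>u\<in>?U. P u *\<^sub>R \<pi> u) $ a = source_marginal s $ a"
          by (simp add: source_marginal_def)
      qed
      finally show ?thesis .
    qed
    \<comment> \<open>The subtracted entropy of \<open>V\<close> does not depend on
      \<open>g\<close>, so it cancels in every difference formed below; likewise for
      \<open>U\<close> in \<open>je\<close>.\<close>
    have je': "joint_ent q g \<phi> - ent q' fst = (\<Sum>v\<in>?V. P' v * hcond s fst g (fst (t v)))" for g :: "_ \<Rightarrow> 'g::finite"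
      using joint_ent_kernel[of s fst "\<lambda>a. map_pmf \<phi> (L a)" g] finq' joint_ent_relabel[OF finq, of \<phi> g "\<lambda>u. u"]
      by (simp add: q'_alt[symmetric] q'_def[symmetric] P'_def[symmetric] \<pi>'_def[symmetric] fst_t)
    have je: "joint_ent q g (\<lambda>u. u) - ent q fst = (\<Sum>u\<in>?U. P u * hcond s fst g (\<pi> u))" for g :: "_ \<Rightarrow> 'g::finite"
      using joint_ent_kernel[OF fin, of g] by (simp add: q_def P_def \<pi>_def)
    have c2: "(\<Sum>v\<in>?V. P' v * gain s (fst (t v))) = joint_ent q cY \<phi> - joint_ent q cZ \<phi>"
      using je'[of cY] je'[of cZ] by (simp add: gain_def right_diff_distrib sum_subtractf)
    have c3: "(\<Sum>v\<in>?V. P' v *\<^sub>R snd (t v)) = snd (snd (region_point q \<phi>))"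
    proof -
      have "(\<Sum>v\<in>?V. P' v *\<^sub>R snd (t v)) = (\<Sum>u\<in>?U. P u *\<^sub>R features s (\<pi> u))"
        using arg_cong[OF grp, of snd] by (simp add: snd_sum)
      also have "\<dots> = snd (snd (region_point q \<phi>))"
        using je[of cY] je[of cZ] je[of "\<lambda>w. (fst w, cY w)"] je[of "\<lambda>w. (cX w, cY w)"]
        by (simp add: prod_eq_iff fst_sum snd_sum features_def gain_def region_point_def right_diff_distrib sum_subtractf)
      finally show ?thesis .
    qed
    show ?thesis
      using c1 c2 c3
      by (simp add: prod_eq_iff fst_sum snd_sum region_point_def) (simp add: q_def map_snd_kernel_law)
  qed
  ultimately show ?thesis by (simp add: q_def)
qed

section \<open>Realization with bounded auxiliary alphabets\<close>

text \<open>Caratheodory's theorem, padded to exactly \<open>N\<close> terms. The padding repeats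
  some point of the set with weight 0. A number of terms common to all decompositions allows pairs
  of indices to be coded by division with remainder.\<close>

lemma convex_hull_indexed:
  fixes p :: "'v::euclidean_space set"
  assumes x: "x \<in> convex hull p" and N: "aff_dim p + 1 \<le> int N"
  obtains c :: "nat \<Rightarrow> real" and pts where "\<And>j. 0 \<le> c j" "\<And>j. pts j \<in> p" "sum c {..<N} = 1" "(\<Sum>j<N. c j *\<^sub>R pts j) = x"
proof -
  obtain S u where S: "finite S" "S \<subseteq> p" "card S \<le> aff_dim p + 1" "\<forall>x\<in>S. 0 \<le> u x" "sum u S = 1" "(\<Sum>v\<in>S. u v *\<^sub>R v) = x"
    using x unfolding convex_hull_caratheodory_aff_dim by blast
  have cN: "card S \<le> N" using S(3) N by linarith
  have ne: "S \<noteq> {}" using S(5) by auto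
  obtain h where h: "bij_betw h {..<card S} S"
    using ex_bij_betw_nat_finite[OF S(1)] by (auto simp: atLeast0LessThan)
  define pts where "pts j = (if j < card S then h j else (SOME v. v \<in> S))" for j
  define c where "c j = (if j < card S then u (h j) else 0)" for j
  have hS: "h j \<in> S" if "j < card S" for j using h that by (auto simp: bij_betw_def)
  have r: "(\<Sum>j<N. F j) = (\<Sum>j<card S. F j)" if "\<And>j. \<not> j < card S \<Longrightarrow> F j = 0" for F :: "nat \<Rightarrow> 'w::comm_monoid_add"
    using cN that by (intro sum.mono_neutral_right) auto
  show thesis
  proof
    show "0 \<le> c j" for j using S(4) hS by (simp add: c_def)
    show "pts j \<in> p" for j using S(2) hS ne some_in_eq[of S] by (auto simp: pts_def)
    have "sum c {..<N} = (\<Sum>j<card S. u (h j))" by (subst r) (auto simp: c_def)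
    then show "sum c {..<N} = 1" using sum.reindex_bij_betw[OF h, of u] S(5) by simp
    have "(\<Sum>j<N. c j *\<^sub>R pts j) = (\<Sum>j<card S. u (h j) *\<^sub>R h j)" by (subst r) (auto simp: c_def pts_def)
    then show "(\<Sum>j<N. c j *\<^sub>R pts j) = x" using sum.reindex_bij_betw[OF h, of "\<lambda>v. u v *\<^sub>R v"] S(6) by simp
  qed
qed

lemma pmf_of_weights:
  assumes "finite A" and f: "\<And>u. 0 \<le> f u" "\<And>u. u \<notin> A \<Longrightarrow> f u = 0" "sum f A = 1"
  shows "\<exists>p. \<forall>u. pmf p u = (f u :: real)"
proof -
  have "(\<integral>\<^sup>+u. ennreal (f u) \<partial>count_space UNIV) = (\<Sum>u\<in>A. ennreal (f u))"
    using assms by (intro nn_integral_count_space') auto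
  also have "\<dots> = 1" using f by (simp add: sum_ennreal)
  finally have "pmf (embed_pmf f) u = f u" for u using f by (intro pmf_embed_pmf) auto
  then show ?thesis by blast
qed

text \<open>Weights and points of a convex combination can be read back as the law of
  \<open>u\<close> and its posteriors. Indices of weight 0 have no meaningful posterior but
  contribute nothing. The result is applied to \<open>U\<close> and to \<open>V\<close>.\<close>

lemma joint_ent_kernel_indexed:
  fixes s :: "('a::finite \<times> 'b::finite) pmf" and g :: "_ \<Rightarrow> 'g::finite"
  assumes fin: "finite (set_pmf (kernel_law s fst L))" and I: "finite I"
    and joint: "\<And>u a. pmf (map_pmf fst s) a * pmf (L a) u = (if u \<in> I then c u * \<pi> u $ a else 0)"
    and \<pi>: "\<And>u. u \<in> I \<Longrightarrow> \<pi> u \<in> prob_simplex"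
  shows "joint_ent (kernel_law s fst L) g (\<lambda>u. u) - ent (kernel_law s fst L) fst = (\<Sum>u\<in>I. c u * hcond s fst g (\<pi> u))"
proof -
  define q where "q = kernel_law s fst L"
  have finq: "finite (set_pmf q)" using fin by (simp add: q_def)
  have pt: "pmf (map_pmf (\<lambda>z. (fst z, fst (snd z))) q) (u, a) = (if u \<in> I then c u * \<pi> u $ a else 0)" for u a
    unfolding q_def using map_kernel_law_state[of fst s "\<lambda>c. c" L] by (simp add: pmf_kernel_law joint)
  have P: "pmf (map_pmf fst q) u = (if u \<in> I then c u else 0)" for u
    unfolding pmf_marginal'[OF finq, of fst u "\<lambda>z. fst (snd z)"] pt
    using \<pi>[of u] by (auto simp: sum_distrib_left[symmetric] prob_simplex_def)
  have post: "posterior q fst u = \<pi> u" if "u \<in> fst ` set_pmf q" for u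
  proof -
    have "pmf (map_pmf fst q) u \<noteq> 0" using that by (simp add: pmf_eq_0_set_pmf)
    then show ?thesis by (auto simp: posterior_def pt P vec_eq_iff split: if_splits)
  qed
  have sub: "fst ` set_pmf q \<subseteq> I"
  proof
    fix u assume "u \<in> fst ` set_pmf q"
    then have "pmf (map_pmf fst q) u \<noteq> 0" by (simp add: pmf_eq_0_set_pmf)
    then show "u \<in> I" by (auto simp: P split: if_splits)
  qed
  have out: "c u = 0" if "u \<in> I - fst ` set_pmf q" for u
  proof -
    have "pmf (map_pmf fst q) u = 0" using that by (simp add: pmf_eq_0_set_pmf)
    then show ?thesis using that P[of u] by simp
  qed
  have "joint_ent q g (\<lambda>u. u) - ent q fst = (\<Sum>u\<in>fst ` set_pmf q. pmf (map_pmf fst q) u * hcond s fst g (posterior q fst u))"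
    using joint_ent_kernel[OF fin, of g] by (simp add: q_def)
  also have "\<dots> = (\<Sum>u\<in>fst ` set_pmf q. c u * hcond s fst g (\<pi> u))"
    using sub by (intro sum.cong refl) (auto simp: post P simp del: split_paired_All)
  also have "\<dots> = (\<Sum>u\<in>I. c u * hcond s fst g (\<pi> u))"
    using sub out I by (intro sum.mono_neutral_left) auto
  finally show ?thesis by (simp add: q_def)
qed

text \<open>The ambient dimension is \<open>CARD('a) + 3\<close>; the coordinates of a probability
  vector sum to 1, which puts the graph into a hyperplane and saves one dimension.\<close>

lemma aff_dim_graph:
  "aff_dim ((\<lambda>\<pi> :: real ^ 'a::finite. (\<pi>, features s \<pi>)) ` prob_simplex) \<le> int CARD('a) + 2"
proof -
  let ?n = "((\<chi> a. 1), 0) :: (real ^ 'a) \<times> real \<times> real \<times> real"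
  have "aff_dim ((\<lambda>\<pi> :: real ^ 'a. (\<pi>, features s \<pi>)) ` prob_simplex) \<le> aff_dim {v. ?n \<bullet> v = 1}"
    by (intro aff_dim_subset) (auto simp: prob_simplex_def inner_vec_def)
  also have "\<dots> = int (DIM((real ^ 'a) \<times> real \<times> real \<times> real) - 1)"
    by (rule aff_dim_hyperplane) (auto simp: vec_eq_iff zero_prod_def)
  finally show ?thesis by simp
qed

lemma sum_div_mod:
  fixes F :: "nat \<Rightarrow> nat \<Rightarrow> 'w::comm_monoid_add"
  shows "(\<Sum>u<N2 * N1. F (u div N1) (u mod N1)) = (\<Sum>j<N2. \<Sum>i<N1. F j i)"
proof -
  have "(\<Sum>u<N2 * N1. F (u div N1) (u mod N1)) = (\<Sum>j<N2. \<Sum>u=j*N1..<j*N1+N1. F (u div N1) (u mod N1))"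
    by (rule sum.nat_group[symmetric])
  also have "\<dots> = (\<Sum>j<N2. \<Sum>i<N1. F j i)"
  proof (rule sum.cong[OF refl])
    fix j
    have "(\<Sum>u=j*N1..<j*N1+N1. F (u div N1) (u mod N1)) = (\<Sum>i=0..<N1. F ((i + j*N1) div N1) ((i + j*N1) mod N1))"
      using sum.shift_bounds_nat_ivl[of "\<lambda>u. F (u div N1) (u mod N1)" 0 "j*N1" N1] by (simp add: add.commute)
    also have "\<dots> = (\<Sum>i<N1. F j i)"
      by (intro sum.cong) auto
    finally show "(\<Sum>u=j*N1..<j*N1+N1. F (u div N1) (u mod N1)) = (\<Sum>i<N1. F j i)" .
  qed
  finally show ?thesis .
qed

lemma region_hull_realize:
  fixes s :: "('a::finite \<times> 'x::finite \<times> 'y::finite \<times> 'z::finite) pmf"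
  assumes pt: "(source_marginal s, r) \<in> region_hull s"
    and N1: "CARD('a) + 3 \<le> N1" and N2: "CARD('a) + 5 \<le> N2"
  obtains L :: "'a \<Rightarrow> nat pmf" where "\<And>a. set_pmf (L a) \<subseteq> {..<N2 * N1}"
    "region_point (kernel_law s fst L) (\<lambda>u. u div N1) = (source_marginal s, r)"
proof -
  let ?C0 = "(\<lambda>t. (fst t, gain s (fst t), snd t)) ` graph_hull s"
  \<comment> \<open>Here the ambient dimension \<open>CARD('a) + 4\<close> is enough, and
    Caratheodory's theorem adds one point.\<close>
  have "aff_dim ?C0 + 1 \<le> int N2"
    using aff_dim_le_DIM[of ?C0] N2 by simp
  with pt[unfolded region_hull_def] obtain c pts where c: "\<And>j. 0 \<le> c j" "sum c {..<N2} = 1"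
    and pts: "\<And>j. pts j \<in> ?C0" and sum_pts: "(\<Sum>j<N2. c j *\<^sub>R pts j) = (source_marginal s, r)"
    by (rule convex_hull_indexed) blast
  have "\<forall>j. \<exists>t. t \<in> graph_hull s \<and> pts j = (fst t, gain s (fst t), snd t)" using pts by blast
  then obtain t where t: "\<And>j. t j \<in> graph_hull s" and ptst: "\<And>j. pts j = (fst (t j), gain s (fst (t j)), snd (t j))"
    by metis
  have "\<forall>j. \<exists>c' \<pi>. (\<forall>i::nat. 0 \<le> c' i) \<and> (\<forall>i. \<pi> i \<in> prob_simplex) \<and> sum c' {..<N1} = 1 \<and>
     (\<Sum>i<N1. c' i *\<^sub>R (\<pi> i, features s (\<pi> i))) = t j"
  proof
    fix j
    have "aff_dim ((\<lambda>\<pi>. (\<pi>, features s \<pi>)) ` prob_simplex) + 1 \<le> int N1"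
      using aff_dim_graph[of s] N1 by linarith
    with t[of j, unfolded graph_hull_def] obtain c' p where c': "\<And>i. 0 \<le> c' i" "sum c' {..<N1} = 1"
      and p: "\<And>i. p i \<in> (\<lambda>\<pi>. (\<pi>, features s \<pi>)) ` prob_simplex" and sp: "(\<Sum>i<N1. c' i *\<^sub>R p i) = t j"
      by (rule convex_hull_indexed) blast
    have "fst (p i) \<in> prob_simplex" "(fst (p i), features s (fst (p i))) = p i" for i using p[of i] by auto
    then show "\<exists>c' \<pi>. (\<forall>i::nat. 0 \<le> c' i) \<and> (\<forall>i. \<pi> i \<in> prob_simplex) \<and> sum c' {..<N1} = 1 \<and>
     (\<Sum>i<N1. c' i *\<^sub>R (\<pi> i, features s (\<pi> i))) = t j"
      using c' sp by (intro exI[of _ c'] exI[of _ "\<lambda>i. fst (p i)"]) simp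
  qed
  then obtain c' \<pi> where "\<forall>j. (\<forall>i::nat. 0 \<le> c' j i) \<and> (\<forall>i. \<pi> j i \<in> prob_simplex) \<and> sum (c' j) {..<N1} = 1 \<and>
     (\<Sum>i<N1. c' j i *\<^sub>R (\<pi> j i, features s (\<pi> j i))) = t j"
    unfolding choice_iff by (elim exE)
  then have c': "\<And>j i. 0 \<le> c' j i" "\<And>j. sum (c' j) {..<N1} = 1"
    and \<pi>: "\<And>j i. \<pi> j i \<in> prob_simplex" and st: "\<And>j. (\<Sum>i<N1. c' j i *\<^sub>R (\<pi> j i, features s (\<pi> j i))) = t j"
    by simp_all
  define N where "N = N2 * N1"
  have Npos: "0 < N" using N1 N2 by (simp add: N_def)
  \<comment> \<open>The symbol \<open>u\<close> codes the pair \<open>(j, i)\<close> with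
    \<open>j = u div N1\<close> the value of \<open>V\<close> and \<open>i = u mod N1\<close> the
    index of the posterior within it, so \<open>V\<close> is recovered from
    \<open>U\<close>.\<close>
  define w where "w u = c (u div N1) * c' (u div N1) (u mod N1)" for u
  define \<rho> where "\<rho> u = \<pi> (u div N1) (u mod N1)" for u
  have w0: "0 \<le> w u" for u using c c' by (simp add: w_def)
  have \<rho>: "\<rho> u \<in> prob_simplex" for u using \<pi> by (simp add: \<rho>_def)
  have \<rho>0: "0 \<le> \<rho> u $ a" for u a using \<rho>[of u] by (simp add: prob_simplex_def)
  have sum_N: "(\<Sum>u<N. w u *\<^sub>R F (\<rho> u)) = (\<Sum>j<N2. c j *\<^sub>R (\<Sum>i<N1. c' j i *\<^sub>R F (\<pi> j i)))" for F :: "real ^ 'a \<Rightarrow> 'w::real_vector"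
    unfolding N_def w_def \<rho>_def sum_div_mod[of "\<lambda>j i. (c j * c' j i) *\<^sub>R F (\<pi> j i)"] by (simp add: scaleR_sum_right)
  have fst_t: "(\<Sum>i<N1. c' j i *\<^sub>R \<pi> j i) = fst (t j)" and snd_t: "(\<Sum>i<N1. c' j i *\<^sub>R features s (\<pi> j i)) = snd (t j)" for j
    using arg_cong[OF st[of j], of fst] arg_cong[OF st[of j], of snd] by (simp_all add: fst_sum snd_sum)
  define Pa where "Pa a = pmf (map_pmf fst s) a" for a
  have src: "(\<Sum>u<N. w u * \<rho> u $ a) = Pa a" for a
  proof -
    have "(\<Sum>u<N. w u *\<^sub>R \<rho> u) = fst (\<Sum>j<N2. c j *\<^sub>R pts j)"
      using sum_N[of "\<lambda>x. x"] by (simp add: fst_t ptst fst_sum)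
    then have "(\<Sum>u<N. w u *\<^sub>R \<rho> u) $ a = source_marginal s $ a" by (simp add: sum_pts)
    then show ?thesis by (simp add: source_marginal_def Pa_def)
  qed
  \<comment> \<open>Bayes' rule turns the posteriors \<open>\<rho> u\<close> into the law of
    \<open>U\<close> given \<open>a\<close>. A letter \<open>a\<close> of probability 0 gets the
    point mass at 0, an arbitrary choice.\<close>
  have "\<exists>p. \<forall>u. pmf p u = (if Pa a = 0 then of_bool (u = 0) else if u < N then w u * \<rho> u $ a / Pa a else 0)" for a
  proof (rule pmf_of_weights[of "{..<N}"])
    show "(\<Sum>u<N. if Pa a = 0 then of_bool (u = 0) else if u < N then w u * \<rho> u $ a / Pa a else 0) = 1"
    proof (cases "Pa a = 0")
      case True
      then show ?thesis using Npos by (simp add: of_bool_def)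
    next
      case False
      then have "(\<Sum>u<N. if Pa a = 0 then of_bool (u = 0) else if u < N then w u * \<rho> u $ a / Pa a else 0) = (\<Sum>u<N. w u * \<rho> u $ a) / Pa a"
        unfolding sum_divide_distrib by (intro sum.cong) auto
      then show ?thesis using False by (simp add: src)
    qed
  next
    show "0 \<le> (if Pa a = 0 then of_bool (u = 0) else if u < N then w u * \<rho> u $ a / Pa a else 0)" for u
      using w0 \<rho>0 by (auto simp: Pa_def)
    show "(if Pa a = 0 then of_bool (u = 0) else if u < N then w u * \<rho> u $ a / Pa a else 0) = 0" if "u \<notin> {..<N}" for u
      using that Npos by auto
  qed simp
  then obtain L where L: "\<And>a u. pmf (L a) u = (if Pa a = 0 then of_bool (u = 0) else if u < N then w u * \<rho> u $ a / Pa a else 0)"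
    by metis
  have Lsub: "set_pmf (L a) \<subseteq> {..<N}" for a
    using N1 N2 by (auto simp: set_pmf_iff L N_def split: if_splits)
  have joint: "Pa a * pmf (L a) u = (if u \<in> {..<N} then w u * \<rho> u $ a else 0)" for a u
  proof (cases "Pa a = 0")
    case True
    have "(\<Sum>u<N. w u * \<rho> u $ a) = 0" using src[of a] True by simp
    then have "\<forall>u\<in>{..<N}. w u * \<rho> u $ a = 0"
      using w0 \<rho>0 by (subst (asm) sum_nonneg_eq_0_iff) auto
    then show ?thesis using True by simp
  next
    case False
    then show ?thesis by (simp add: L)
  qed
  define \<phi> where "\<phi> u = u div N1" for u
  define L' where "L' a = map_pmf \<phi> (L a)" for a
  \<comment> \<open>Merging the symbols of one fibre yields the posterior \<open>fst (t v)\<close>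
    for \<open>V\<close>, the point at which the outer hull evaluates \<open>gain\<close>.\<close>
  have joint': "Pa a * pmf (L' a) v = (if v \<in> {..<N2} then c v * fst (t v) $ a else 0)" for a v
  proof -
    have "pmf (L' a) v = (\<Sum>u\<in>set_pmf (L a). pmf (L a) u * of_bool (\<phi> u = v))"
      unfolding L'_def by (rule pmf_map_sum[OF finite_subset[OF Lsub finite_lessThan]])
    also have "\<dots> = (\<Sum>u<N. pmf (L a) u * of_bool (\<phi> u = v))"
      using Lsub by (intro sum.mono_neutral_left) (auto simp: set_pmf_iff)
    finally have "Pa a * pmf (L' a) v = (\<Sum>u<N. w u * \<rho> u $ a * of_bool (\<phi> u = v))"
      by (simp add: sum_distrib_left mult.assoc[symmetric] joint)
    also have "\<dots> = (\<Sum>j<N2. \<Sum>i<N1. c j * c' j i * \<pi> j i $ a * of_bool (j = v))"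
      unfolding N_def w_def \<rho>_def \<phi>_def by (rule sum_div_mod)
    also have "\<dots> = (\<Sum>j<N2. if j = v then c j * (\<Sum>i<N1. c' j i *\<^sub>R \<pi> j i) $ a else 0)"
      by (intro sum.cong refl) (simp add: sum_distrib_left mult.assoc)
    also have "\<dots> = (if v \<in> {..<N2} then c v * fst (t v) $ a else 0)"
      by (simp add: fst_t)
    finally show ?thesis .
  qed
  define q where "q = kernel_law s fst L"
  have finq: "finite (set_pmf q)"
    unfolding q_def using finite_subset[OF Lsub] by (intro finite_set_kernel_law) auto
  have q': "map_pmf (\<lambda>z. (\<phi> (fst z), snd z)) q = kernel_law s fst L'"
    by (simp add: q_def L'_def[abs_def] map_kernel_law_input)
  have finq': "finite (set_pmf (kernel_law s fst L'))" using finq by (simp add: q'[symmetric])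
  have je: "joint_ent q g (\<lambda>u. u) - ent q fst = (\<Sum>u<N. w u * hcond s fst g (\<rho> u))" for g :: "_ \<Rightarrow> 'g::finite"
    unfolding q_def using finq by (intro joint_ent_kernel_indexed) (auto simp: q_def joint[unfolded Pa_def] \<rho>)
  have t_simplex: "fst (t u) \<in> prob_simplex" for u by (rule fst_graph_hull[OF t])
  have je': "joint_ent q g \<phi> - ent (kernel_law s fst L') fst = (\<Sum>v<N2. c v * hcond s fst g (fst (t v)))" for g :: "_ \<Rightarrow> 'g::finite"
    using joint_ent_kernel_indexed[OF finq', of "{..<N2}" c "\<lambda>v. fst (t v)" g] joint_ent_relabel[OF finq, of \<phi> g "\<lambda>u. u"]
    by (simp add: q' joint'[unfolded Pa_def] t_simplex)
  have c2: "joint_ent q cY \<phi> - joint_ent q cZ \<phi> = (\<Sum>v<N2. c v * gain s (fst (t v)))"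
    using je'[of cY] je'[of cZ] by (simp add: gain_def right_diff_distrib sum_subtractf)
  have c3: "snd (snd (region_point q \<phi>)) = (\<Sum>j<N2. c j *\<^sub>R snd (t j))"
  proof -
    have "(\<Sum>j<N2. c j *\<^sub>R snd (t j)) = (\<Sum>u<N. w u *\<^sub>R features s (\<rho> u))"
      unfolding sum_N snd_t ..
    also have "\<dots> = snd (snd (region_point q \<phi>))"
      using je[of cY] je[of cZ] je[of "\<lambda>w. (fst w, cY w)"] je[of "\<lambda>w. (cX w, cY w)"]
      by (simp add: prod_eq_iff fst_sum snd_sum features_def gain_def region_point_def right_diff_distrib sum_subtractf)
    finally show ?thesis ..
  qed
  have "region_point q \<phi> = (source_marginal s, r)"
  proof -
    have "snd (region_point q \<phi>) = snd (\<Sum>j<N2. c j *\<^sub>R pts j)"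
      using c2 c3 by (simp add: prod_eq_iff snd_sum fst_sum ptst region_point_def)
    moreover have "fst (region_point q \<phi>) = source_marginal s"
      by (simp add: region_point_def q_def map_snd_kernel_law)
    ultimately show ?thesis by (simp add: prod_eq_iff sum_pts)
  qed
  then show thesis using that[of L] Lsub by (simp add: q_def N_def \<phi>_def[abs_def])
qed

section \<open>Single-letterization\<close>

text \<open>Submodularity for variables known only through what determines what. It covers all steps
  of the kind "conditioning reduces entropy" below, with side conditions that amount to comparing
  coordinates.\<close>

lemma ent_submodular_gen:
  assumes fin: "finite (set_pmf p)"
    and "\<And>v w. X v = X w \<Longrightarrow> Y v = Y w \<Longrightarrow> U v = U w"
    and "\<And>v w. X v = X w \<Longrightarrow> V v = V w" "\<And>v w. Y v = Y w \<Longrightarrow> V v = V w"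
  shows "ent p U + ent p V \<le> ent p X + ent p Y"
proof -
  have "ent p U \<le> ent p (\<lambda>w. (X w, Y w, V w))" by (intro ent_mono[OF fin]) (use assms(2) in blast)
  moreover have "ent p (\<lambda>w. (X w, V w)) \<le> ent p X" by (intro ent_mono[OF fin]) (use assms(3) in blast)
  moreover have "ent p (\<lambda>w. (Y w, V w)) \<le> ent p Y" by (intro ent_mono[OF fin]) (use assms(4) in blast)
  ultimately show ?thesis using ent_submodular[OF fin, of X Y V] by linarith
qed

text \<open>The kernel \<open>K\<close> yields the pair of helper data and key, deterministically
  for a generated key and with fresh randomness for a chosen one. The assumption
  \<open>markov\<close> is the chain \<open>Xt - X - (Y, Z)\<close> in the entropic form in which it
  is used.\<close>

locale block_code =
  fixes s :: "('a::finite \<times> 'x::finite \<times> 'y::finite \<times> 'z::finite) pmf"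
    and n :: nat
    and K :: "'a list \<Rightarrow> ('j \<times> 'k) pmf"
  assumes finK: "\<And>xs. finite (set_pmf (K xs))"
    and markov: "ent s (\<lambda>w. w) + ent s cX = ent s (\<lambda>w. (fst w, cX w)) + ent s (\<lambda>w. (cX w, cY w, cZ w))"
begin

definition B :: "(nat \<Rightarrow> 'a \<times> 'x \<times> 'y \<times> 'z) pmf" where "B = Pi_pmf {..<n} undefined (\<lambda>_. s)"

definition P :: "(('j \<times> 'k) \<times> (nat \<Rightarrow> 'a \<times> 'x \<times> 'y \<times> 'z)) pmf" where
  "P = kernel_law B (\<lambda>f. map (\<lambda>j. fst (f j)) [0..<n]) K"

definition sq :: "('a \<times> 'x \<times> 'y \<times> 'z \<Rightarrow> 'b) \<Rightarrow> nat set \<Rightarrow> ('j \<times> 'k) \<times> (nat \<Rightarrow> 'a \<times> 'x \<times> 'y \<times> 'z) \<Rightarrow> nat \<Rightarrow> 'b" where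
  "sq g I z = restrict (\<lambda>j. g (snd z j)) I"

lemma sq_eq_iff: "sq g I v = sq g I w \<longleftrightarrow> (\<forall>j\<in>I. g (snd v j) = g (snd w j))"
  by (simp add: sq_def restrict_eq_iff)

lemma finB: "finite (set_pmf B)"
  unfolding B_def by (subst set_Pi_pmf) auto

lemma finP: "finite (set_pmf P)"
  unfolding P_def by (intro finite_set_kernel_law finB finK)

abbreviation H :: "(('j \<times> 'k) \<times> (nat \<Rightarrow> 'a \<times> 'x \<times> 'y \<times> 'z) \<Rightarrow> 'b) \<Rightarrow> real" where "H \<equiv> ent P"

lemma map_snd_P: "map_pmf snd P = B"
  by (simp add: P_def map_snd_kernel_law)

section \<open>Entropies of coordinate blocks and Markov chains of words\<close>

lemma H_letters:
  "H (\<lambda>z. restrict (\<lambda>j. g j (snd z j)) {..<n}) = (\<Sum>j<n. ent s (g j))"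
proof -
  have "H (\<lambda>z. restrict (\<lambda>j. g j (snd z j)) {..<n}) = ent B (\<lambda>f. restrict (\<lambda>j. g j (f j)) {..<n})"
    unfolding map_snd_P[symmetric] by (simp add: ent_map[OF finP])
  also have "\<dots> = (\<Sum>j<n. ent s (g j))" unfolding B_def by (rule ent_Pi) auto
  finally show ?thesis .
qed

lemma H_sq: "H (sq g {..<n}) = n * ent s g"
  using H_letters[of "\<lambda>_. g"] by (simp add: sq_def[abs_def])

lemma H_sq2: "H (\<lambda>z. (sq g {..<n} z, sq h {..<n} z)) = n * ent s (\<lambda>w. (g w, h w))"
proof -
  have "H (\<lambda>z. (sq g {..<n} z, sq h {..<n} z)) = H (sq (\<lambda>w. (g w, h w)) {..<n})"
    by (rule ent_cong[OF finP]) (auto simp: sq_eq_iff)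
  then show ?thesis by (simp add: H_sq)
qed

lemma H_sq3: "H (\<lambda>z. (sq g {..<n} z, sq h {..<n} z, sq k {..<n} z)) = n * ent s (\<lambda>w. (g w, h w, k w))"
proof -
  have "H (\<lambda>z. (sq g {..<n} z, sq h {..<n} z, sq k {..<n} z)) = H (sq (\<lambda>w. (g w, h w, k w)) {..<n})"
    by (rule ent_cong[OF finP]) (auto simp: sq_eq_iff)
  then show ?thesis by (simp add: H_sq)
qed

text \<open>The letters are independent: given the suffixes of \<open>g\<close> and
  \<open>h\<close>, their prefixes say nothing about the suffix of \<open>k\<close>.\<close>

lemma H_suffix:
  fixes g :: "_ \<Rightarrow> 'b" and h :: "_ \<Rightarrow> 'c" and k :: "_ \<Rightarrow> 'd"
  shows "H (\<lambda>z. (sq g {..<n} z, sq h {..<n} z, sq k {i..<n} z)) - H (\<lambda>z. (sq g {..<n} z, sq h {..<n} z))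
    = H (\<lambda>z. (sq g {i..<n} z, sq h {i..<n} z, sq k {i..<n} z)) - H (\<lambda>z. (sq g {i..<n} z, sq h {i..<n} z))"
proof -
  \<comment> \<open>\<open>None\<close> hides a coordinate before \<open>i\<close>, so a suffix
    becomes a full block with letter maps that vary with the coordinate.\<close>
  let ?e = "\<lambda>G. \<lambda>j w. if i \<le> j then Some (G w) else None"
  have 1: "H (\<lambda>z. (sq g {..<n} z, sq h {..<n} z, sq k {i..<n} z)) = (\<Sum>j<n. ent s (\<lambda>w. (g w, h w, ?e k j w)))"
    unfolding H_letters[symmetric] by (rule ent_cong[OF finP]) (auto simp: sq_eq_iff restrict_eq_iff)
  have 2: "H (\<lambda>z. (sq g {..<n} z, sq h {..<n} z)) = (\<Sum>j<n. ent s (\<lambda>w. (g w, h w)))"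
    unfolding H_letters[symmetric] by (rule ent_cong[OF finP]) (auto simp: sq_eq_iff restrict_eq_iff)
  have 3: "H (\<lambda>z. (sq g {i..<n} z, sq h {i..<n} z, sq k {i..<n} z)) = (\<Sum>j<n. ent s (?e (\<lambda>w. (g w, h w, k w)) j))"
    unfolding H_letters[symmetric] by (rule ent_cong[OF finP]) (auto simp: sq_eq_iff restrict_eq_iff)
  have 4: "H (\<lambda>z. (sq g {i..<n} z, sq h {i..<n} z)) = (\<Sum>j<n. ent s (?e (\<lambda>w. (g w, h w)) j))"
    unfolding H_letters[symmetric] by (rule ent_cong[OF finP]) (auto simp: sq_eq_iff restrict_eq_iff)
  show ?thesis unfolding 1 2 3 4 sum_subtractf[symmetric]
  proof (intro sum.cong refl)
    fix j
    have fs: "finite (set_pmf s)" by simp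
    show "ent s (\<lambda>w. (g w, h w, ?e k j w)) - ent s (\<lambda>w. (g w, h w)) = ent s (?e (\<lambda>w. (g w, h w, k w)) j) - ent s (?e (\<lambda>w. (g w, h w)) j)"
    proof (cases "i \<le> j")
      case True
      then show ?thesis
        by (simp add: ent_cong[OF fs, of "\<lambda>w. (g w, h w, Some (k w))" "\<lambda>w. Some (g w, h w, k w)"] ent_cong[OF fs, of "\<lambda>w. (g w, h w)" "\<lambda>w. Some (g w, h w)"])
    next
      case False
      then show ?thesis
        by (simp add: ent_cong[OF fs, of "\<lambda>w. (g w, h w, None)" "\<lambda>w. (g w, h w)"])
    qed
  qed
qed

lemma snd_eq_iff:
  assumes "v \<in> set_pmf P" "w \<in> set_pmf P"
  shows "snd v = snd w \<longleftrightarrow> (\<forall>j\<in>{..<n}. snd v j = snd w j)"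
proof -
  have "snd u j = undefined" if "u \<in> set_pmf P" "\<not> j < n" for u j
  proof -
    have "snd u \<in> set_pmf B" using that(1) unfolding map_snd_P[symmetric] by auto
    then show ?thesis
      using that(2) subsetD[OF set_Pi_pmf_subset[of "{..<n}" undefined "\<lambda>_. s"]] by (simp add: B_def)
  qed
  with assms show ?thesis unfolding fun_eq_iff lessThan_iff Ball_def by metis
qed

text \<open>The chain from the pair \<open>fst z\<close> through the word \<open>Xt\<close> to the
  whole source block, transferred from the kernel identity to blocks.\<close>

lemma H_message:
  "H (\<lambda>z. (fst z, sq (\<lambda>w. w) {..<n} z)) + H (sq fst {..<n}) = H (\<lambda>z. (fst z, sq fst {..<n} z)) + H (sq (\<lambda>w. w) {..<n})"
proof -
  have "H (\<lambda>z. map (\<lambda>j. fst (snd z j)) [0..<n]) = H (sq fst {..<n})"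
    by (rule ent_cong[OF finP]) (auto simp: sq_eq_iff)
  moreover have "H (\<lambda>z. (fst z, map (\<lambda>j. fst (snd z j)) [0..<n])) = H (\<lambda>z. (fst z, sq fst {..<n} z))"
    by (rule ent_cong[OF finP]) (auto simp: sq_eq_iff)
  moreover have "H snd = H (sq (\<lambda>w. w) {..<n})"
    by (rule ent_cong[OF finP]) (simp only: snd_eq_iff sq_eq_iff)
  moreover have "H (\<lambda>z. z) = H (\<lambda>z. (fst z, sq (\<lambda>w. w) {..<n} z))"
    by (rule ent_cong[OF finP]) (simp only: prod_eq_iff snd_eq_iff sq_eq_iff fst_conv snd_conv)
  ultimately show ?thesis
    using ent_kernel_law[OF finP[unfolded P_def]] unfolding P_def[symmetric] by simp
qed

lemma split_letter:
  fixes w :: "'a \<times> 'x \<times> 'y \<times> 'z"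
  shows "w = v \<longleftrightarrow> fst w = fst v \<and> cX w = cX v \<and> cY w = cY v \<and> cZ w = cZ v"
  by (auto simp: prod_eq_iff cX_def cY_def cZ_def)

text \<open>Given the word \<open>Xt\<close>, the words \<open>Y\<close> and \<open>Z\<close> do not
  reduce the uncertainty of the pair \<open>fst z\<close>. The reverse inequality is submodularity,
  so this is conditional independence.\<close>

lemma markov_fst:
  "H (\<lambda>z. (fst z, sq fst {..<n} z)) + H (\<lambda>z. (sq fst {..<n} z, sq cY {..<n} z, sq cZ {..<n} z))
   \<le> H (\<lambda>z. (fst z, sq fst {..<n} z, sq cY {..<n} z, sq cZ {..<n} z)) + H (sq fst {..<n})"
proof -
  have "H (\<lambda>z. (fst z, sq (\<lambda>w. w) {..<n} z)) + H (\<lambda>z. (sq fst {..<n} z, sq cY {..<n} z, sq cZ {..<n} z))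
    \<le> H (\<lambda>z. (fst z, sq fst {..<n} z, sq cY {..<n} z, sq cZ {..<n} z)) + H (sq (\<lambda>w. w) {..<n})"
    by (rule ent_submodular_gen[OF finP]) (auto simp: sq_eq_iff)
  then show ?thesis using H_message by linarith
qed

text \<open>The analogue for the source word \<open>X\<close>: the pair depends on the block through
  \<open>Xt\<close> only, and \<open>Xt - X - (Y, Z)\<close> holds letter by letter.\<close>

lemma markov_cX:
  "H (\<lambda>z. (fst z, sq cX {..<n} z)) + H (\<lambda>z. (sq cX {..<n} z, sq cY {..<n} z, sq cZ {..<n} z))
   \<le> H (\<lambda>z. (fst z, sq cX {..<n} z, sq cY {..<n} z, sq cZ {..<n} z)) + H (sq cX {..<n})"
proof -
  let ?all = "\<lambda>z. (fst z, sq (\<lambda>w. w) {..<n} z)"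
  let ?MXX = "\<lambda>z. (fst z, sq fst {..<n} z, sq cX {..<n} z)"
  have 1: "H ?all + H (\<lambda>z. (fst z, sq cX {..<n} z)) \<le> H ?MXX + H (\<lambda>z. (fst z, sq cX {..<n} z, sq cY {..<n} z, sq cZ {..<n} z))"
    by (rule ent_submodular_gen[OF finP]) (auto simp: sq_eq_iff split_letter)
  have 2: "H ?MXX + H (sq fst {..<n}) \<le> H (\<lambda>z. (fst z, sq fst {..<n} z)) + H (\<lambda>z. (sq fst {..<n} z, sq cX {..<n} z))"
    by (rule ent_submodular_gen[OF finP]) (auto simp: sq_eq_iff)
  have "real n * (ent s (\<lambda>w. w) + ent s cX) = real n * (ent s (\<lambda>w. (fst w, cX w)) + ent s (\<lambda>w. (cX w, cY w, cZ w)))"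
    by (simp add: markov)
  then have 3: "H (sq (\<lambda>w. w) {..<n}) + H (sq cX {..<n}) = H (\<lambda>z. (sq fst {..<n} z, sq cX {..<n} z)) + H (\<lambda>z. (sq cX {..<n} z, sq cY {..<n} z, sq cZ {..<n} z))"
    by (simp add: H_sq H_sq2 H_sq3 distrib_left)
  show ?thesis using 1 2 3 H_message by linarith
qed

text \<open>Once the word of \<open>g\<close> and \<open>Y\<close> are known, the message carries no
  information about any suffix of \<open>Z\<close>. This follows by weakening the Markov chain
  \<open>mk\<close>.\<close>

lemma suffix_cond:
  fixes g :: "_ \<Rightarrow> 'b"
  assumes mk: "H (\<lambda>z. (fst z, sq g {..<n} z)) + H (\<lambda>z. (sq g {..<n} z, sq cY {..<n} z, sq cZ {..<n} z))
   \<le> H (\<lambda>z. (fst z, sq g {..<n} z, sq cY {..<n} z, sq cZ {..<n} z)) + H (sq g {..<n})"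
  shows "H (\<lambda>z. (sq g {..<n} z, sq cY {..<n} z, sq cZ {i..<n} z)) - H (\<lambda>z. (sq g {..<n} z, sq cY {..<n} z))
    \<le> H (\<lambda>z. (fst z, sq g {..<n} z, sq cY {..<n} z, sq cZ {i..<n} z)) - H (\<lambda>z. (fst z, sq g {..<n} z, sq cY {..<n} z))"
proof -
  have 1: "H (\<lambda>z. (fst z, sq g {..<n} z, sq cY {..<n} z, sq cZ {..<n} z)) + H (\<lambda>z. (sq g {..<n} z, sq cY {..<n} z, sq cZ {i..<n} z))
    \<le> H (\<lambda>z. (fst z, sq g {..<n} z, sq cY {..<n} z, sq cZ {i..<n} z)) + H (\<lambda>z. (sq g {..<n} z, sq cY {..<n} z, sq cZ {..<n} z))"
    by (rule ent_submodular_gen[OF finP]) (auto simp: sq_eq_iff)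
  have 2: "H (\<lambda>z. (fst z, sq g {..<n} z, sq cY {..<n} z)) + H (sq g {..<n})
    \<le> H (\<lambda>z. (fst z, sq g {..<n} z)) + H (\<lambda>z. (sq g {..<n} z, sq cY {..<n} z))"
    by (rule ent_submodular_gen[OF finP]) (auto simp: sq_eq_iff)
  show ?thesis using 1 2 mk by linarith
qed

section \<open>The auxiliary variables of a code and its single-letter bounds\<close>

definition aux_U :: "nat \<Rightarrow> ('j \<times> 'k) \<times> (nat \<Rightarrow> 'a \<times> 'x \<times> 'y \<times> 'z) \<Rightarrow> ('j \<times> 'k) \<times> (nat \<Rightarrow> 'y) \<times> (nat \<Rightarrow> 'z)" where
  "aux_U i z = (fst z, sq cY {..<i} z, sq cZ {Suc i..<n} z)"

text \<open>The future of \<open>Z\<close> in \<open>aux_U\<close> is the obstacle, since enlarging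
  the condition on the right could lower the entropy. But given the futures of \<open>g\<close> and
  \<open>Y\<close>, the future of \<open>Z\<close> is independent of the message and of letter
  \<open>i\<close>, so it can first be added at no cost. Afterwards the future of \<open>g\<close>
  and the remaining part of \<open>Y\<close> are dropped.\<close>

lemma letter_equivocation:
  fixes g :: "_ \<Rightarrow> 'b"
  assumes mk: "H (\<lambda>z. (fst z, sq g {..<n} z)) + H (\<lambda>z. (sq g {..<n} z, sq cY {..<n} z, sq cZ {..<n} z))
   \<le> H (\<lambda>z. (fst z, sq g {..<n} z, sq cY {..<n} z, sq cZ {..<n} z)) + H (sq g {..<n})"
    and i: "i < n"
  shows "H (\<lambda>z. (fst z, sq g {i..<n} z, sq cY {..<n} z)) - H (\<lambda>z. (fst z, sq g {Suc i..<n} z, sq cY {..<n} z))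
    \<le> H (\<lambda>z. ((g (snd z i), cY (snd z i)), aux_U i z)) - H (\<lambda>z. (cY (snd z i), aux_U i z))"
proof -
  let ?Z = "\<lambda>z. sq cZ {Suc i..<n} z" and ?Y = "\<lambda>z. sq cY {..<n} z"
  have 1: "H (\<lambda>z. (fst z, sq g {..<n} z, ?Y z, ?Z z)) + H (\<lambda>z. (fst z, sq g {i..<n} z, ?Y z))
     \<le> H (\<lambda>z. (fst z, sq g {i..<n} z, ?Y z, ?Z z)) + H (\<lambda>z. (fst z, sq g {..<n} z, ?Y z))"
    by (rule ent_submodular_gen[OF finP]) (auto simp: sq_eq_iff)
  have 2: "H (\<lambda>z. (fst z, sq g {Suc i..<n} z, ?Y z, ?Z z)) + H (\<lambda>z. (sq g {Suc i..<n} z, sq cY {Suc i..<n} z))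
     \<le> H (\<lambda>z. (sq g {Suc i..<n} z, sq cY {Suc i..<n} z, ?Z z)) + H (\<lambda>z. (fst z, sq g {Suc i..<n} z, ?Y z))"
    by (rule ent_submodular_gen[OF finP]) (auto simp: sq_eq_iff)
  have 3: "H (\<lambda>z. (fst z, sq g {i..<n} z, ?Y z, ?Z z)) + H (\<lambda>z. (cY (snd z i), aux_U i z))
     \<le> H (\<lambda>z. (fst z, sq g {Suc i..<n} z, ?Y z, ?Z z)) + H (\<lambda>z. ((g (snd z i), cY (snd z i)), aux_U i z))"
  proof (rule ent_submodular_gen[OF finP], goal_cases)
    case (1 v w)
    have "g (snd v j) = g (snd w j)" if "j \<in> {i..<n}" for j
      using 1 that by (cases "j = i") (auto simp: sq_eq_iff)
    then show ?case using 1 by (auto simp: sq_eq_iff)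
  qed (use i in \<open>auto simp: sq_eq_iff aux_U_def\<close>)
  \<comment> \<open>Together with \<open>1\<close> and \<open>2\<close>, the suffix facts give
    equality in "conditioning on the future of \<open>Z\<close> does not help"; \<open>3\<close> is
    the final removal of conditions.\<close>
  show ?thesis using 1 2 3 suffix_cond[OF mk, of "Suc i"] H_suffix[of g cY cZ "Suc i"] by linarith
qed

text \<open>The chain rule reveals the letters of \<open>g\<close> from the last to the first,
  because each letter must be conditioned on the future of \<open>g\<close> for
  \<open>letter_equivocation\<close> to apply.\<close>

lemma sum_equivocation:
  fixes g :: "_ \<Rightarrow> 'b"
  assumes mk: "H (\<lambda>z. (fst z, sq g {..<n} z)) + H (\<lambda>z. (sq g {..<n} z, sq cY {..<n} z, sq cZ {..<n} z))
   \<le> H (\<lambda>z. (fst z, sq g {..<n} z, sq cY {..<n} z, sq cZ {..<n} z)) + H (sq g {..<n})"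
  shows "H (\<lambda>z. (fst z, sq g {..<n} z, sq cY {..<n} z)) - H (\<lambda>z. (fst z, sq cY {..<n} z))
    \<le> (\<Sum>i<n. H (\<lambda>z. ((g (snd z i), cY (snd z i)), aux_U i z)) - H (\<lambda>z. (cY (snd z i), aux_U i z)))"
proof -
  define D where "D i = H (\<lambda>z. (fst z, sq g {i..<n} z, sq cY {..<n} z))" for i
  have "D n = H (\<lambda>z. (fst z, sq cY {..<n} z))"
    unfolding D_def by (rule ent_cong[OF finP]) (auto simp: sq_eq_iff)
  then have "H (\<lambda>z. (fst z, sq g {..<n} z, sq cY {..<n} z)) - H (\<lambda>z. (fst z, sq cY {..<n} z)) = D 0 - D n"
    by (simp add: D_def atLeast0LessThan)
  also have "\<dots> = (\<Sum>i<n. D i - D (Suc i))" by (simp add: sum_lessThan_telescope')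
  also have "\<dots> \<le> (\<Sum>i<n. H (\<lambda>z. ((g (snd z i), cY (snd z i)), aux_U i z)) - H (\<lambda>z. (cY (snd z i), aux_U i z)))"
    unfolding D_def by (intro sum_mono letter_equivocation mk) auto
  finally show ?thesis .
qed

text \<open>Csiszar's sum identity, as a telescoping sum over the hybrids \<open>(Y\<^sub>1, \<dots>, Y\<^sub>i, Z\<^sub>i\<^sub>+\<^sub>1, \<dots>, Z\<^sub>n)\<close>.\<close>

lemma csiszar_sum:
  "(\<Sum>i<n. H (\<lambda>z. (cY (snd z i), \<tau> (fst z), sq cY {..<i} z, sq cZ {Suc i..<n} z))
        - H (\<lambda>z. (cZ (snd z i), \<tau> (fst z), sq cY {..<i} z, sq cZ {Suc i..<n} z)))
   = H (\<lambda>z. (\<tau> (fst z), sq cY {..<n} z)) - H (\<lambda>z. (\<tau> (fst z), sq cZ {..<n} z))"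
proof -
  define E where "E i = H (\<lambda>z. (\<tau> (fst z), sq cY {..<i} z, sq cZ {i..<n} z))" for i
  have "(\<Sum>i<n. H (\<lambda>z. (cY (snd z i), \<tau> (fst z), sq cY {..<i} z, sq cZ {Suc i..<n} z))
        - H (\<lambda>z. (cZ (snd z i), \<tau> (fst z), sq cY {..<i} z, sq cZ {Suc i..<n} z))) = (\<Sum>i<n. E (Suc i) - E i)"
  proof (intro sum.cong refl arg_cong2[where f = minus])
    fix i assume i: "i \<in> {..<n}"
    show "H (\<lambda>z. (cY (snd z i), \<tau> (fst z), sq cY {..<i} z, sq cZ {Suc i..<n} z)) = E (Suc i)"
      unfolding E_def by (rule ent_cong[OF finP]) (auto simp: sq_eq_iff lessThan_Suc)
    have "{i..<n} = insert i {Suc i..<n}" using i by auto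
    then show "H (\<lambda>z. (cZ (snd z i), \<tau> (fst z), sq cY {..<i} z, sq cZ {Suc i..<n} z)) = E i"
      unfolding E_def by (intro ent_cong[OF finP]) (auto simp: sq_eq_iff)
  qed
  also have "\<dots> = E n - E 0" by (rule sum_lessThan_telescope)
  also have "E n = H (\<lambda>z. (\<tau> (fst z), sq cY {..<n} z))"
    unfolding E_def by (rule ent_cong[OF finP]) (auto simp: sq_eq_iff)
  also have "E 0 = H (\<lambda>z. (\<tau> (fst z), sq cZ {..<n} z))"
    unfolding E_def by (rule ent_cong[OF finP]) (auto simp: sq_eq_iff)
  finally show ?thesis .
qed

definition letter_law :: "nat \<Rightarrow> ((('j \<times> 'k) \<times> (nat \<Rightarrow> 'y) \<times> (nat \<Rightarrow> 'z)) \<times> ('a \<times> 'x \<times> 'y \<times> 'z)) pmf" where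
  "letter_law i = map_pmf (\<lambda>z. (aux_U i z, snd z i)) P"

text \<open>The variable \<open>aux_U i\<close> contains no \<open>Y\<close> or \<open>Z\<close> of
  letter \<open>i\<close>, and the message sees that letter through \<open>Xt\<close> only. Hence
  the other letters can be drawn independently and the code run on the completed word, which makes
  \<open>U\<close> a randomized function of \<open>Xt\<close> at letter \<open>i\<close>.\<close>

lemma letter_law_kernel:
  assumes i: "i < n"
  shows "\<exists>L. letter_law i = kernel_law s fst L"
proof -
  define I where "I = {..<n} - {i}"
  define B' where "B' = Pi_pmf I undefined (\<lambda>_. s)"
  define L where "L b = bind_pmf B' (\<lambda>f. map_pmf (\<lambda>m. (m, restrict (\<lambda>j. cY (f j)) {..<i}, restrict (\<lambda>j. cZ (f j)) {Suc i..<n}))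
      (K (map (\<lambda>j. if j = i then b else fst (f j)) [0..<n])))" for b
  have I: "{..<n} = insert i I" "i \<notin> I" "finite I" using i by (auto simp: I_def)
  have B: "B = bind_pmf s (\<lambda>a. map_pmf (\<lambda>f. f(i := a)) B')"
    unfolding B_def I(1) B'_def using I(2,3)
    by (subst Pi_pmf_insert') (auto simp: map_pmf_def)
  have "letter_law i = kernel_law s fst L"
    unfolding letter_law_def P_def kernel_law_altdef B L_def
    by (auto simp: map_bind_pmf pmf.map_comp o_def bind_assoc_pmf bind_map_pmf aux_U_def sq_def restrict_eq_iff if_distrib[of fst]
             intro!: bind_pmf_cong map_pmf_cong)
  then show ?thesis by blast
qed

lemma region_point_letter:
  "region_point (letter_law i) (\<lambda>u. (fst (fst u), snd u)) = 
    (source_marginal (map_pmf snd (letter_law i)),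
     H (\<lambda>z. (cY (snd z i), fst (fst z), sq cY {..<i} z, sq cZ {Suc i..<n} z)) - H (\<lambda>z. (cZ (snd z i), fst (fst z), sq cY {..<i} z, sq cZ {Suc i..<n} z)),
     H (\<lambda>z. (cY (snd z i), fst z, sq cY {..<i} z, sq cZ {Suc i..<n} z)) - H (\<lambda>z. (cZ (snd z i), fst z, sq cY {..<i} z, sq cZ {Suc i..<n} z)),
     H (\<lambda>z. ((fst (snd z i), cY (snd z i)), aux_U i z)) - H (\<lambda>z. (cY (snd z i), aux_U i z)),
     H (\<lambda>z. ((cX (snd z i), cY (snd z i)), aux_U i z)) - H (\<lambda>z. (cY (snd z i), aux_U i z)))"
  unfolding region_point_def joint_ent_def letter_law_def ent_map[OF finP] aux_U_def by simp

text \<open>With \<open>J\<close> the helper data, \<open>S\<close> the key and words of length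
  \<open>n\<close>, the bounded quantities are in turn: the equivocation \<open>H(S|J,Z)\<close> of
  the eavesdropper; the key entropy, as an upper bound on the secrecy gain; the storage rate,
  increased by \<open>H(J,S|Xt,Y)\<close>; and the leakage \<open>I(X;J|Z)\<close>. The error
  \<open>\<Phi>\<close> stands for \<open>H(S|J,Y)\<close>.\<close>

lemma converse_block:
  fixes \<Phi> :: real
  assumes n: "0 < n"
    and fano: "H (\<lambda>z. (fst z, sq cY {..<n} z)) - H (\<lambda>z. (fst (fst z), sq cY {..<n} z)) \<le> \<Phi>"
  obtains a b c d :: real where "(source_marginal s, a, b, c, d) \<in> region_hull s"
    "H (\<lambda>z. (fst z, sq cZ {..<n} z)) - H (\<lambda>z. (fst (fst z), sq cZ {..<n} z)) \<le> n * (a - b) + \<Phi>"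
    "n * (a - b) \<le> H (\<lambda>z. snd (fst z))"
    "n * (ent s (\<lambda>w. (fst w, cY w)) - ent s cY - c)
       + (H (\<lambda>z. (fst z, sq fst {..<n} z, sq cY {..<n} z)) - H (\<lambda>z. (sq fst {..<n} z, sq cY {..<n} z)))
     \<le> H (\<lambda>z. fst (fst z)) + \<Phi>"
    "n * (ent s (\<lambda>w. (cX w, cY w)) - ent s cY - d + ent s cY - ent s cZ - a)
     \<le> H (\<lambda>z. (sq cX {..<n} z, sq cZ {..<n} z)) + H (\<lambda>z. (fst (fst z), sq cZ {..<n} z)) - H (sq cZ {..<n})
       - H (\<lambda>z. (sq cX {..<n} z, fst (fst z), sq cZ {..<n} z)) + \<Phi>"
proof -
  let ?\<phi> = "\<lambda>u :: ('j \<times> 'k) \<times> (nat \<Rightarrow> 'y) \<times> (nat \<Rightarrow> 'z). (fst (fst u), snd u)"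
  let ?rp = "\<lambda>i. region_point (letter_law i) ?\<phi>"
  let ?X = "sq fst {..<n}" and ?G = "sq cX {..<n}" and ?Y = "sq cY {..<n}" and ?Z = "sq cZ {..<n}"
  have rp_hull: "?rp i \<in> region_hull s" and rp_fst: "fst (?rp i) = source_marginal s" if i: "i < n" for i
  proof -
    obtain L where L: "letter_law i = kernel_law s fst L" using letter_law_kernel[OF i] by blast
    have "finite (set_pmf (letter_law i))" using finP by (simp add: letter_law_def)
    then show "?rp i \<in> region_hull s" unfolding L by (rule region_point_in_hull)
    show "fst (?rp i) = source_marginal s" by (simp add: region_point_def L map_snd_kernel_law)
  qed
  \<comment> \<open>The uniform average over the letters is the point of a time-shared auxiliary
    pair; convexity keeps it in the hull, and all its terms have the same law of
    \<open>Xt\<close>.\<close>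
  define A where "A = (\<Sum>i<n. (1 / real n) *\<^sub>R ?rp i)"
  have A_in: "A \<in> region_hull s"
    unfolding A_def using n by (intro convex_sum) (auto simp: convex_region_hull rp_hull)
  have "fst A = (\<Sum>i<n. (1 / real n) *\<^sub>R source_marginal s)"
    unfolding A_def fst_sum by (intro sum.cong) (auto simp: rp_fst)
  also have "\<dots> = source_marginal s" by (simp only: sum_constant_scaleR card_lessThan) (use n in simp)
  finally have fstA: "fst A = source_marginal s" .
  obtain a b c d where A: "A = (source_marginal s, a, b, c, d)" using fstA by (cases A) auto
  have nA: "real n *\<^sub>R snd A = (\<Sum>i<n. snd (?rp i))"
    using n by (simp add: A_def snd_sum scaleR_sum_right)
  \<comment> \<open>\<open>V\<close> drops the key from \<open>aux_U\<close>. The difference of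
    \<open>na\<close> and \<open>nb\<close> is therefore
    \<open>n * (a - b) = H(S|J,Z) - H(S|J,Y)\<close>.\<close>
  have na: "n * a = H (\<lambda>z. (fst (fst z), ?Y z)) - H (\<lambda>z. (fst (fst z), ?Z z))"
    using arg_cong[OF nA, of fst] csiszar_sum[of fst]
    by (simp add: A fst_sum region_point_letter)
  have nb: "n * b = H (\<lambda>z. (fst z, ?Y z)) - H (\<lambda>z. (fst z, ?Z z))"
    using arg_cong[OF nA, of "\<lambda>v. fst (snd v)"] csiszar_sum[of "\<lambda>m. m"]
    by (simp add: A fst_sum snd_sum region_point_letter)
  have nc: "H (\<lambda>z. (fst z, ?X z, ?Y z)) - H (\<lambda>z. (fst z, ?Y z)) \<le> n * c"
    using arg_cong[OF nA, of "\<lambda>v. fst (snd (snd v))"] sum_equivocation[OF markov_fst]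
    by (simp add: A fst_sum snd_sum region_point_letter)
  have nd: "H (\<lambda>z. (fst z, ?G z, ?Y z)) - H (\<lambda>z. (fst z, ?Y z)) \<le> n * d"
    using arg_cong[OF nA, of "\<lambda>v. snd (snd (snd v))"] sum_equivocation[OF markov_cX]
    by (simp add: A fst_sum snd_sum region_point_letter)
  have JY_M: "H (\<lambda>z. (fst (fst z), ?Y z)) \<le> H (\<lambda>z. (fst z, ?Y z))"
    by (rule ent_mono[OF finP]) auto
  have MZ: "H (\<lambda>z. (fst z, ?Z z)) \<le> H (\<lambda>z. (fst (fst z), ?Z z)) + H (\<lambda>z. snd (fst z))"
    using ent_submodular_gen[OF finP, of "\<lambda>z. (fst (fst z), ?Z z)" "\<lambda>z. snd (fst z)" "\<lambda>z. (fst z, ?Z z)" "\<lambda>_. ()"] finP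
    by (auto simp: prod_eq_iff)
  have JY: "H (\<lambda>z. (fst (fst z), ?Y z)) \<le> H (\<lambda>z. fst (fst z)) + H ?Y"
    using ent_submodular_gen[OF finP, of "\<lambda>z. fst (fst z)" ?Y "\<lambda>z. (fst (fst z), ?Y z)" "\<lambda>_. ()"] finP by auto
  \<comment> \<open>The facts \<open>G1\<close> to \<open>G4\<close> and \<open>markov_cX\<close>
    link the chain \<open>H(J|X,Z) \<le> H(J|X) \<le> H(J|X,Y,Z) \<le> H(J|X,Y) \<le>
    H(J,S|X,Y)\<close>, which lets the leakage at the eavesdropper be compared with the information
    given \<open>Y\<close>.\<close>
  have G1: "H (\<lambda>z. (?G z, fst (fst z), ?Z z)) + H ?G \<le> H (\<lambda>z. (?G z, fst (fst z))) + H (\<lambda>z. (?G z, ?Z z))"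
    by (rule ent_submodular_gen[OF finP]) auto
  have G2: "H (\<lambda>z. (fst z, ?G z, ?Y z, ?Z z)) + H (\<lambda>z. (?G z, fst (fst z))) \<le> H (\<lambda>z. (?G z, fst (fst z), ?Y z, ?Z z)) + H (\<lambda>z. (fst z, ?G z))"
    by (rule ent_submodular_gen[OF finP]) auto
  have G3: "H (\<lambda>z. (?G z, fst (fst z), ?Y z, ?Z z)) + H (\<lambda>z. (?G z, ?Y z)) \<le> H (\<lambda>z. (?G z, fst (fst z), ?Y z)) + H (\<lambda>z. (?G z, ?Y z, ?Z z))"
    by (rule ent_submodular_gen[OF finP]) auto
  have G4: "H (\<lambda>z. (?G z, fst (fst z), ?Y z)) \<le> H (\<lambda>z. (fst z, ?G z, ?Y z))"
    by (rule ent_mono[OF finP]) auto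
  show thesis
  proof (rule that[of a b c d])
    show "(source_marginal s, a, b, c, d) \<in> region_hull s" using A_in by (simp add: A)
    show "H (\<lambda>z. (fst z, ?Z z)) - H (\<lambda>z. (fst (fst z), ?Z z)) \<le> n * (a - b) + \<Phi>"
      using na nb fano by (simp add: right_diff_distrib)
    show "n * (a - b) \<le> H (\<lambda>z. snd (fst z))"
      using na nb JY_M MZ by (simp add: right_diff_distrib)
    show "n * (ent s (\<lambda>w. (fst w, cY w)) - ent s cY - c) + (H (\<lambda>z. (fst z, ?X z, ?Y z)) - H (\<lambda>z. (?X z, ?Y z)))
     \<le> H (\<lambda>z. fst (fst z)) + \<Phi>"
      using nc fano JY H_sq[of cY] H_sq2[of fst cY] by (simp add: right_diff_distrib)
    show "n * (ent s (\<lambda>w. (cX w, cY w)) - ent s cY - d + ent s cY - ent s cZ - a)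
     \<le> H (\<lambda>z. (?G z, ?Z z)) + H (\<lambda>z. (fst (fst z), ?Z z)) - H ?Z - H (\<lambda>z. (?G z, fst (fst z), ?Z z)) + \<Phi>"
      using nd na fano G1 G2 G3 G4 markov_cX H_sq[of cZ] H_sq2[of cX cY] by (simp add: right_diff_distrib)
  qed
qed

end

section \<open>From block codes to the outer bound\<close>

text \<open>Codes act on lists, whereas the single-letter argument selects coordinates of functions;
  this passes between the two.\<close>

lemma replicate_pmf_eq_Pi_pmf:
  "replicate_pmf n p = map_pmf (\<lambda>f. map f [0..<n]) (Pi_pmf {..<n} d (\<lambda>_. p))"
proof (induction n)
  case 0
  then show ?case by simp
next
  case (Suc n)
  have "replicate_pmf (Suc n) p = bind_pmf (replicate_pmf n p) (\<lambda>xs. bind_pmf p (\<lambda>y. return_pmf (xs @ [y])))"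
    using replicate_pmf_distrib[of n 1 p] by (simp add: bind_assoc_pmf bind_return_pmf)
  also have "\<dots> = bind_pmf p (\<lambda>y. bind_pmf (Pi_pmf {..<n} d (\<lambda>_. p)) (\<lambda>f. return_pmf (map f [0..<n] @ [y])))"
    by (subst bind_commute_pmf) (simp add: Suc bind_map_pmf)
  also have "\<dots> = map_pmf (\<lambda>f. map f [0..<Suc n]) (Pi_pmf (insert n {..<n}) d (\<lambda>_. p))"
    by (subst Pi_pmf_insert') (auto simp: map_bind_pmf map_pmf_def[symmetric] pmf.map_comp o_def intro!: bind_pmf_cong map_pmf_cong)
  finally show ?case by (simp add: lessThan_Suc)
qed

context block_code
begin

definition R :: "(('j \<times> 'k) \<times> ('a \<times> 'x \<times> 'y \<times> 'z) list) pmf" where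
  "R = kernel_law (replicate_pmf n s) (map fst) K"

lemma R_eq: "R = map_pmf (\<lambda>z. (fst z, map (snd z) [0..<n])) P"
  unfolding R_def P_def replicate_pmf_eq_Pi_pmf[of n s undefined] B_def[symmetric]
  using map_kernel_law_state[of "\<lambda>f. map f [0..<n]" B "map fst" K] by (simp add: o_def)

lemma finR: "finite (set_pmf R)"
  by (simp add: R_eq finP)

lemma ent_R: "ent R X = H (\<lambda>z. X (fst z, map (snd z) [0..<n]))"
  unfolding R_eq by (rule ent_map[OF finP])

lemma converse_list:
  fixes \<Phi> :: real
  assumes n: "0 < n"
    and A: "finite A" "\<And>z. z \<in> set_pmf R \<Longrightarrow> snd (fst z) \<in> A"
    and err: "measure_pmf.prob R {z. d (map cY (snd z), fst (fst z)) \<noteq> snd (fst z)} \<le> \<delta>"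
    and \<Phi>: "1 + \<delta> * log 2 (card A) \<le> \<Phi>"
  obtains a b c d :: real where "(source_marginal s, a, b, c, d) \<in> region_hull s"
    "ent R (\<lambda>z. (snd (fst z), fst (fst z), map cZ (snd z))) - ent R (\<lambda>z. (fst (fst z), map cZ (snd z))) \<le> n * (a - b) + \<Phi>"
    "n * (a - b) \<le> ent R (\<lambda>z. snd (fst z))"
    "n * (ent s (\<lambda>w. (fst w, cY w)) - ent s cY - c)
       + (ent R (\<lambda>z. (fst z, map fst (snd z), map cY (snd z))) - ent R (\<lambda>z. (map fst (snd z), map cY (snd z))))
     \<le> ent R (\<lambda>z. fst (fst z)) + \<Phi>"
    "n * (ent s (\<lambda>w. (cX w, cY w)) - ent s cY - d + ent s cY - ent s cZ - a)
     \<le> ent R (\<lambda>z. (map cX (snd z), map cZ (snd z))) + ent R (\<lambda>z. (fst (fst z), map cZ (snd z))) - ent R (\<lambda>z. map cZ (snd z))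
       - ent R (\<lambda>z. (map cX (snd z), fst (fst z), map cZ (snd z))) + \<Phi>"
proof -
  have c1: "ent R (\<lambda>z. (snd (fst z), fst (fst z), map g (snd z))) = H (\<lambda>z. (fst z, sq g {..<n} z))" for g :: "_ \<Rightarrow> 'q"
    unfolding ent_R by (rule ent_cong[OF finP]) (auto simp: sq_eq_iff prod_eq_iff)
  have c2: "ent R (\<lambda>z. (fst (fst z), map g (snd z))) = H (\<lambda>z. (fst (fst z), sq g {..<n} z))" for g :: "_ \<Rightarrow> 'q"
    unfolding ent_R by (rule ent_cong[OF finP]) (auto simp: sq_eq_iff prod_eq_iff)
  have c3: "ent R (\<lambda>z. (fst z, map g (snd z), map h (snd z))) = H (\<lambda>z. (fst z, sq g {..<n} z, sq h {..<n} z))"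
    for g :: "_ \<Rightarrow> 'q" and h :: "_ \<Rightarrow> 'r"
    unfolding ent_R by (rule ent_cong[OF finP]) (auto simp: sq_eq_iff prod_eq_iff)
  have c4: "ent R (\<lambda>z. (map g (snd z), map h (snd z))) = H (\<lambda>z. (sq g {..<n} z, sq h {..<n} z))"
    for g :: "_ \<Rightarrow> 'q" and h :: "_ \<Rightarrow> 'r"
    unfolding ent_R by (rule ent_cong[OF finP]) (auto simp: sq_eq_iff prod_eq_iff)
  have c5: "ent R (\<lambda>z. map g (snd z)) = H (sq g {..<n})" for g :: "_ \<Rightarrow> 'q"
    unfolding ent_R by (rule ent_cong[OF finP]) (auto simp: sq_eq_iff prod_eq_iff)
  have c6: "ent R (\<lambda>z. (map g (snd z), fst (fst z), map h (snd z))) = H (\<lambda>z. (sq g {..<n} z, fst (fst z), sq h {..<n} z))"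
    for g :: "_ \<Rightarrow> 'q" and h :: "_ \<Rightarrow> 'r"
    unfolding ent_R by (rule ent_cong[OF finP]) (auto simp: sq_eq_iff prod_eq_iff)
  have c7: "ent R (\<lambda>z. snd (fst z)) = H (\<lambda>z. snd (fst z))" "ent R (\<lambda>z. fst (fst z)) = H (\<lambda>z. fst (fst z))"
    by (simp_all add: ent_R)
  have "ent R (\<lambda>z. (snd (fst z), (fst (fst z), map cY (snd z)))) - ent R (\<lambda>z. (fst (fst z), map cY (snd z))) \<le> \<Phi>"
    using fano[where S = "\<lambda>z. snd (fst z)" and d = "\<lambda>(j, y). d (y, j)" and T = "\<lambda>z. (fst (fst z), map cY (snd z))" and \<delta> = \<delta>, OF finR A] err \<Phi>
    by auto
  then have "H (\<lambda>z. (fst z, sq cY {..<n} z)) - H (\<lambda>z. (fst (fst z), sq cY {..<n} z)) \<le> \<Phi>"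
    unfolding c1 c2 .
  then show thesis
    by (rule converse_block[OF n]) (rule that[unfolded c1 c2 c3 c4 c5 c6 c7])
qed

end

text \<open>The generated-secret region corresponds to \<open>\<kappa> = 0\<close>, the chosen-secret region to \<open>\<kappa> = 1\<close>.\<close>

definition outer_approx ::
  "real \<Rightarrow> ('a::finite \<times> 'x::finite \<times> 'y::finite \<times> 'z::finite) pmf \<Rightarrow> real \<times> real \<times> real \<Rightarrow> real \<Rightarrow> bool" where
  "outer_approx \<kappa> s R \<epsilon> \<longleftrightarrow> (\<exists>a b c d. (source_marginal s, a, b, c, d) \<in> region_hull s \<and>
     fst R \<le> a - b + \<epsilon> \<and>
     ent s (\<lambda>w. (fst w, cY w)) - ent s cY - c + \<kappa> * (a - b) \<le> fst (snd R) + \<epsilon> \<and>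
     ent s (\<lambda>w. (cX w, cY w)) - ent s cY - d + ent s cY - ent s cZ - a \<le> snd (snd R) + \<epsilon>)"

text \<open>The least slack for which the inequalities hold is a continuous function on the compact
  fibre over the law of \<open>Xt\<close>. Its minimum is attained and lies below every positive
  number.\<close>

lemma outer_approx_limit:
  assumes "\<And>\<epsilon>. 0 < \<epsilon> \<Longrightarrow> outer_approx \<kappa> s R \<epsilon>"
  shows "outer_approx \<kappa> s R 0"
proof -
  define C where "C = region_hull s \<inter> {v. fst v = source_marginal s}"
  define \<Phi>1 where "\<Phi>1 v = fst R - (fst (snd v) - fst (snd (snd v)))" for v :: "(real ^ 'a) \<times> real \<times> real \<times> real \<times> real"
  define \<Phi>2 where "\<Phi>2 v = ent s (\<lambda>w. (fst w, cY w)) - ent s cY - fst (snd (snd (snd v))) + \<kappa> * (fst (snd v) - fst (snd (snd v))) - fst (snd R)"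
    for v :: "(real ^ 'a) \<times> real \<times> real \<times> real \<times> real"
  define \<Phi>3 where "\<Phi>3 v = ent s (\<lambda>w. (cX w, cY w)) - ent s cY - snd (snd (snd (snd v))) + ent s cY - ent s cZ - fst (snd v) - snd (snd R)"
    for v :: "(real ^ 'a) \<times> real \<times> real \<times> real \<times> real"
  define \<Phi> where "\<Phi> v = max (\<Phi>1 v) (max (\<Phi>2 v) (\<Phi>3 v))" for v
  have \<Phi>: "(\<exists>v\<in>C. \<Phi> v \<le> \<epsilon>) \<longleftrightarrow> outer_approx \<kappa> s R \<epsilon>" for \<epsilon>
  proof -
    have "(\<exists>v\<in>C. \<Phi> v \<le> \<epsilon>) \<longleftrightarrow> (\<exists>a b c d. (source_marginal s, a, b, c, d) \<in> region_hull s \<and> \<Phi> (source_marginal s, a, b, c, d) \<le> \<epsilon>)"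
      unfolding C_def Bex_def Int_iff mem_Collect_eq split_paired_Ex fst_conv by blast
    then show ?thesis by (simp add: \<Phi>_def \<Phi>1_def \<Phi>2_def \<Phi>3_def outer_approx_def algebra_simps)
  qed
  have "compact C"
    unfolding C_def by (intro compact_Int_closed compact_region_hull closed_Collect_eq continuous_intros)
  moreover have "C \<noteq> {}" using assms[of 1] unfolding \<Phi>[symmetric] by auto
  moreover have "continuous_on C \<Phi>"
    unfolding \<Phi>_def[abs_def] \<Phi>1_def \<Phi>2_def \<Phi>3_def by (intro continuous_on_max continuous_intros)
  ultimately have "\<exists>v\<in>C. \<forall>u\<in>C. \<Phi> v \<le> \<Phi> u" by (rule continuous_attains_inf)
  then obtain v where v: "v \<in> C" "\<And>u. u \<in> C \<Longrightarrow> \<Phi> v \<le> \<Phi> u" by (elim bexE) simp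
  have "\<Phi> v \<le> 0"
  proof (rule field_le_epsilon)
    fix e :: real assume "0 < e"
    then obtain u where "u \<in> C" "\<Phi> u \<le> e" using assms[of e] unfolding \<Phi>[symmetric] by blast
    then show "\<Phi> v \<le> 0 + e" using v(2)[of u] by simp
  qed
  then show ?thesis using v(1) \<Phi>[of 0] by blast
qed

lemma markov_single_law:
  fixes PX :: "'x::finite pmf" and PA :: "'x \<Rightarrow> 'a::finite pmf" and V :: "'x \<Rightarrow> ('y::finite \<times> 'z::finite) pmf"
  defines "s \<equiv> single_law PX PA V"
  shows "ent s (\<lambda>w. w) + ent s cX = ent s (\<lambda>w. (fst w, cX w)) + ent s (\<lambda>w. (cX w, cY w, cZ w))"
proof -
  define r where "r = bind_pmf PX (\<lambda>x. map_pmf (\<lambda>yz. (x, yz)) (V x))"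
  \<comment> \<open>Drawing \<open>Xt\<close> last exhibits it as the output of a kernel that sees
    \<open>X\<close> only.\<close>
  have "s = bind_pmf PX (\<lambda>x. bind_pmf (V x) (\<lambda>yz. bind_pmf (PA x) (\<lambda>xt. return_pmf (xt, x, yz))))"
    unfolding s_def single_law_def by (subst bind_commute_pmf) (simp add: case_prod_beta)
  also have "\<dots> = kernel_law r fst PA"
    by (simp add: r_def kernel_law_def bind_assoc_pmf bind_map_pmf)
  finally have s: "s = kernel_law r fst PA" .
  have "ent s (\<lambda>z. z) + ent s (\<lambda>z. fst (snd z)) = ent s (\<lambda>z. (fst z, fst (snd z))) + ent s snd"
    unfolding s by (rule ent_kernel_law) simp
  then show ?thesis by (simp add: cX_def[abs_def] cY_def cZ_def)
qed

section \<open>From the conditions on a code to the approximate bounds\<close>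

lemma log_card_rate_set:
  assumes "0 \<le> R"
  shows "finite (rate_set n R)" "rate_set n R \<noteq> {}" "log 2 (card (rate_set n R)) \<le> n * R + 1"
proof -
  let ?t = "2 powr (real n * R)"
  have t: "1 \<le> ?t" using assms by (simp add: ge_one_powr_ge_zero)
  have eq: "rate_set n R = {1..nat \<lceil>?t\<rceil>}"
    by (auto simp: rate_set_def int_range_def le_nat_iff nat_le_iff)
  have c: "card (rate_set n R) = nat \<lceil>?t\<rceil>" "1 \<le> nat \<lceil>?t\<rceil>" using t by (simp_all add: eq) linarith
  show "finite (rate_set n R)" by (simp add: eq)
  show "rate_set n R \<noteq> {}" using c(2) by (simp add: eq)
  \<comment> \<open>Rounding up at most doubles a number that is at least 1, hence the one
    additional bit.\<close>
  have "real (nat \<lceil>?t\<rceil>) \<le> 2 * ?t" using t by linarith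
  also have "2 * ?t = 2 powr (real n * R + 1)" by (simp add: powr_add)
  finally have le: "real (nat \<lceil>?t\<rceil>) \<le> 2 powr (real n * R + 1)" .
  have "log 2 (real (nat \<lceil>?t\<rceil>)) \<le> log 2 (2 powr (real n * R + 1))"
    using c(2) le by (subst log_le_cancel_iff) auto
  also have "\<dots> = n * R + 1" by (rule log_powr_cancel) auto
  finally show "log 2 (card (rate_set n R)) \<le> n * R + 1" unfolding c(1) .
qed

lemma ent_uniform:
  assumes "finite A" "A \<noteq> {}"
  shows "ent (pmf_of_set A) (\<lambda>x. x) = log 2 (card A)"
proof -
  have "0 < card A" using assms by (simp add: card_gt_0_iff)
  then show ?thesis using assms by (simp add: ent_def log_divide)
qed

lemma seq_eq_map: "seqXt = map fst" "seqX = map cX" "seqY = map cY" "seqZ = map cZ"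
  by (auto simp: fun_eq_iff seqXt_def seqX_def seqY_def seqZ_def cX_def cY_def cZ_def case_prod_beta)

lemma finite_set_replicate_pmf: "finite (set_pmf p) \<Longrightarrow> finite (set_pmf (replicate_pmf n p))"
  using finite_lists_length_eq[of "set_pmf p" n] by (simp add: set_replicate_pmf lists_eq_set)

text \<open>The common core of both models. The key condition allows two losses of
  \<open>n * \<delta>\<close>, from the uniformity and the rate of a generated key, and secrecy a
  third; this is why the Fano term must fit into \<open>n * (\<epsilon> - 3 * \<delta>)\<close>. The
  assumption \<open>fresh\<close> demands the uncertainty of the message that
  \<open>\<kappa>\<close> charges to the storage rate.\<close>

lemma kernel_outer_approx:
  fixes PX :: "'x::finite pmf" and PA :: "'x \<Rightarrow> 'a::finite pmf" and V :: "'x \<Rightarrow> ('y::finite \<times> 'z::finite) pmf"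
    and K :: "'a list \<Rightarrow> ('j \<times> 'k) pmf" and n :: nat and RS RJ RL \<delta> \<epsilon> \<kappa> :: real
  defines "s \<equiv> single_law PX PA V"
  defines "R \<equiv> kernel_law (replicate_pmf n s) (map fst) K"
  assumes finK: "\<And>xs. finite (set_pmf (K xs))" and n: "0 < n" and \<kappa>: "0 \<le> \<kappa>"
    and A: "finite A" "\<And>z. z \<in> set_pmf R \<Longrightarrow> snd (fst z) \<in> A"
    and B: "finite B" "\<And>z. z \<in> set_pmf R \<Longrightarrow> fst (fst z) \<in> B"
    and err: "measure_pmf.prob R {z. d (map cY (snd z), fst (fst z)) \<noteq> snd (fst z)} \<le> \<delta>"
    and key: "n * RS - 2 * (n * \<delta>) \<le> ent R (\<lambda>z. snd (fst z))"
    and secrecy: "ent R (\<lambda>z. snd (fst z)) + ent R (\<lambda>z. (fst (fst z), map cZ (snd z)))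
      - ent R (\<lambda>z. (snd (fst z), fst (fst z), map cZ (snd z))) \<le> n * \<delta>"
    and storage: "log 2 (card B) \<le> n * (RJ + \<delta>)"
    and leakage: "ent R (\<lambda>z. (map cX (snd z), map cZ (snd z))) + ent R (\<lambda>z. (fst (fst z), map cZ (snd z))) - ent R (\<lambda>z. map cZ (snd z))
       - ent R (\<lambda>z. (map cX (snd z), fst (fst z), map cZ (snd z))) \<le> n * (RL + \<delta>)"
    and fresh: "\<kappa> * ent R (\<lambda>z. snd (fst z)) \<le> ent R (\<lambda>z. (fst z, map fst (snd z), map cY (snd z))) - ent R (\<lambda>z. (map fst (snd z), map cY (snd z)))"
    and \<epsilon>: "1 + \<delta> * log 2 (card A) \<le> n * (\<epsilon> - 3 * \<delta>)" and \<delta>: "0 \<le> \<delta>"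
  shows "outer_approx \<kappa> s (RS, RJ, RL) \<epsilon>"
proof -
  interpret bc: block_code s n K
    by unfold_locales (use finK markov_single_law s_def in auto)
  have R: "bc.R = R" by (simp add: bc.R_def R_def)
  have finR: "finite (set_pmf R)" using bc.finR by (simp add: R)
  define \<Phi> :: real where "\<Phi> = n * (\<epsilon> - 3 * \<delta>)"
  have nn: "n * (\<epsilon> - 3 * \<delta>) \<le> n * (\<epsilon> - \<delta>)" using \<delta> by (intro mult_left_mono) auto
  obtain a b c e :: real where hull: "(source_marginal s, a, b, c, e) \<in> region_hull s"
    and 1: "ent R (\<lambda>z. (snd (fst z), fst (fst z), map cZ (snd z))) - ent R (\<lambda>z. (fst (fst z), map cZ (snd z))) \<le> n * (a - b) + \<Phi>"
    and 2: "n * (a - b) \<le> ent R (\<lambda>z. snd (fst z))"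
    and 3: "n * (ent s (\<lambda>w. (fst w, cY w)) - ent s cY - c)
       + (ent R (\<lambda>z. (fst z, map fst (snd z), map cY (snd z))) - ent R (\<lambda>z. (map fst (snd z), map cY (snd z))))
     \<le> ent R (\<lambda>z. fst (fst z)) + \<Phi>"
    and 4: "n * (ent s (\<lambda>w. (cX w, cY w)) - ent s cY - e + ent s cY - ent s cZ - a)
     \<le> ent R (\<lambda>z. (map cX (snd z), map cZ (snd z))) + ent R (\<lambda>z. (fst (fst z), map cZ (snd z))) - ent R (\<lambda>z. map cZ (snd z))
       - ent R (\<lambda>z. (map cX (snd z), fst (fst z), map cZ (snd z))) + \<Phi>"
    by (rule bc.converse_list[unfolded R, OF n A err \<epsilon>[folded \<Phi>_def]])
  have J: "ent R (\<lambda>z. fst (fst z)) \<le> log 2 (card B)"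
    by (rule ent_le_log_card[OF finR B])
  \<comment> \<open>The secrecy gain is at most the key entropy, so the latter can be replaced by
    the single-letter term of the storage bound.\<close>
  have "\<kappa> * (n * (a - b)) \<le> \<kappa> * ent R (\<lambda>z. snd (fst z))" using 2 \<kappa> by (rule mult_left_mono)
  note 3 = this fresh 3 J storage
  have "n * RS \<le> n * (a - b + \<epsilon>)"
    using key secrecy 1 by (simp add: \<Phi>_def algebra_simps)
  moreover have "n * (ent s (\<lambda>w. (fst w, cY w)) - ent s cY - c + \<kappa> * (a - b)) \<le> n * (RJ + \<epsilon>)"
    using 3 nn by (simp add: \<Phi>_def algebra_simps)
  moreover have "n * (ent s (\<lambda>w. (cX w, cY w)) - ent s cY - e + ent s cY - ent s cZ - a) \<le> n * (RL + \<epsilon>)"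
    using 4 leakage nn by (simp add: \<Phi>_def algebra_simps)
  ultimately show ?thesis
    unfolding outer_approx_def using hull n by auto
qed

lemma gs_block_outer_approx:
  fixes PX :: "'x::finite pmf" and PA :: "'x \<Rightarrow> 'a::finite pmf" and V :: "'x \<Rightarrow> ('y::finite \<times> 'z::finite) pmf" and n :: nat and RS RJ RL \<delta> \<epsilon> :: real
  assumes n: "0 < n" and \<delta>: "0 < \<delta>" and RS: "0 \<le> RS" and RJ: "0 \<le> RJ"
    and e: "e \<in> gs_encoders n (rate_set n RJ) (rate_set n RS)"
  defines "p \<equiv> block_law n PX PA V" and "J \<equiv> (\<lambda>w. fst (e (seqXt w)))" and "S \<equiv> (\<lambda>w. snd (e (seqXt w)))"
  assumes err: "measure_pmf.prob p {w. d (seqY w, J w) \<noteq> S w} \<le> \<delta>"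
    and unif: "shannon_entropy p S + real n * \<delta> \<ge> log 2 (real (card (rate_set n RS)))"
    and rate: "log 2 (real (card (rate_set n RS))) \<ge> real n * (RS - \<delta>)"
    and storage: "log 2 (real (card (rate_set n RJ))) \<le> real n * (RJ + \<delta>)"
    and secrecy: "mutual_info p S (\<lambda>w. (J w, seqZ w)) \<le> real n * \<delta>"
    and leakage: "cond_mutual_info p seqX J seqZ \<le> real n * (RL + \<delta>)"
    and \<epsilon>: "1 + \<delta> * (n * RS + 1) \<le> n * (\<epsilon> - 3 * \<delta>)"
  shows "outer_approx 0 (single_law PX PA V) (RS, RJ, RL) \<epsilon>"
proof -
  let ?s = "single_law PX PA V"
  let ?R = "kernel_law (replicate_pmf n ?s) (map fst) (\<lambda>xs. return_pmf (e xs))"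
  have R: "?R = map_pmf (\<lambda>w. (e (seqXt w), w)) p"
    by (simp add: kernel_law_altdef p_def block_law_def seq_eq_map map_pmf_def bind_return_pmf)
  have finp: "finite (set_pmf p)"
    by (simp add: p_def block_law_def finite_set_replicate_pmf)
  have finR: "finite (set_pmf ?R)" using finp by (simp add: R)
  have eR: "ent ?R X = ent p (\<lambda>w. X (e (seqXt w), w))" for X :: "_ \<Rightarrow> 'q"
    unfolding R by (rule ent_map[OF finp])
  have eset: "fst z \<in> rate_set n RJ \<times> rate_set n RS" if z: "z \<in> set_pmf ?R" for z
  proof -
    obtain w where w: "w \<in> set_pmf p" "z = (e (seqXt w), w)" using z by (auto simp: R)
    then have "length (seqXt w) = n" by (auto simp: p_def block_law_def set_replicate_pmf seqXt_def)
    then show ?thesis using e w(2) by (auto simp: gs_encoders_def)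
  qed
  note rs = log_card_rate_set[OF RS, of n] and rj = log_card_rate_set[OF RJ, of n]
  show ?thesis
  proof (rule kernel_outer_approx[where K = "\<lambda>xs. return_pmf (e xs)" and n = n and A = "rate_set n RS" and B = "rate_set n RJ" and d = d and \<delta> = \<delta>])
    show "measure_pmf.prob ?R {z. d (map cY (snd z), fst (fst z)) \<noteq> snd (fst z)} \<le> \<delta>"
      using err by (simp add: R seq_eq_map vimage_def J_def S_def)
    show "real n * RS - 2 * (real n * \<delta>) \<le> ent ?R (\<lambda>z. snd (fst z))"
      using unif rate by (simp add: eR shannon_entropy_eq_ent[OF finp] S_def algebra_simps)
    show "ent ?R (\<lambda>z. snd (fst z)) + ent ?R (\<lambda>z. (fst (fst z), map cZ (snd z)))
      - ent ?R (\<lambda>z. (snd (fst z), fst (fst z), map cZ (snd z))) \<le> n * \<delta>"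
      using secrecy by (simp add: eR mutual_info_eq_ent[OF finp] S_def J_def seq_eq_map)
    show "ent ?R (\<lambda>z. (map cX (snd z), map cZ (snd z))) + ent ?R (\<lambda>z. (fst (fst z), map cZ (snd z))) - ent ?R (\<lambda>z. map cZ (snd z))
       - ent ?R (\<lambda>z. (map cX (snd z), fst (fst z), map cZ (snd z))) \<le> n * (RL + \<delta>)"
      using leakage by (simp add: eR cond_mutual_info_eq_ent[OF finp] J_def seq_eq_map)
    \<comment> \<open>With \<open>\<kappa> = 0\<close> only the nonnegativity of a conditional
      entropy is required.\<close>
    show "0 * ent ?R (\<lambda>z. snd (fst z)) \<le> ent ?R (\<lambda>z. (fst z, map fst (snd z), map cY (snd z))) - ent ?R (\<lambda>z. (map fst (snd z), map cY (snd z)))"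
      using ent_mono[OF finR, of "\<lambda>z. (fst z, map fst (snd z), map cY (snd z))" "\<lambda>z. (map fst (snd z), map cY (snd z))"] by simp
    have "\<delta> * log 2 (card (rate_set n RS)) \<le> \<delta> * (n * RS + 1)" using rs(3) \<delta> by (intro mult_left_mono) auto
    then show "1 + \<delta> * log 2 (card (rate_set n RS)) \<le> n * (\<epsilon> - 3 * \<delta>)" using \<epsilon> by linarith
  qed (use n \<delta> rs(1) rj(1) storage eset in \<open>auto simp: mem_Times_iff\<close>)
qed

lemma cs_block_outer_approx:
  fixes PX :: "'x::finite pmf" and PA :: "'x \<Rightarrow> 'a::finite pmf" and V :: "'x \<Rightarrow> ('y::finite \<times> 'z::finite) pmf" and n :: nat and RS RJ RL \<delta> \<epsilon> :: real
  assumes n: "0 < n" and \<delta>: "0 < \<delta>" and RS: "0 \<le> RS" and RJ: "0 \<le> RJ"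
    and e: "e \<in> cs_encoders n (rate_set n RJ) (rate_set n RS)"
  defines "p \<equiv> pair_pmf (pmf_of_set (rate_set n RS)) (block_law n PX PA V)" and "J \<equiv> (\<lambda>(s, w). e (seqXt w, s))"
  assumes err: "measure_pmf.prob p {w. (\<lambda>(s, w). d (seqY w, J (s, w))) w \<noteq> fst w} \<le> \<delta>"
    and rate: "log 2 (real (card (rate_set n RS))) \<ge> real n * (RS - \<delta>)"
    and storage: "log 2 (real (card (rate_set n RJ))) \<le> real n * (RJ + \<delta>)"
    and secrecy: "mutual_info p fst (\<lambda>w. (J w, seqZ (snd w))) \<le> real n * \<delta>"
    and leakage: "cond_mutual_info p (\<lambda>w. seqX (snd w)) J (\<lambda>w. seqZ (snd w)) \<le> real n * (RL + \<delta>)"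
    and \<epsilon>: "1 + \<delta> * (n * RS + 1) \<le> n * (\<epsilon> - 3 * \<delta>)"
  shows "outer_approx 1 (single_law PX PA V) (RS, RJ, RL) \<epsilon>"
proof -
  let ?s = "single_law PX PA V"
  let ?A = "rate_set n RS"
  note rs = log_card_rate_set[OF RS, of n] and rj = log_card_rate_set[OF RJ, of n]
  let ?K = "\<lambda>xs. map_pmf (\<lambda>s. (e (xs, s), s)) (pmf_of_set ?A)"
  let ?R = "kernel_law (replicate_pmf n ?s) (map fst) ?K"
  let ?bl = "block_law n PX PA V"
  have R: "?R = map_pmf (\<lambda>sw. ((J sw, fst sw), snd sw)) p"
    unfolding kernel_law_altdef p_def pair_pmf_def J_def
    by (subst bind_commute_pmf) (simp add: map_bind_pmf pmf.map_comp o_def block_law_def seq_eq_map map_pmf_def bind_assoc_pmf bind_return_pmf)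
  have finbl: "finite (set_pmf ?bl)"
    by (simp add: block_law_def finite_set_replicate_pmf)
  have finp: "finite (set_pmf p)"
    using finbl rs by (simp add: p_def)
  have finR: "finite (set_pmf ?R)" using finp by (simp add: R)
  have eR: "ent ?R X = ent p (\<lambda>sw. X ((J sw, fst sw), snd sw))" for X :: "_ \<Rightarrow> 'q"
    unfolding R by (rule ent_map[OF finp])
  have eset: "fst z \<in> rate_set n RJ \<times> rate_set n RS" if z: "z \<in> set_pmf ?R" for z
  proof -
    obtain s w where w: "s \<in> ?A" "w \<in> set_pmf ?bl" "z = ((e (seqXt w, s), s), w)" using z rs by (auto simp: R p_def J_def)
    then have "length (seqXt w) = n" by (auto simp: block_law_def set_replicate_pmf seqXt_def)
    then show ?thesis using e w by (auto simp: cs_encoders_def)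
  qed
  have HS: "ent ?R (\<lambda>z. snd (fst z)) = log 2 (card ?A)"
    using ent_map[OF finp, of fst "\<lambda>x. x"] ent_uniform[OF rs(1,2)] by (simp add: eR p_def map_fst_pair_pmf)
  show ?thesis
  proof (rule kernel_outer_approx[where K = ?K and n = n and A = "rate_set n RS" and B = "rate_set n RJ" and d = d and \<delta> = \<delta>])
    show "measure_pmf.prob ?R {z. d (map cY (snd z), fst (fst z)) \<noteq> snd (fst z)} \<le> \<delta>"
      using err by (simp add: R seq_eq_map vimage_def case_prod_beta)
    have "0 \<le> real n * \<delta>" using \<delta> by simp
    then show "real n * RS - 2 * (real n * \<delta>) \<le> ent ?R (\<lambda>z. snd (fst z))"
      using rate unfolding HS right_diff_distrib by linarith
    show "ent ?R (\<lambda>z. snd (fst z)) + ent ?R (\<lambda>z. (fst (fst z), map cZ (snd z)))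
      - ent ?R (\<lambda>z. (snd (fst z), fst (fst z), map cZ (snd z))) \<le> n * \<delta>"
      using secrecy by (simp add: eR mutual_info_eq_ent[OF finp] seq_eq_map)
    show "ent ?R (\<lambda>z. (map cX (snd z), map cZ (snd z))) + ent ?R (\<lambda>z. (fst (fst z), map cZ (snd z))) - ent ?R (\<lambda>z. map cZ (snd z))
       - ent ?R (\<lambda>z. (map cX (snd z), fst (fst z), map cZ (snd z))) \<le> n * (RL + \<delta>)"
      using leakage by (simp add: eR cond_mutual_info_eq_ent[OF finp] seq_eq_map)
    show "1 * ent ?R (\<lambda>z. snd (fst z)) \<le> ent ?R (\<lambda>z. (fst z, map fst (snd z), map cY (snd z))) - ent ?R (\<lambda>z. (map fst (snd z), map cY (snd z)))"
    \<comment> \<open>The chosen key is uniform and independent of the source, so its full entropy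
      survives given the words \<open>Xt\<close> and \<open>Y\<close>; forgetting the helper data on
      the left only lowers the joint entropy.\<close>
    proof -
      have "ent ?R (\<lambda>z. (snd (fst z), map fst (snd z), map cY (snd z))) \<le> ent ?R (\<lambda>z. (fst z, map fst (snd z), map cY (snd z)))"
        by (rule ent_mono[OF finR]) auto
      moreover have "ent ?R (\<lambda>z. (snd (fst z), map fst (snd z), map cY (snd z))) = log 2 (card ?A) + ent ?bl (\<lambda>w. (map fst w, map cY w))"
        using ent_pair[of "pmf_of_set ?A" ?bl "\<lambda>x. x" "\<lambda>w. (map fst w, map cY w)"] finbl rs ent_uniform[OF rs(1,2)]
        by (simp add: eR p_def case_prod_unfold)
      moreover have "ent ?R (\<lambda>z. (map fst (snd z), map cY (snd z))) = ent ?bl (\<lambda>w. (map fst w, map cY w))"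
        using ent_map[OF finp, of snd "\<lambda>w. (map fst w, map cY w)"] by (simp add: eR p_def map_snd_pair_pmf)
      ultimately show ?thesis unfolding HS by linarith
    qed
    have "\<delta> * log 2 (card (rate_set n RS)) \<le> \<delta> * (n * RS + 1)" using rs(3) \<delta> by (intro mult_left_mono) auto
    then show "1 + \<delta> * log 2 (card (rate_set n RS)) \<le> n * (\<epsilon> - 3 * \<delta>)" using \<epsilon> by linarith
  qed (use n \<delta> rs rj(1) storage eset in \<open>auto simp: mem_Times_iff\<close>)
qed

text \<open>The parameter \<open>\<delta>\<close> is fixed before \<open>n\<close>. The choice
  \<open>\<delta> * (3 + RS) \<le> \<epsilon> / 2\<close> absorbs the terms growing with
  \<open>n\<close>, and a large \<open>n\<close> then absorbs the constant
  \<open>1 + \<delta>\<close> into the other half.\<close>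

lemma eventually_slack:
  fixes \<epsilon> RS :: real
  assumes \<epsilon>: "0 < \<epsilon>" and RS: "0 \<le> RS"
    and ev: "\<forall>\<^sub>F \<delta> :: real in at_right 0. \<forall>\<^sub>F n in sequentially. Q \<delta> n"
  obtains \<delta> :: real and n where "0 < \<delta>" "0 < n" "Q \<delta> n" "1 + \<delta> * (n * RS + 1) \<le> n * (\<epsilon> - 3 * \<delta>)"
proof -
  have "\<forall>\<^sub>F \<delta> :: real in at_right 0. \<delta> \<in> {0<..<\<epsilon> / (2 * (3 + RS))}"
    by (rule eventually_at_right_real) (use \<epsilon> RS in simp)
  then have "\<forall>\<^sub>F \<delta> :: real in at_right 0. (\<forall>\<^sub>F n in sequentially. Q \<delta> n) \<and> \<delta> < \<epsilon> / (2 * (3 + RS)) \<and> 0 < \<delta>"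
    using ev by eventually_elim auto
  then obtain \<delta> where Q: "\<forall>\<^sub>F n in sequentially. Q \<delta> n" and d: "\<delta> < \<epsilon> / (2 * (3 + RS))" "0 < \<delta>"
    using eventually_happens'[OF trivial_limit_at_right_real] by blast
  have d2: "\<delta> * (3 + RS) \<le> \<epsilon> / 2" using d(1) RS by (simp add: field_simps)
  obtain N :: nat where N: "2 * (1 + \<delta>) / \<epsilon> < N" using reals_Archimedean2 by blast
  have "\<forall>\<^sub>F n in sequentially. Q \<delta> n \<and> N < n"
    using Q eventually_gt_at_top[of N] by eventually_elim auto
  then obtain n where n: "Q \<delta> n" "N < n" using eventually_happens'[OF sequentially_bot] by blast
  have "2 * (1 + \<delta>) \<le> real n * \<epsilon>" using N n(2) \<epsilon> by (simp add: field_simps) (smt (verit) mult_left_mono of_nat_less_iff)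
  moreover have "real n * (\<delta> * (3 + RS)) \<le> real n * (\<epsilon> / 2)" using d2 by (intro mult_left_mono) auto
  ultimately have "1 + \<delta> * (n * RS + 1) \<le> n * (\<epsilon> - 3 * \<delta>)" by (simp add: algebra_simps)
  then show thesis using that[of \<delta> n] d n by simp
qed

section \<open>Achievable rates, closure and bounded auxiliary alphabets\<close>

definition gs_code ::
  "'x::finite pmf \<Rightarrow> ('x \<Rightarrow> 'a::finite pmf) \<Rightarrow> ('k::finite \<Rightarrow> 'l::finite \<Rightarrow> 'x \<Rightarrow> ('y::finite \<times> 'z::finite) pmf)
   \<Rightarrow> real \<Rightarrow> real \<Rightarrow> real \<Rightarrow> real \<Rightarrow> nat \<Rightarrow> ('a list \<Rightarrow> nat * nat) \<Rightarrow> ('y list \<times> nat \<Rightarrow> nat) \<Rightarrow> bool" where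
  "gs_code PX PA W RS RJ RL \<delta> n e d \<longleftrightarrow> (\<forall>k l. let p = block_law n PX PA (W k l);
                   J = (\<lambda>w. fst (e (seqXt w)));
                   S = (\<lambda>w. snd (e (seqXt w)));
                   S' = (\<lambda>w. d (seqY w, J w))
               in measure_pmf.prob p {w. S' w \<noteq> S w} \<le> \<delta>
                \<and> shannon_entropy p S + real n * \<delta> \<ge> log 2 (real (card (rate_set n RS)))
                \<and> log 2 (real (card (rate_set n RS))) \<ge> real n * (RS - \<delta>)
                \<and> log 2 (real (card (rate_set n RJ))) \<le> real n * (RJ + \<delta>)
                \<and> mutual_info p S (\<lambda>w. (J w, seqZ w)) \<le> real n * \<delta>
                \<and> cond_mutual_info p seqX J seqZ \<le> real n * (RL + \<delta>))"

lemma gs_achievable_iff: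
  "gs_achievable PX PA W (RS, RJ, RL) \<longleftrightarrow> 0 \<le> RS \<and> 0 \<le> RJ \<and> 0 \<le> RL \<and>
     (\<forall>\<^sub>F \<delta> :: real in at_right 0. \<forall>\<^sub>F n in sequentially.
       \<exists>e \<in> gs_encoders n (rate_set n RJ) (rate_set n RS). \<exists>d \<in> decoders n (rate_set n RJ) (rate_set n RS).
         gs_code PX PA W RS RJ RL \<delta> n e d)"
  unfolding gs_achievable_def gs_code_def prod.case ..

lemma gs_achievable_outer_approx:
  assumes ach: "gs_achievable PX PA W R" and \<epsilon>: "0 < \<epsilon>"
  shows "outer_approx 0 (single_law PX PA (W k l)) R \<epsilon>"
proof -
  obtain RS RJ RL where R: "R = (RS, RJ, RL)" by (cases R) auto
  have RS: "0 \<le> RS" and RJ: "0 \<le> RJ"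
    and ev: "\<forall>\<^sub>F \<delta> :: real in at_right 0. \<forall>\<^sub>F n in sequentially.
       \<exists>e \<in> gs_encoders n (rate_set n RJ) (rate_set n RS). \<exists>d \<in> decoders n (rate_set n RJ) (rate_set n RS).
         gs_code PX PA W RS RJ RL \<delta> n e d"
    using ach unfolding R gs_achievable_iff by blast+
  from eventually_slack[OF \<epsilon> RS ev] obtain \<delta> :: real and n e d where d: "0 < \<delta>" "0 < n"
      "1 + \<delta> * (n * RS + 1) \<le> n * (\<epsilon> - 3 * \<delta>)"
    and e: "e \<in> gs_encoders n (rate_set n RJ) (rate_set n RS)"
    and c: "gs_code PX PA W RS RJ RL \<delta> n e d" by metis
  note c = c[unfolded gs_code_def Let_def, rule_format, of k l]
  show ?thesis
    unfolding R by (rule gs_block_outer_approx[where d = d, OF d(2,1) RS RJ e _ _ _ _ _ _ d(3)]; use c in blast)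
qed

definition cs_code ::
  "'x::finite pmf \<Rightarrow> ('x \<Rightarrow> 'a::finite pmf) \<Rightarrow> ('k::finite \<Rightarrow> 'l::finite \<Rightarrow> 'x \<Rightarrow> ('y::finite \<times> 'z::finite) pmf)
   \<Rightarrow> real \<Rightarrow> real \<Rightarrow> real \<Rightarrow> real \<Rightarrow> nat \<Rightarrow> ('a list \<times> nat \<Rightarrow> nat) \<Rightarrow> ('y list \<times> nat \<Rightarrow> nat) \<Rightarrow> bool" where
  "cs_code PX PA W RS RJ RL \<delta> n e d \<longleftrightarrow> (\<forall>k l. let p = pair_pmf (pmf_of_set (rate_set n RS)) (block_law n PX PA (W k l));
                   S = fst;
                   J = (\<lambda>(s, w). e (seqXt w, s));
                   S' = (\<lambda>(s, w). d (seqY w, J (s, w)))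
               in measure_pmf.prob p {w. S' w \<noteq> S w} \<le> \<delta>
                \<and> log 2 (real (card (rate_set n RS))) \<ge> real n * (RS - \<delta>)
                \<and> log 2 (real (card (rate_set n RJ))) \<le> real n * (RJ + \<delta>)
                \<and> mutual_info p S (\<lambda>w. (J w, seqZ (snd w))) \<le> real n * \<delta>
                \<and> cond_mutual_info p (\<lambda>w. seqX (snd w)) J (\<lambda>w. seqZ (snd w)) \<le> real n * (RL + \<delta>))"

lemma cs_achievable_iff:
  "cs_achievable PX PA W (RS, RJ, RL) \<longleftrightarrow> 0 \<le> RS \<and> 0 \<le> RJ \<and> 0 \<le> RL \<and>
     (\<forall>\<^sub>F \<delta> :: real in at_right 0. \<forall>\<^sub>F n in sequentially.
       \<exists>e \<in> cs_encoders n (rate_set n RJ) (rate_set n RS). \<exists>d \<in> decoders n (rate_set n RJ) (rate_set n RS).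
         cs_code PX PA W RS RJ RL \<delta> n e d)"
  unfolding cs_achievable_def cs_code_def prod.case ..

lemma cs_achievable_outer_approx:
  assumes ach: "cs_achievable PX PA W R" and \<epsilon>: "0 < \<epsilon>"
  shows "outer_approx 1 (single_law PX PA (W k l)) R \<epsilon>"
proof -
  obtain RS RJ RL where R: "R = (RS, RJ, RL)" by (cases R) auto
  have RS: "0 \<le> RS" and RJ: "0 \<le> RJ"
    and ev: "\<forall>\<^sub>F \<delta> :: real in at_right 0. \<forall>\<^sub>F n in sequentially.
       \<exists>e \<in> cs_encoders n (rate_set n RJ) (rate_set n RS). \<exists>d \<in> decoders n (rate_set n RJ) (rate_set n RS).
         cs_code PX PA W RS RJ RL \<delta> n e d"
    using ach unfolding R cs_achievable_iff by blast+
  from eventually_slack[OF \<epsilon> RS ev] obtain \<delta> :: real and n e d where d: "0 < \<delta>" "0 < n"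
      "1 + \<delta> * (n * RS + 1) \<le> n * (\<epsilon> - 3 * \<delta>)"
    and e: "e \<in> cs_encoders n (rate_set n RJ) (rate_set n RS)"
    and c: "cs_code PX PA W RS RJ RL \<delta> n e d" by metis
  note c = c[unfolded cs_code_def Let_def, rule_format, of k l]
  show ?thesis
    unfolding R by (rule cs_block_outer_approx[where d = d, OF d(2,1) RS RJ e _ _ _ _ _ d(3)]; use c in blast)
qed

text \<open>The bounds need no continuity in the code: an achievable tuple within
  \<open>\<epsilon> / 2\<close> and a slack of \<open>\<epsilon> / 2\<close> combine to slack
  \<open>\<epsilon>\<close>, and the limit is taken once, in
  \<open>outer_approx_limit\<close>.\<close>

lemma outer_approx_closure:
  assumes R: "R \<in> closure {R. P R}" and P: "\<And>R \<epsilon>. P R \<Longrightarrow> 0 < \<epsilon> \<Longrightarrow> outer_approx \<kappa> s R \<epsilon>"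
  shows "outer_approx \<kappa> s R 0"
proof (rule outer_approx_limit)
  fix \<epsilon> :: real assume "0 < \<epsilon>"
  then obtain R' where R': "P R'" "dist R' R < \<epsilon> / 2"
    using R unfolding closure_approachable by (metis half_gt_zero mem_Collect_eq)
  have "\<bar>fst R' - fst R\<bar> < \<epsilon> / 2" "dist (snd R') (snd R) < \<epsilon> / 2"
    using R'(2) dist_fst_le[of R' R] dist_snd_le[of R' R] by (auto simp: dist_real_def)
  moreover from this(2) have "\<bar>fst (snd R') - fst (snd R)\<bar> < \<epsilon> / 2" "\<bar>snd (snd R') - snd (snd R)\<bar> < \<epsilon> / 2"
    using dist_fst_le[of "snd R'" "snd R"] dist_snd_le[of "snd R'" "snd R"] by (auto simp: dist_real_def)
  moreover have "outer_approx \<kappa> s R' (\<epsilon> / 2)" using P R'(1) \<open>0 < \<epsilon>\<close> by simp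
  ultimately show "outer_approx \<kappa> s R \<epsilon>" unfolding outer_approx_def by (elim exE conjE, intro exI conjI) (assumption | linarith)+
qed

lemma nonneg_closure:
  assumes R: "R \<in> closure {R :: real \<times> real \<times> real. P R}" 
    and P: "\<And>R. P R \<Longrightarrow> 0 \<le> fst R \<and> 0 \<le> fst (snd R) \<and> 0 \<le> snd (snd R)"
  shows "0 \<le> fst R \<and> 0 \<le> fst (snd R) \<and> 0 \<le> snd (snd R)"
proof -
  have "closed {R :: real \<times> real \<times> real. 0 \<le> fst R \<and> 0 \<le> fst (snd R) \<and> 0 \<le> snd (snd R)}"
    by (intro closed_Collect_conj closed_Collect_le continuous_intros)
  then have "closure {R. P R} \<subseteq> {R :: real \<times> real \<times> real. 0 \<le> fst R \<and> 0 \<le> fst (snd R) \<and> 0 \<le> snd (snd R)}"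
    using P by (intro closure_minimal) auto
  then show ?thesis using R by auto
qed

text \<open>The kernel from \<open>U\<close> to \<open>V\<close> is deterministic, so entropies of
  \<open>(U, V)\<close> collapse to those of \<open>U\<close>, and the difference of the conditional
  informations becomes \<open>a - b\<close>. Entropies of source letters alone are those of the
  given law, which the kernel leaves unchanged.\<close>

lemma outer_approx_aux_law:
  fixes PX :: "'x::finite pmf" and PA :: "'x \<Rightarrow> 'a::finite pmf" and V :: "'x \<Rightarrow> ('y::finite \<times> 'z::finite) pmf"
  assumes approx: "outer_approx \<kappa> (single_law PX PA V) (RS, RJ, RL) 0"
    and N1: "CARD('a) + 3 \<le> N1" and N2: "CARD('a) + 5 \<le> N2"
  shows "\<exists>(PV, PU) \<in> aux_kernels N2 (N2 * N1). let q = aux_law PX PA V PV PU; g = cond_mutual_info q rvY rvU rvV - cond_mutual_info q rvZ rvU rvV in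
     RS \<le> g \<and> cond_mutual_info q rvXt rvU rvY + \<kappa> * g \<le> RJ \<and>
     cond_mutual_info q rvX rvU rvY + mutual_info q rvY rvV - mutual_info q rvZ rvV \<le> RL"
proof -
  let ?s = "single_law PX PA V"
  obtain a b c d where hull: "(source_marginal ?s, a, b, c, d) \<in> region_hull ?s"
    and RS: "RS \<le> a - b" and RJ: "ent ?s (\<lambda>w. (fst w, cY w)) - ent ?s cY - c + \<kappa> * (a - b) \<le> RJ"
    and RL: "ent ?s (\<lambda>w. (cX w, cY w)) - ent ?s cY - d + ent ?s cY - ent ?s cZ - a \<le> RL"
    using approx by (auto simp: outer_approx_def)
  define \<phi> where "\<phi> u = u div N1" for u
  obtain L :: "'a \<Rightarrow> nat pmf" where L: "\<And>a. set_pmf (L a) \<subseteq> {..<N2 * N1}"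
    and rp: "region_point (kernel_law ?s fst L) \<phi> = (source_marginal ?s, a, b, c, d)"
    using region_hull_realize[OF hull N1 N2] unfolding \<phi>_def[abs_def] by metis
  define q where "q = kernel_law ?s fst L"
  define p where "p = aux_law PX PA V (\<lambda>u. return_pmf (\<phi> u)) L"
  have p: "p = map_pmf (\<lambda>z. (\<phi> (fst z), fst z, snd z)) q"
    unfolding p_def aux_law_def q_def kernel_law_def
    by (auto simp: map_bind_pmf bind_return_pmf intro!: bind_pmf_cong split: prod.splits)
  have finq: "finite (set_pmf q)"
    unfolding q_def using finite_subset[OF L finite_lessThan] by (intro finite_set_kernel_law) auto
  have finp: "finite (set_pmf p)" using finq by (simp add: p)
  have rv: "rvV (v, z) = v" "rvU (v, z) = fst z" "rvXt (v, z) = fst (snd z)" "rvX (v, z) = cX (snd z)" "rvY (v, z) = cY (snd z)" "rvZ (v, z) = cZ (snd z)" for v and z :: "nat \<times> 'a \<times> 'x \<times> 'y \<times> 'z"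
    by (simp_all add: rvV_def rvU_def rvXt_def rvX_def rvY_def rvZ_def cX_def cY_def cZ_def case_prod_beta)
  have src: "ent ?s X = ent q (\<lambda>z. X (snd z))" for X :: "_ \<Rightarrow> 'q"
    using ent_map[OF finq, of snd X] by (simp add: q_def map_snd_kernel_law)
  have a: "a = joint_ent q cY \<phi> - joint_ent q cZ \<phi>" and b: "b = joint_ent q cY (\<lambda>u. u) - joint_ent q cZ (\<lambda>u. u)"
    and c: "c = joint_ent q (\<lambda>w. (fst w, cY w)) (\<lambda>u. u) - joint_ent q cY (\<lambda>u. u)"
    and d: "d = joint_ent q (\<lambda>w. (cX w, cY w)) (\<lambda>u. u) - joint_ent q cY (\<lambda>u. u)"
    using rp by (simp_all add: region_point_def q_def)
  have cong1: "ent q (\<lambda>z. (g (snd z), fst z, \<phi> (fst z))) = joint_ent q g (\<lambda>u. u)" for g :: "_ \<Rightarrow> 'q"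
    unfolding joint_ent_def by (rule ent_cong[OF finq]) auto
  have cong2: "ent q (\<lambda>z. (g (snd z), fst z, h (snd z))) = joint_ent q (\<lambda>w. (g w, h w)) (\<lambda>u. u)" for g :: "_ \<Rightarrow> 'q" and h :: "_ \<Rightarrow> 'r"
    unfolding joint_ent_def by (rule ent_cong[OF finq]) auto
  have cong3: "ent q (\<lambda>z. (fst z, h (snd z))) = joint_ent q h (\<lambda>u. u)" for h :: "_ \<Rightarrow> 'r"
    unfolding joint_ent_def by (rule ent_cong[OF finq]) auto
  have cong4: "ent q (\<lambda>z. (h (snd z), \<phi> (fst z))) = joint_ent q h \<phi>" for h :: "_ \<Rightarrow> 'r"
    unfolding joint_ent_def ..
  have ep: "ent p X = ent q (\<lambda>z. X (\<phi> (fst z), fst z, snd z))" for X :: "_ \<Rightarrow> 'q"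
    unfolding p by (rule ent_map[OF finq])
  have g: "cond_mutual_info p rvY rvU rvV - cond_mutual_info p rvZ rvU rvV = a - b"
    by (simp add: cond_mutual_info_eq_ent[OF finp] ep rv cong1 cong4 a b)
  have j: "cond_mutual_info p rvXt rvU rvY = ent ?s (\<lambda>w. (fst w, cY w)) - ent ?s cY - c"
    by (simp add: cond_mutual_info_eq_ent[OF finp] ep rv cong2 cong3 c src)
  have l: "cond_mutual_info p rvX rvU rvY + mutual_info p rvY rvV - mutual_info p rvZ rvV
     = ent ?s (\<lambda>w. (cX w, cY w)) - ent ?s cY - d + ent ?s cY - ent ?s cZ - a"
    by (simp add: cond_mutual_info_eq_ent[OF finp] mutual_info_eq_ent[OF finp] ep rv cong2 cong3 cong4 d a src)
  have "((\<lambda>u. return_pmf (\<phi> u)), L) \<in> aux_kernels N2 (N2 * N1)"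
    unfolding aux_kernels_def mem_Collect_eq prod.case
    using L by (intro exI[of _ "{..<N2}"] exI[of _ "{..<N2 * N1}"]) (simp add: \<phi>_def less_mult_imp_div_less)
  then show ?thesis
    by (intro bexI[where x = "((\<lambda>u. return_pmf (\<phi> u)), L)"])
       (use RS RJ RL in \<open>simp_all add: Let_def p_def[symmetric] g j l\<close>)
qed

theorem proposition2:
  fixes PX :: "'x::finite pmf"
    and PA :: "'x \<Rightarrow> 'a::finite pmf"
    and W :: "'k::finite \<Rightarrow> 'l::finite \<Rightarrow> 'x \<Rightarrow> ('y::finite \<times> 'z::finite) pmf"
  shows "let mV = CARD('a) + 2 * (CARD('k) + CARD('l)) + 1;
             mU = mV * (CARD('a) + CARD('k) + CARD('l) + 1)
         in
      gs_capacity_region PX PA W \<subseteq>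
      (\<Inter>k. \<Inter>l. \<Union>(PV, PU) \<in> aux_kernels mV mU. {(RS :: real, RJ :: real, RL :: real).
         let q = aux_law PX PA (W k l) PV PU in
         0 \<le> RS \<and> 0 \<le> RJ \<and> 0 \<le> RL \<and>
         RS \<le> cond_mutual_info q rvY rvU rvV - cond_mutual_info q rvZ rvU rvV \<and>
         RJ \<ge> cond_mutual_info q rvXt rvU rvY \<and>
         RL \<ge> cond_mutual_info q rvX rvU rvY + mutual_info q rvY rvV - mutual_info q rvZ rvV}) \<and>
      cs_capacity_region PX PA W \<subseteq>
      (\<Inter>k. \<Inter>l. \<Union>(PV, PU) \<in> aux_kernels mV mU. {(RS :: real, RJ :: real, RL :: real).
         let q = aux_law PX PA (W k l) PV PU in
         0 \<le> RS \<and> 0 \<le> RJ \<and> 0 \<le> RL \<and>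
         RS \<le> cond_mutual_info q rvY rvU rvV - cond_mutual_info q rvZ rvU rvV \<and>
         RJ \<ge> cond_mutual_info q rvXt rvU rvY
              + cond_mutual_info q rvY rvU rvV - cond_mutual_info q rvZ rvU rvV \<and>
         RL \<ge> cond_mutual_info q rvX rvU rvY + mutual_info q rvY rvV - mutual_info q rvZ rvV})"
proof -
  define N1 where "N1 = CARD('a) + CARD('k) + CARD('l) + 1"
  define N2 where "N2 = CARD('a) + 2 * (CARD('k) + CARD('l)) + 1"
  \<comment> \<open>The numbers of states matter only through this bound: it lifts the stated
    alphabet sizes to those required by Caratheodory's theorem for a single state.\<close>
  have "2 \<le> CARD('k) + CARD('l)" using zero_less_card_finite[where 'a = 'k] zero_less_card_finite[where 'a = 'l] by linarith
  then have N: "CARD('a) + 3 \<le> N1" "CARD('a) + 5 \<le> N2" by (simp_all add: N1_def N2_def)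
  have gs: "outer_approx 0 (single_law PX PA (W k l)) R 0 \<and> 0 \<le> fst R \<and> 0 \<le> fst (snd R) \<and> 0 \<le> snd (snd R)"
    if R: "R \<in> gs_capacity_region PX PA W" for R k l
  proof
    show "outer_approx 0 (single_law PX PA (W k l)) R 0"
      by (rule outer_approx_closure[OF R[unfolded gs_capacity_region_def]]) (rule gs_achievable_outer_approx)
    show "0 \<le> fst R \<and> 0 \<le> fst (snd R) \<and> 0 \<le> snd (snd R)"
      by (rule nonneg_closure[OF R[unfolded gs_capacity_region_def]]) (auto simp: gs_achievable_def)
  qed
  have cs: "outer_approx 1 (single_law PX PA (W k l)) R 0 \<and> 0 \<le> fst R \<and> 0 \<le> fst (snd R) \<and> 0 \<le> snd (snd R)"
    if R: "R \<in> cs_capacity_region PX PA W" for R k l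
  proof
    show "outer_approx 1 (single_law PX PA (W k l)) R 0"
      by (rule outer_approx_closure[OF R[unfolded cs_capacity_region_def]]) (rule cs_achievable_outer_approx)
    show "0 \<le> fst R \<and> 0 \<le> fst (snd R) \<and> 0 \<le> snd (snd R)"
      by (rule nonneg_closure[OF R[unfolded cs_capacity_region_def]]) (auto simp: cs_achievable_def)
  qed
  show ?thesis
    unfolding Let_def N1_def[symmetric] N2_def[symmetric]
  proof (intro conjI subsetI INT_I)
    fix R k l assume "R \<in> gs_capacity_region PX PA W"
    note g = gs[OF this, of k l]
    obtain RS RJ RL where R: "R = (RS, RJ, RL)" by (cases R) auto
    from outer_approx_aux_law[OF conjunct1[OF g, unfolded R] N] g
    show "R \<in> (\<Union>(PV, PU) \<in> aux_kernels N2 (N2 * N1). {(RS, RJ, RL).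
         0 \<le> RS \<and> 0 \<le> RJ \<and> 0 \<le> RL \<and>
         RS \<le> cond_mutual_info (aux_law PX PA (W k l) PV PU) rvY rvU rvV - cond_mutual_info (aux_law PX PA (W k l) PV PU) rvZ rvU rvV \<and>
         RJ \<ge> cond_mutual_info (aux_law PX PA (W k l) PV PU) rvXt rvU rvY \<and>
         RL \<ge> cond_mutual_info (aux_law PX PA (W k l) PV PU) rvX rvU rvY + mutual_info (aux_law PX PA (W k l) PV PU) rvY rvV - mutual_info (aux_law PX PA (W k l) PV PU) rvZ rvV})"
      by (fastforce simp: R Let_def)
  next
    fix R k l assume "R \<in> cs_capacity_region PX PA W"
    note g = cs[OF this, of k l]
    obtain RS RJ RL where R: "R = (RS, RJ, RL)" by (cases R) auto
    from outer_approx_aux_law[OF conjunct1[OF g, unfolded R] N] g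
    show "R \<in> (\<Union>(PV, PU) \<in> aux_kernels N2 (N2 * N1). {(RS, RJ, RL).
         0 \<le> RS \<and> 0 \<le> RJ \<and> 0 \<le> RL \<and>
         RS \<le> cond_mutual_info (aux_law PX PA (W k l) PV PU) rvY rvU rvV - cond_mutual_info (aux_law PX PA (W k l) PV PU) rvZ rvU rvV \<and>
         RJ \<ge> cond_mutual_info (aux_law PX PA (W k l) PV PU) rvXt rvU rvY + cond_mutual_info (aux_law PX PA (W k l) PV PU) rvY rvU rvV - cond_mutual_info (aux_law PX PA (W k l) PV PU) rvZ rvU rvV \<and>
         RL \<ge> cond_mutual_info (aux_law PX PA (W k l) PV PU) rvX rvU rvY + mutual_info (aux_law PX PA (W k l) PV PU) rvY rvV - mutual_info (aux_law PX PA (W k l) PV PU) rvZ rvV})"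
      by (fastforce simp: R Let_def)
  qed
qed

end
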